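(* Let $F:\mathbb{R}\to\mathbb{R}$ be $C^\infty$ and $\lambda>0$, and consider the flow on $\mathbb{R}^3$, with variables $(\omega,\Omega,\theta)$, of $$\epsilon\dot\omega=-\sin(\Omega+\omega)F(\theta),\qquad \dot\Omega=\lambda\omega,\qquad \dot\theta=1 .$$ For $\epsilon$ sufficiently small, there exist infinitely many slow locally invariant manifolds for this flow. They consist of simply connected, compact subsets of $\mathbb{R}^3$ such that $$\omega=(k\pi-\Omega)\left(1+\frac{\epsilon(-1)^k\lambda}{F(\theta)}\right)+O(\epsilon^2),\qquad F(\theta)\neq0,\quad k\in\mathbb{Z}.$$ The manifolds are attracting when $(-1)^{k+1}F(\theta)<0$ and repelling otherwise. The slow flow on these manifolds is $$\omega=-\Omega(0)e^{-\lambda t}+O(\epsilon),\qquad \Omega=k\pi+\Omega(0)e^{-\lambda t}+O(\epsilon),\qquad \theta=t .$$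
   Context: Here $0<\epsilon\ll1$ is the singular perturbation parameter, dots denote $d/dt$, $\omega$ is the fast variable and $\Omega,\theta$ are the slow variables. The terms are those of geometric singular perturbation theory (Fenichel). For $\epsilon=0$ the critical manifolds are subsets of $\{\Omega+\omega=k\pi,\ F(\theta)\neq0\}$, i.e. sets of fixed points of the fast system obtained with the time $\tau=t/\epsilon$. A slow manifold is a manifold lying within $O(\epsilon)$ of such a critical manifold and diffeomorphic to it. Locally invariant means that solutions can leave the manifold only through its boundary. Attracting/repelling refers to the direction transverse to the manifold (the $\omega$ direction).
   Formalization: In the slow flow, Ω(0) is replaced by Ω(0)−kπ (the formula as printed fails at t=0 for k≠0) and θ=t by θ=θ(0)+t; F is assumed not identically zero, since otherwise no critical manifold with F(θ)≠0 exists. *)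

theory Defs
  imports "HOL-Analysis.Analysis"
begin

section \<open>Smooth maps, diffeomorphisms and surfaces with boundary\<close>

text \<open>The following notions of differentiability are meant for open sets. In finite dimension,
  \<open>C\<^sup>n\<close> is the existence of all iterated directional derivatives as total derivatives
  up to order \<open>n\<close>, with continuity of those of order \<open>n\<close>.\<close>

primrec Ck_on :: "nat \<Rightarrow> 'a::euclidean_space set \<Rightarrow> ('a \<Rightarrow> 'b::real_normed_vector) \<Rightarrow> bool" where
  "Ck_on 0 S f \<longleftrightarrow> continuous_on S f"
| "Ck_on (Suc n) S f \<longleftrightarrow>
     (\<forall>x\<in>S. f differentiable (at x)) \<and> (\<forall>v. Ck_on n S (\<lambda>x. frechet_derivative f (at x) v))"

definition smooth_on :: "'a::euclidean_space set \<Rightarrow> ('a \<Rightarrow> 'b::real_normed_vector) \<Rightarrow> bool" where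
  "smooth_on S f \<longleftrightarrow> (\<forall>n. Ck_on n S f)"

text \<open>Diffeomorphism of arbitrary subsets of Euclidean space: the map and its inverse have smooth
  extensions to open neighbourhoods.\<close>

definition diffeomorphic :: "'a::euclidean_space set \<Rightarrow> 'b::euclidean_space set \<Rightarrow> bool" where
  "diffeomorphic M N \<longleftrightarrow>
     (\<exists>U V f g. open U \<and> M \<subseteq> U \<and> open V \<and> N \<subseteq> V \<and>
        smooth_on U f \<and> smooth_on V g \<and> homeomorphism M N f g)"

type_synonym state = "real \<times> real \<times> real"

text \<open>Near \<open>p\<close> there are smooth coordinates of the ambient space in which \<open>M\<close>
  becomes the model set \<open>H\<close>.\<close>

definition straightens_to :: "state set \<Rightarrow> state set \<Rightarrow> state \<Rightarrow> bool" where
  "straightens_to M H p \<longleftrightarrow>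
     (\<exists>U V f g. open U \<and> open V \<and> p \<in> U \<and> smooth_on U f \<and> smooth_on V g \<and>
        homeomorphism U V f g \<and> f ` (M \<inter> U) = H \<inter> V)"

definition smooth_surface :: "state set \<Rightarrow> bool" where
  "smooth_surface M \<longleftrightarrow>
     (\<forall>p\<in>M. straightens_to M {(x, y, z). x = 0} p \<or> straightens_to M {(x, y, z). x = 0 \<and> y \<ge> 0} p)"

definition surface_boundary :: "state set \<Rightarrow> state set" where
  "surface_boundary M = {p \<in> M. \<not> straightens_to M {(x, y, z). x = 0} p}"


section \<open>The flow\<close>

text \<open>States are triples \<open>(\<omega>, \<Omega>, \<theta>)\<close>; time is the slow time \<open>t\<close>.\<close>

definition field :: "(real \<Rightarrow> real) \<Rightarrow> real \<Rightarrow> real \<Rightarrow> state \<Rightarrow> state" where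
  "field F lam \<epsilon> = (\<lambda>(\<omega>, \<Omega>, \<theta>). (- sin (\<Omega> + \<omega>) * F \<theta> / \<epsilon>, lam * \<omega>, 1))"

definition solution :: "(state \<Rightarrow> state) \<Rightarrow> (real \<Rightarrow> state) \<Rightarrow> real set \<Rightarrow> bool" where
  "solution X x J \<longleftrightarrow> (\<forall>t\<in>J. (x has_vector_derivative X (x t)) (at t within J))"

text \<open>A solution can leave \<open>M\<close>, in forward or in backward time, only at a boundary point:
  while it is at any other point of \<open>M\<close> it stays in \<open>M\<close> for all nearby times. For compact
  \<open>M\<close> a solution that leaves \<open>M\<close> has a last instant before leaving, at which it is in \<open>M\<close>.\<close>

definition locally_invariant :: "(state \<Rightarrow> state) \<Rightarrow> state set \<Rightarrow> bool" where
  "locally_invariant X M \<longleftrightarrow>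
     (\<forall>x a b. solution X x {a..b} \<longrightarrow>
        (\<forall>s\<in>{a..b}. x s \<in> M - surface_boundary M \<longrightarrow>
           (\<exists>\<delta>>0. \<forall>t\<in>{a..b}. \<bar>t - s\<bar> < \<delta> \<longrightarrow> x t \<in> M)))"


section \<open>Critical and slow manifolds\<close>

definition critical_manifold :: "(real \<Rightarrow> real) \<Rightarrow> int \<Rightarrow> state set \<Rightarrow> bool" where
  "critical_manifold F k M0 \<longleftrightarrow>
     M0 \<noteq> {} \<and> compact M0 \<and> simply_connected M0 \<and> smooth_surface M0 \<and>
     M0 \<subseteq> {(\<omega>, \<Omega>, \<theta>). \<Omega> + \<omega> = of_int k * pi \<and> F \<theta> \<noteq> 0}"

text \<open>A slow manifold is a family \<open>M \<epsilon>\<close>, \<open>0 < \<epsilon> < \<epsilon>0\<close>; being within \<open>O(\<epsilon>)\<close> refers to the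
  Hausdorff distance.\<close>

definition slow_manifold :: "state set \<Rightarrow> real \<Rightarrow> (real \<Rightarrow> state set) \<Rightarrow> bool" where
  "slow_manifold M0 \<epsilon>0 M \<longleftrightarrow>
     (\<forall>\<epsilon>\<in>{0<..<\<epsilon>0}. smooth_surface (M \<epsilon>) \<and> diffeomorphic M0 (M \<epsilon>)) \<and>
     (\<exists>C. \<forall>\<epsilon>\<in>{0<..<\<epsilon>0}. (\<forall>p\<in>M \<epsilon>. infdist p M0 \<le> C * \<epsilon>) \<and> (\<forall>q\<in>M0. infdist q (M \<epsilon>) \<le> C * \<epsilon>))"

text \<open>\<open>M \<epsilon>\<close> is the graph of \<open>\<omega> = h \<epsilon> \<Omega> \<theta>\<close> over the projection of \<open>M0\<close> to the
  \<open>(\<Omega>, \<theta>)\<close>-plane, with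
  \<open>h \<epsilon> \<Omega> \<theta> = (k\<pi> - \<Omega>)(1 + \<epsilon>(-1)\<^sup>k lam / F \<theta>) + O(\<epsilon>\<^sup>2)\<close> uniformly.\<close>

definition slow_expansion ::
    "(real \<Rightarrow> real) \<Rightarrow> real \<Rightarrow> int \<Rightarrow> state set \<Rightarrow> real \<Rightarrow> (real \<Rightarrow> state set) \<Rightarrow> bool" where
  "slow_expansion F lam k M0 \<epsilon>0 M \<longleftrightarrow>
     (\<exists>h C. \<forall>\<epsilon>\<in>{0<..<\<epsilon>0}.
        M \<epsilon> = (\<lambda>(\<omega>, \<Omega>, \<theta>). (h \<epsilon> \<Omega> \<theta>, \<Omega>, \<theta>)) ` M0 \<and>
        (\<forall>(\<omega>, \<Omega>, \<theta>)\<in>M0.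
           \<bar>h \<epsilon> \<Omega> \<theta> - (of_int k * pi - \<Omega>) * (1 + \<epsilon> * (-1) powi k * lam / F \<theta>)\<bar> \<le> C * \<epsilon>\<^sup>2))"

text \<open>Attraction in the \<open>\<omega>\<close> direction: as long as a solution remains over the base of
  \<open>M \<epsilon>\<close>, \<open>w t\<close> is the \<open>\<omega>\<close>-coordinate of a point of \<open>M \<epsilon>\<close> above
  \<open>(\<Omega> t, \<theta> t)\<close>. The size \<open>\<delta>\<close> of the attracted neighbourhood and the rate \<open>\<mu>\<close> (in the
  fast time \<open>t/\<epsilon>\<close>) do not depend on \<open>\<epsilon>\<close>.\<close>

definition attracting :: "(real \<Rightarrow> state \<Rightarrow> state) \<Rightarrow> real \<Rightarrow> (real \<Rightarrow> state set) \<Rightarrow> bool" where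
  "attracting X \<epsilon>0 M \<longleftrightarrow>
     (\<exists>\<delta>>0. \<exists>\<mu>>0. \<exists>K. \<forall>\<epsilon>\<in>{0<..<\<epsilon>0}. \<forall>\<omega> \<Omega> \<theta> w T.
        solution (X \<epsilon>) (\<lambda>t. (\<omega> t, \<Omega> t, \<theta> t)) {0..T} \<and>
        (\<forall>t\<in>{0..T}. (w t, \<Omega> t, \<theta> t) \<in> M \<epsilon>) \<and> \<bar>\<omega> 0 - w 0\<bar> < \<delta> \<longrightarrow>
        (\<forall>t\<in>{0..T}. \<bar>\<omega> t - w t\<bar> \<le> K * exp (- \<mu> * t / \<epsilon>) * \<bar>\<omega> 0 - w 0\<bar>))"

definition repelling :: "(real \<Rightarrow> state \<Rightarrow> state) \<Rightarrow> real \<Rightarrow> (real \<Rightarrow> state set) \<Rightarrow> bool" where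
  "repelling X \<epsilon>0 M \<longleftrightarrow> attracting (\<lambda>\<epsilon> p. - X \<epsilon> p) \<epsilon>0 M"

text \<open>The slow flow on \<open>M \<epsilon>\<close>. The constant of integration multiplying \<open>exp (- lam * t)\<close> is
  the initial value of the slow variable measured from the equilibrium \<open>k\<pi>\<close>, that is
  \<open>\<Omega> 0 - k\<pi>\<close>. With the time origin such that \<open>\<theta> 0 = 0\<close>, the last equation is \<open>\<theta> t = t\<close>.\<close>

definition slow_flow ::
    "(real \<Rightarrow> real) \<Rightarrow> real \<Rightarrow> int \<Rightarrow> real \<Rightarrow> (real \<Rightarrow> state set) \<Rightarrow> bool" where
  "slow_flow F lam k \<epsilon>0 M \<longleftrightarrow>
     (\<exists>C. \<forall>\<epsilon>\<in>{0<..<\<epsilon>0}. \<forall>\<omega> \<Omega> \<theta> a b. 0 \<in> {a..b} \<and>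
        solution (field F lam \<epsilon>) (\<lambda>t. (\<omega> t, \<Omega> t, \<theta> t)) {a..b} \<and>
        (\<forall>t\<in>{a..b}. (\<omega> t, \<Omega> t, \<theta> t) \<in> M \<epsilon>) \<longrightarrow>
        (\<forall>t\<in>{a..b}.
           \<bar>\<omega> t - (- (\<Omega> 0 - of_int k * pi) * exp (- lam * t))\<bar> \<le> C * \<epsilon> \<and>
           \<bar>\<Omega> t - (of_int k * pi + (\<Omega> 0 - of_int k * pi) * exp (- lam * t))\<bar> \<le> C * \<epsilon> \<and>
           \<theta> t = \<theta> 0 + t))"

definition perturbs_to ::
    "(real \<Rightarrow> real) \<Rightarrow> real \<Rightarrow> int \<Rightarrow> state set \<Rightarrow> real \<Rightarrow> (real \<Rightarrow> state set) \<Rightarrow> bool" where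
  "perturbs_to F lam k M0 \<epsilon>0 M \<longleftrightarrow>
     slow_manifold M0 \<epsilon>0 M \<and>
     (\<forall>\<epsilon>\<in>{0<..<\<epsilon>0}. locally_invariant (field F lam \<epsilon>) (M \<epsilon>) \<and>
        compact (M \<epsilon>) \<and> simply_connected (M \<epsilon>)) \<and>
     slow_expansion F lam k M0 \<epsilon>0 M \<and>
     (if \<forall>(\<omega>, \<Omega>, \<theta>)\<in>M0. (-1) powi (k + 1) * F \<theta> < 0
      then attracting (field F lam) \<epsilon>0 M else repelling (field F lam) \<epsilon>0 M) \<and>
     slow_flow F lam k \<epsilon>0 M"

end

theory Submission
  imports Defs
begin

text \<open>With \<open>x = \<Omega> - k\<pi>\<close>, \<open>u = x + \<omega>\<close> and \<open>G = (-1)\<^sup>k F\<close>, a graph \<open>u = h(x, \<theta>)\<close> is invariant iff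
  \<open>h\<^sub>\<theta> = - (G/\<epsilon>) sin h - \<lambda> (h - x) (h\<^sub>x - 1)\<close>. Since \<open>x = u = 0\<close> is a solution, \<open>h\<close> can be sought as a power
  series \<open>\<Sum> a\<^sub>n(\<theta>) x\<^sup>n\<close>: \<open>a\<^sub>1\<close> solves a stiff Riccati equation, and each later \<open>a\<^sub>n\<close> a scalar linear equation
  whose strong damping \<open>G/\<epsilon>\<close> makes it small. A Cauchy-Kovalevskaya majorant, with a radius of convergence that
  shrinks with \<open>\<theta>\<close>, gives convergence for \<open>|x| < R\<close> once \<open>\<epsilon>\<close> is small, and the equation itself then yields
  smoothness in \<open>\<theta>\<close>. No cut-off, hence no loss of smoothness, is involved. The deviation of a solution from
  the graph satisfies a scalar equation, from which local invariance and attraction follow; repelling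
  manifolds are treated by reversing time. Only the parity of \<open>k\<close> matters, so \<open>\<epsilon>\<close> can be chosen uniformly in \<open>k\<close>.\<close>

section \<open>Calculus of smooth maps\<close>

text \<open>Fenichel's theorem yields graphs of class C^r with an \<epsilon>-range depending on r,
  whereas \<open>smooth_surface\<close> asks for all orders on one range. The equation is analytic
  in \<open>x\<close>, which makes a series available; \<open>F\<close> is merely smooth, so
  \<theta> remains a parameter. The obstacle is the transport term: \<open>h\<^sub>x\<close>
  produces a factor of order n, so for \<lambda> > 0 the equation of \<open>a\<^sub>n\<close>
  contains a growth rate of about \<lambda>(n + 1), which overtakes the damping
  \<open>G/\<epsilon>\<close> once n is of order 1/\<epsilon>. Damping alone cannot bound all
  coefficients; dividing \<open>a\<^sub>n\<close> by the n-th power of an increasing weight adds a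
  damping that is itself proportional to n. Invariance prescribes no initial data, as slow manifolds
  are not unique. At the left end of the \<theta>-interval the linear coefficient gets its
  leading-order equilibrium value and the later ones get 0, so no initial layer appears. The graph
  is built over a box containing the projection of the critical manifold. The manifold itself is
  then moved by an ambient shear in the \<omega> direction, so its shape is arbitrary and its charts
  and topology carry over.\<close>

lemma frechet_derivative_eqI:
  "(f has_derivative f') (at x) \<Longrightarrow> frechet_derivative f (at x) = f'"
  by (rule frechet_derivative_at[symmetric])

text \<open>Openness of \<open>S\<close> matters: \<open>frechet_derivative f (at x)\<close> depends
  on \<open>f\<close> near \<open>x\<close>, so agreement on \<open>S\<close> transfers derivatives
  only if \<open>S\<close> is a neighbourhood of \<open>x\<close>.\<close>

lemma Ck_on_cong_imp:
  assumes "open S" "\<And>x. x \<in> S \<Longrightarrow> f x = g x" "Ck_on n S f"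
  shows "Ck_on n S g"
  using assms(2,3)
proof (induction n arbitrary: f g)
  case 0
  then show ?case using continuous_on_cong[OF refl, of S f g] by simp
next
  case (Suc n)
  have d: "(g has_derivative frechet_derivative f (at x)) (at x)" if "x \<in> S" for x
    by (rule has_derivative_transform_within_open[OF _ assms(1) that Suc.prems(1)])
       (use Suc.prems(2) that in \<open>auto simp: frechet_derivative_works\<close>)
  have "Ck_on n S (\<lambda>x. frechet_derivative g (at x) v)" for v
  proof (rule Suc.IH)
    show "Ck_on n S (\<lambda>x. frechet_derivative f (at x) v)" using Suc.prems by simp
    show "frechet_derivative f (at x) v = frechet_derivative g (at x) v" if "x \<in> S" for x
      using frechet_derivative_eqI[OF d[OF that]] by simp
  qed
  then show ?case using d by (auto simp: differentiable_def)
qed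

text \<open>By uniqueness of derivatives, an explicit \<open>f'\<close> may stand in for the
  operator \<open>frechet_derivative\<close>.\<close>

lemma Ck_on_SucI:
  assumes "open S" "\<And>x. x \<in> S \<Longrightarrow> (f has_derivative f' x) (at x)" "\<And>v. Ck_on n S (\<lambda>x. f' x v)"
  shows "Ck_on (Suc n) S f"
proof -
  have "Ck_on n S (\<lambda>x. frechet_derivative f (at x) v)" for v
    by (rule Ck_on_cong_imp[OF assms(1) _ assms(3)[of v]]) (simp add: frechet_derivative_eqI[OF assms(2)])
  then show ?thesis using assms(2) by (auto simp: differentiable_def)
qed

lemma Ck_on_SucD:
  assumes "Ck_on (Suc n) S f"
  shows "x \<in> S \<Longrightarrow> (f has_derivative frechet_derivative f (at x)) (at x)"
    and "Ck_on n S (\<lambda>x. frechet_derivative f (at x) v)"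
  using assms by (auto simp: frechet_derivative_works)

lemma Ck_on_Suc_imp: "Ck_on (Suc n) S f \<Longrightarrow> Ck_on n S f"
proof (induction n arbitrary: f)
  case 0
  then show ?case
    by (auto intro!: continuous_at_imp_continuous_on differentiable_imp_continuous_within)
next
  case (Suc n)
  show ?case unfolding Ck_on.simps(2)[of n]
  proof (intro conjI allI)
    show "\<forall>x\<in>S. f differentiable at x" using Suc.prems by simp
    show "Ck_on n S (\<lambda>x. frechet_derivative f (at x) v)" for v
      by (rule Suc.IH) (rule Ck_on_SucD(2)[OF Suc.prems])
  qed
qed

lemma Ck_on_imp_continuous_on: "Ck_on n S f \<Longrightarrow> continuous_on S f"
proof (induction n)
  case (Suc n)
  then show ?case using Ck_on_Suc_imp by blast
qed simp

lemma Ck_on_subset: "Ck_on n S f \<Longrightarrow> T \<subseteq> S \<Longrightarrow> Ck_on n T f"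
  by (induction n arbitrary: f) (auto intro: continuous_on_subset)

lemma Ck_on_const: "open S \<Longrightarrow> Ck_on n S (\<lambda>x. c)"
proof (induction n arbitrary: c)
  case (Suc n)
  show ?case by (rule Ck_on_SucI[where f' = "\<lambda>x v. 0"]) (use Suc in auto)
qed simp

lemma Ck_on_bounded_linear_comp:
  assumes "bounded_linear L" "open S" "Ck_on n S f"
  shows "Ck_on n S (\<lambda>x. L (f x))"
  using assms(3)
proof (induction n arbitrary: f)
  case 0
  then show ?case using assms(1) by (simp add: bounded_linear.continuous_on)
next
  case (Suc n)
  show ?case
    by (rule Ck_on_SucI[where f' = "\<lambda>x v. L (frechet_derivative f (at x) v)"])
       (use Suc assms in \<open>auto intro!: bounded_linear.has_derivative[OF assms(1)] Ck_on_SucD(1)[OF Suc.prems]\<close>)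
qed

lemma Ck_on_id: "open S \<Longrightarrow> Ck_on n S (\<lambda>x. x)"
proof (cases n)
  case (Suc m)
  assume "open S"
  then show ?thesis unfolding Suc
    by (intro Ck_on_SucI[where f' = "\<lambda>x v. v"]) (auto intro!: Ck_on_const)
qed simp

lemma Ck_on_linear: "bounded_linear L \<Longrightarrow> open S \<Longrightarrow> Ck_on n S L"
  using Ck_on_bounded_linear_comp[OF _ _ Ck_on_id] by blast

lemma Ck_on_add:
  assumes "open S" "Ck_on n S f" "Ck_on n S g"
  shows "Ck_on n S (\<lambda>x. f x + g x)"
  using assms(2,3)
proof (induction n arbitrary: f g)
  case 0
  then show ?case by (simp add: continuous_on_add)
next
  case (Suc n)
  show ?case
    by (rule Ck_on_SucI[where f' = "\<lambda>x v. frechet_derivative f (at x) v + frechet_derivative g (at x) v"])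
       (use assms(1) Suc.IH Ck_on_SucD[OF Suc.prems(1)] Ck_on_SucD[OF Suc.prems(2)] in
         \<open>auto intro!: has_derivative_add\<close>)
qed

lemma Ck_on_scaleR:
  fixes f :: "'a::euclidean_space \<Rightarrow> real"
  assumes "open S" "Ck_on n S f" "Ck_on n S g"
  shows "Ck_on n S (\<lambda>x. f x *\<^sub>R g x)"
  using assms(2,3)
proof (induction n arbitrary: f g)
  case 0
  then show ?case by (simp add: continuous_on_scaleR)
next
  case (Suc n)
  show ?case
  proof (rule Ck_on_SucI[where f' = "\<lambda>x v. f x *\<^sub>R frechet_derivative g (at x) v + frechet_derivative f (at x) v *\<^sub>R g x"])
    fix v
    show "Ck_on n S (\<lambda>x. f x *\<^sub>R frechet_derivative g (at x) v + frechet_derivative f (at x) v *\<^sub>R g x)"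
      by (intro Ck_on_add Suc.IH assms(1) Ck_on_SucD(2)[OF Suc.prems(1)] Ck_on_SucD(2)[OF Suc.prems(2)]
          Ck_on_Suc_imp[OF Suc.prems(1)] Ck_on_Suc_imp[OF Suc.prems(2)])
  qed (use assms(1) Ck_on_SucD(1)[OF Suc.prems(1)] Ck_on_SucD(1)[OF Suc.prems(2)] in
        \<open>auto intro!: has_derivative_scaleR\<close>)
qed

lemma Ck_on_mult:
  fixes f g :: "'a::euclidean_space \<Rightarrow> real"
  assumes "open S" "Ck_on n S f" "Ck_on n S g"
  shows "Ck_on n S (\<lambda>x. f x * g x)"
  using Ck_on_scaleR[OF assms] by simp

lemma Ck_on_minus: "open S \<Longrightarrow> Ck_on n S f \<Longrightarrow> Ck_on n S (\<lambda>x. - f x)"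
  by (rule Ck_on_bounded_linear_comp) (simp_all add: bounded_linear_minus[OF bounded_linear_ident])

lemma Ck_on_diff: "open S \<Longrightarrow> Ck_on n S f \<Longrightarrow> Ck_on n S g \<Longrightarrow> Ck_on n S (\<lambda>x. f x - g x)"
  using Ck_on_add[OF _ _ Ck_on_minus, of S n f g] by simp

lemma Ck_on_sum:
  "open S \<Longrightarrow> (\<And>i. i \<in> I \<Longrightarrow> Ck_on n S (f i)) \<Longrightarrow> Ck_on n S (\<lambda>x. \<Sum>i\<in>I. f i x)"
  by (induction I rule: infinite_finite_induct) (auto intro: Ck_on_const Ck_on_add)

lemma Ck_on_Pair:
  assumes "open S" "Ck_on n S f" "Ck_on n S g"
  shows "Ck_on n S (\<lambda>x. (f x, g x))"
proof -
  have "Ck_on n S (\<lambda>x. (f x, 0) + (0, g x))"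
    by (intro Ck_on_add assms Ck_on_bounded_linear_comp[OF _ _ assms(2), of "\<lambda>y. (y, 0)"]
        Ck_on_bounded_linear_comp[OF _ _ assms(3), of "\<lambda>y. (0, y)"] bounded_linear_Pair
        bounded_linear_ident bounded_linear_zero)
  then show ?thesis by simp
qed

lemma Ck_on_compose:
  fixes f :: "'a::euclidean_space \<Rightarrow> 'b::euclidean_space" and g :: "'b \<Rightarrow> 'c::real_normed_vector"
  assumes "open S" "open T" "f ` S \<subseteq> T" "Ck_on n S f" "Ck_on n T g"
  shows "Ck_on n S (\<lambda>x. g (f x))"
  using assms(4,5)
proof (induction n arbitrary: g)
  case 0
  then show ?case using assms(3) by (simp add: continuous_on_compose2)
next
  case (Suc n)
  let ?f = "\<lambda>x. frechet_derivative f (at x)" and ?g = "\<lambda>y. frechet_derivative g (at y)"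
  have d: "((\<lambda>x. g (f x)) has_derivative (\<lambda>v. ?g (f x) (?f x v))) (at x)" if "x \<in> S" for x
    using that assms(3)
    by (intro has_derivative_compose[of f _ x UNIV g, simplified] Ck_on_SucD(1)[OF Suc.prems(1)]
        Ck_on_SucD(1)[OF Suc.prems(2)]) auto
  \<comment> \<open>\<open>Ck_on\<close> speaks of derivatives in a fixed direction, but the chain
    rule evaluates the derivative of \<open>g\<close> in the moving direction \<open>?f x v\<close>.
    Expansion in \<open>Basis\<close> leaves fixed directions with coefficients covered by
    \<open>Ck_on_scaleR\<close>.\<close>
  have eq: "?g (f x) (?f x v) = (\<Sum>b\<in>Basis. (?f x v \<bullet> b) *\<^sub>R ?g (f x) b)" if "x \<in> S" for x v
  proof -
    have "linear (?g (f x))"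
      using Ck_on_SucD(1)[OF Suc.prems(2), of "f x"] that assms(3) by (auto dest: has_derivative_linear)
    then have "?g (f x) (\<Sum>b\<in>Basis. (?f x v \<bullet> b) *\<^sub>R b) = (\<Sum>b\<in>Basis. (?f x v \<bullet> b) *\<^sub>R ?g (f x) b)"
      by (simp add: linear_sum linear_cmul)
    then show ?thesis by (simp add: euclidean_representation)
  qed
  show ?case
  proof (rule Ck_on_SucI[OF assms(1) d])
    fix v
    have "Ck_on n S (\<lambda>x. \<Sum>b\<in>Basis. (?f x v \<bullet> b) *\<^sub>R ?g (f x) b)"
      by (intro Ck_on_sum Ck_on_scaleR assms(1) Suc.IH[OF Ck_on_Suc_imp[OF Suc.prems(1)]]
          Ck_on_SucD(2)[OF Suc.prems(2)] Ck_on_bounded_linear_comp[OF bounded_linear_inner_left]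
          Ck_on_SucD(2)[OF Suc.prems(1)])
    then show "Ck_on n S (\<lambda>x. ?g (f x) (?f x v))"
      by (rule Ck_on_cong_imp[OF assms(1) eq[symmetric], rotated])
  qed
qed

lemma Ck_on_real_SucI:
  fixes f :: "real \<Rightarrow> real"
  assumes "open S" "\<And>x. x \<in> S \<Longrightarrow> (f has_real_derivative f' x) (at x)" "Ck_on n S f'"
  shows "Ck_on (Suc n) S f"
  by (rule Ck_on_SucI[where f' = "\<lambda>x v. f' x * v"])
     (use assms in \<open>auto simp: has_field_derivative_def intro!: Ck_on_mult Ck_on_const\<close>)

lemma Ck_on_sin_cos: "Ck_on n UNIV (sin :: real \<Rightarrow> real) \<and> Ck_on n UNIV (cos :: real \<Rightarrow> real)"
proof (induction n)
  case 0
  show ?case by (auto intro: continuous_intros)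
next
  case (Suc n)
  have "Ck_on (Suc n) UNIV (sin :: real \<Rightarrow> real)"
    by (rule Ck_on_real_SucI[where f' = cos]) (use Suc in \<open>auto intro!: derivative_eq_intros\<close>)
  moreover have "Ck_on (Suc n) UNIV (cos :: real \<Rightarrow> real)"
    by (rule Ck_on_real_SucI[where f' = "\<lambda>x. - sin x"])
       (use Suc in \<open>auto intro!: Ck_on_minus derivative_eq_intros\<close>)
  ultimately show ?case by blast
qed

text \<open>The derivative is a polynomial in \<open>inverse\<close> itself, so the induction closes
  with products.\<close>

lemma Ck_on_inverse: "Ck_on n (- {0}) (inverse :: real \<Rightarrow> real)"
proof (induction n)
  case 0
  show ?case using continuous_on_inverse[OF continuous_on_id, of "- {0::real}"] by simp
next
  case (Suc n)
  have "(inverse has_real_derivative - (inverse x * inverse x)) (at x)" if "x \<in> - {0::real}" for x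
    using DERIV_inverse[of x UNIV] that by simp
  moreover have "Ck_on n (- {0}) (\<lambda>x::real. - (inverse x * inverse x))"
    by (intro Ck_on_minus Ck_on_mult Suc open_Compl closed_singleton)
  ultimately show ?case by (intro Ck_on_real_SucI open_Compl closed_singleton)
qed

lemma smooth_on_real_deriv:
  fixes f :: "real \<Rightarrow> real"
  assumes "smooth_on UNIV f"
  shows "(f has_real_derivative deriv f x) (at x)" "continuous_on UNIV (deriv f)"
proof -
  have 1: "Ck_on 1 UNIV f" using assms by (auto simp: smooth_on_def simp del: Ck_on.simps)
  have d: "(f has_derivative frechet_derivative f (at x)) (at x)" for x
    using Ck_on_SucD(1)[OF 1[unfolded One_nat_def]] by simp
  then have "f field_differentiable at x" for x
    by (metis differentiable_def real_differentiable_def field_differentiable_def)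
  then show *: "(f has_real_derivative deriv f x) (at x)" for x
    using field_differentiable_derivI by blast
  have "deriv f = (\<lambda>x. frechet_derivative f (at x) 1)"
  proof
    show "deriv f x = frechet_derivative f (at x) 1" for x
      using frechet_derivative_eqI[OF *[of x, unfolded has_field_derivative_def]] by simp
  qed
  then show "continuous_on UNIV (deriv f)"
    using Ck_on_SucD(2)[OF 1[unfolded One_nat_def], of 1] by simp
qed

section \<open>Scalar differential equations and majorants\<close>

lemma nonincreasing_on_Icc:
  fixes f f' :: "real \<Rightarrow> real"
  assumes der: "\<And>t. t \<in> {a..b} \<Longrightarrow> (f has_real_derivative f' t) (at t within {a..b})"
    and le: "\<And>t. t \<in> {a..b} \<Longrightarrow> f' t \<le> 0" and xy: "a \<le> x" "x \<le> y" "y \<le> b"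
  shows "f y \<le> f x"
proof (rule DERIV_nonpos_imp_decreasing_open[OF xy(2)])
  show "\<exists>d. DERIV f t :> d \<and> d \<le> 0" if "x < t" "t < y" for t
    using der[of t] le[of t] that xy by (auto simp: at_within_Icc_at)
  have "continuous_on {a..b} f"
    by (rule DERIV_continuous_on[OF der])
  then show "continuous_on {x..y} f" by (rule continuous_on_subset) (use xy in auto)
qed

text \<open>With the integrating factor \<open>exp (P t)\<close>, the derivative of
  \<open>(e - B) * exp P\<close> is \<open>(r - B * p) * exp P\<close>, which is not positive. The
  bound is the quasi-static one, source over damping, and depends neither on the length of the
  interval nor on the size of \<open>p\<close>; this makes it fit for damping of order
  1/\<epsilon>.\<close>

lemma linear_ode_upper_bound:
  fixes e p r :: "real \<Rightarrow> real"
  assumes der: "\<And>t. t \<in> {a..b} \<Longrightarrow> (e has_real_derivative - p t * e t + r t) (at t within {a..b})"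
    and p: "continuous_on {a..b} p" and r: "\<And>t. t \<in> {a..b} \<Longrightarrow> r t \<le> B * p t"
    and init: "e a \<le> B" and t: "t \<in> {a..b}"
  shows "e t \<le> B"
proof -
  define P where "P t = integral {a..t} p" for t
  have P: "(P has_real_derivative p t) (at t within {a..b})" if "t \<in> {a..b}" for t
    unfolding P_def by (rule integral_has_real_derivative[OF p that])
  have "(e t - B) * exp (P t) \<le> (e a - B) * exp (P a)"
  proof (rule nonincreasing_on_Icc[where a = a and b = b and f = "\<lambda>t. (e t - B) * exp (P t)"
        and f' = "\<lambda>s. (r s - B * p s) * exp (P s)"])
    fix s assume s: "s \<in> {a..b}"
    show "((\<lambda>t. (e t - B) * exp (P t)) has_real_derivative (r s - B * p s) * exp (P s)) (at s within {a..b})"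
      by (rule derivative_eq_intros der[OF s] P[OF s] refl)+ (simp add: algebra_simps)
    show "(r s - B * p s) * exp (P s) \<le> 0" using r[OF s] by (simp add: mult_le_0_iff)
  qed (use t in auto)
  also have "\<dots> \<le> 0" using init by (simp add: mult_le_0_iff)
  finally show ?thesis by (simp add: mult_le_0_iff)
qed

lemma linear_ode_bound:
  fixes e p r :: "real \<Rightarrow> real"
  assumes der: "\<And>t. t \<in> {a..b} \<Longrightarrow> (e has_real_derivative - p t * e t + r t) (at t within {a..b})"
    and p: "continuous_on {a..b} p" and r: "\<And>t. t \<in> {a..b} \<Longrightarrow> \<bar>r t\<bar> \<le> B * p t"
    and init: "\<bar>e a\<bar> \<le> B" and t: "t \<in> {a..b}"
  shows "\<bar>e t\<bar> \<le> B"
proof -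
  have "e t \<le> B"
    by (rule linear_ode_upper_bound[OF der p _ _ t]) (use r init in \<open>auto simp: abs_le_iff\<close>)
  moreover have "- e t \<le> B"
  proof (rule linear_ode_upper_bound[where e = "\<lambda>t. - e t" and r = "\<lambda>t. - r t", OF _ p _ _ t])
    show "((\<lambda>t. - e t) has_real_derivative - p s * - e s + - r s) (at s within {a..b})"
      if "s \<in> {a..b}" for s
      by (rule derivative_eq_intros der[OF that] refl)+ simp
  qed (use r init in \<open>auto simp: abs_le_iff\<close>)
  ultimately show ?thesis by simp
qed

lemma linear_ode_exists:
  fixes p r :: "real \<Rightarrow> real"
  assumes p: "continuous_on {a..b} p" and r: "continuous_on {a..b} r"
  shows "\<exists>y. y a = y0 \<and> (\<forall>t\<in>{a..b}. (y has_real_derivative - p t * y t + r t) (at t within {a..b}))"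
proof -
  define P where "P t = integral {a..t} p" for t
  have P: "(P has_real_derivative p t) (at t within {a..b})" if "t \<in> {a..b}" for t
    unfolding P_def by (rule integral_has_real_derivative[OF p that])
  have "continuous_on {a..b} P"
    by (rule DERIV_continuous_on[OF P])
  then have "continuous_on {a..b} (\<lambda>s. exp (P s) * r s)" by (intro continuous_intros r)
  then have I: "((\<lambda>t. integral {a..t} (\<lambda>s. exp (P s) * r s)) has_real_derivative exp (P t) * r t)
      (at t within {a..b})" if "t \<in> {a..b}" for t
    using integral_has_real_derivative that by blast
  define y where "y t = exp (- P t) * (y0 + integral {a..t} (\<lambda>s. exp (P s) * r s))" for t
  have "(y has_real_derivative - p t * y t + r t) (at t within {a..b})" if "t \<in> {a..b}" for t
    unfolding y_def
    by (rule derivative_eq_intros P[OF that] I[OF that] refl)+ (simp add: algebra_simps flip: exp_add)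
  moreover have "y a = y0" by (simp add: y_def P_def)
  ultimately show ?thesis by blast
qed

text \<open>Banach's theorem for the map sending \<open>u\<close> to the solution of the linear
  equation with source \<open>f (u t)\<close>. As \<open>M\<close> is at most half the damping, the
  quasi-static bound gives the contraction factor 1/2 on the whole interval at once.\<close>

lemma stiff_ode_exists:
  fixes p f :: "real \<Rightarrow> real"
  assumes "a \<le> b" and p: "continuous_on {a..b} p" and pM: "\<And>t. t \<in> {a..b} \<Longrightarrow> 2 * M \<le> p t"
    and lip: "\<And>x y. \<bar>f x - f y\<bar> \<le> M * \<bar>x - y\<bar>"
  shows "\<exists>y. y a = y0 \<and> (\<forall>t\<in>{a..b}. (y has_real_derivative - p t * y t + f (y t)) (at t within {a..b}))"
proof -
  \<comment> \<open>The complete space at hand consists of bounded continuous functions on all of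
    the line, so functions on \<open>{a..b}\<close> are extended by their end values.
    \<open>Q\<close> records this constancy, whence distances are decided on
    \<open>{a..b}\<close>.\<close>
  define clip where "clip t = max a (min b t)" for t
  have clip: "clip t \<in> {a..b}" for t using \<open>a \<le> b\<close> by (auto simp: clip_def)
  have clip_id: "t \<in> {a..b} \<Longrightarrow> clip t = t" for t by (auto simp: clip_def)
  have "continuous_on UNIV f"
    by (rule lipschitz_on_continuous_on[where L = "\<bar>M\<bar>"], rule lipschitz_onI)
       (auto simp: dist_real_def intro: order_trans[OF lip mult_right_mono])
  define Q where "Q u z \<longleftrightarrow> z a = y0 \<and> (\<forall>t. z t = z (clip t)) \<and>
      (\<forall>t\<in>{a..b}. (z has_real_derivative - p t * z t + f (u t)) (at t within {a..b}))"
    for u z :: "real \<Rightarrow> real"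
  have "\<exists>z :: real \<Rightarrow>\<^sub>C real. Q u z" for u :: "real \<Rightarrow>\<^sub>C real"
  proof -
    have "continuous_on {a..b} (\<lambda>t. f (u t))"
      by (rule continuous_on_compose2[OF \<open>continuous_on UNIV f\<close>])
         (use bcontfun_def apply_bcontfun[of u] in \<open>auto intro: continuous_on_subset\<close>)
    from linear_ode_exists[OF p this, of y0] obtain y where y: "y a = y0"
      "\<And>t. t \<in> {a..b} \<Longrightarrow> (y has_real_derivative - p t * y t + f (u t)) (at t within {a..b})"
      by blast
    have yc: "continuous_on {a..b} y"
      by (rule DERIV_continuous_on[OF y(2)])
    have "compact (y ` {a..b})" by (rule compact_continuous_image[OF yc]) simp
    then have "bounded (range (\<lambda>t. y (clip t)))"
      by (rule bounded_subset[OF compact_imp_bounded]) (use clip in auto)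
    moreover have "continuous_on UNIV (\<lambda>t. y (clip t))"
      by (rule continuous_on_compose2[OF yc]) (auto simp: clip image_subset_iff simp del: atLeastAtMost_iff, auto simp: clip_def intro!: continuous_intros)
    ultimately have "(\<lambda>t. y (clip t)) \<in> bcontfun" by (auto simp: bcontfun_def)
    then obtain z where z: "apply_bcontfun z = (\<lambda>t. y (clip t))" by (metis Bcontfun_inverse)
    have "(z has_real_derivative - p t * z t + f (u t)) (at t within {a..b})" if "t \<in> {a..b}" for t
      unfolding z clip_id[OF that]
      by (rule has_field_derivative_transform_within[OF y(2)[OF that], of 1])
         (use that in \<open>simp_all add: clip_id\<close>)
    then have "Q u z" using y(1) clip clip_id \<open>a \<le> b\<close> by (auto simp: Q_def z)
    then show ?thesis by blast
  qed
  then obtain T :: "(real \<Rightarrow>\<^sub>C real) \<Rightarrow> (real \<Rightarrow>\<^sub>C real)" 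
    where T: "\<And>u. Q (apply_bcontfun u) (apply_bcontfun (T u))" by metis
  have "\<exists>!u. T u = u"
  proof (rule banach_fix_type[where c = "1/2"])
    show "\<forall>u v. dist (T u) (T v) \<le> 1 / 2 * dist u v"
    proof (intro allI dist_bound)
      fix u v :: "real \<Rightarrow>\<^sub>C real" and t
      let ?e = "\<lambda>t. T u t - T v t"
      have "\<bar>?e (clip t)\<bar> \<le> 1 / 2 * dist u v"
      proof (rule linear_ode_bound[where r = "\<lambda>t. f (u t) - f (v t)", OF _ p _ _ clip])
        show "(?e has_real_derivative - p s * ?e s + (f (u s) - f (v s))) (at s within {a..b})"
          if "s \<in> {a..b}" for s
          using T[of u] T[of v] that by (auto simp: Q_def algebra_simps intro!: derivative_eq_intros)
        show "\<bar>f (u s) - f (v s)\<bar> \<le> 1 / 2 * dist u v * p s" if s: "s \<in> {a..b}" for s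
        proof -
          have "0 \<le> M" using lip[of 0 1] by simp
          have "\<bar>f (u s) - f (v s)\<bar> \<le> M * \<bar>u s - v s\<bar>" by (rule lip)
          also have "\<dots> \<le> M * dist u v"
            using dist_bounded[of u s v] by (intro mult_left_mono \<open>0 \<le> M\<close>) (simp add: dist_real_def)
          also have "\<dots> \<le> (p s / 2) * dist u v" using pM[OF s] by (intro mult_right_mono) auto
          finally show ?thesis by (simp add: mult.commute)
        qed
        show "\<bar>?e a\<bar> \<le> 1 / 2 * dist u v" using T[of u] T[of v] by (simp add: Q_def)
      qed
      moreover have "T u t = T u (clip t)" "T v t = T v (clip t)"
        using T[of u] T[of v] by (auto simp: Q_def)
      ultimately show "dist (T u t) (T v t) \<le> 1 / 2 * dist u v" by (simp add: dist_real_def)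
    qed
  qed auto
  then obtain u where "T u = u" by blast
  with T[of u] show ?thesis by (auto simp: Q_def)
qed

text \<open>The weights \<open>1 / n\<^sup>2\<close> are submultiplicative under convolution up to the constant 8, which makes
  \<open>A r\<^sup>n / n\<^sup>2\<close> a majorant that survives products and compositions of power series.\<close>

lemma sum_inverse_squares_le: "(\<Sum>j = 1..<n. 1 / (real j)\<^sup>2) \<le> 2"
proof -
  have "(\<Sum>j = 1..<Suc k. 1 / (real j)\<^sup>2) \<le> 2 - 1 / real k" if "k \<ge> 1" for k
    using that
  proof (induction k rule: dec_induct)
    case (step k)
    have "1 / (real (Suc k))\<^sup>2 \<le> 1 / (real k * real (Suc k))"
      using step.hyps by (intro divide_left_mono) (auto simp: power2_eq_square)
    also have "\<dots> = 1 / real k - 1 / real (Suc k)" using step.hyps by (simp add: field_simps)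
    finally show ?case using step by simp
  qed simp
  from this[of "n - 1"] have "(\<Sum>j = 1..<n. 1 / (real j)\<^sup>2) \<le> 2 - 1 / real (n - 1)" if "n \<ge> 2"
    using that by simp
  also have "2 - 1 / real (n - 1) \<le> 2" by simp
  finally show ?thesis by (cases "n \<ge> 2") (auto simp: not_le less_Suc_eq numeral_2_eq_2)
qed

text \<open>Partial fractions: 1/(j(n-j)) is (1/j + 1/(n-j))/n. Squaring costs a factor 2, and each
  of the two resulting sums is at most 2, hence 8 = 2 (2 + 2).\<close>

lemma convolution_inverse_squares_le:
  "(\<Sum>j = 1..<n. 1 / (real j)\<^sup>2 * (1 / (real (n - j))\<^sup>2)) \<le> 8 / (real n)\<^sup>2"
proof -
  have "1 / (real j)\<^sup>2 * (1 / (real (n - j))\<^sup>2)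
      \<le> 2 / (real n)\<^sup>2 * (1 / (real j)\<^sup>2 + 1 / (real (n - j))\<^sup>2)" if "j \<in> {1..<n}" for j
  proof -
    define x y where "x = real j" and "y = real (n - j)"
    have xy: "x > 0" "y > 0" "real n = x + y" using that by (auto simp: x_def y_def)
    have "1 / x\<^sup>2 * (1 / y\<^sup>2) = (1 / (x + y) * (1 / x + 1 / y))\<^sup>2"
      using xy by (simp add: field_simps power2_eq_square)
    also have "\<dots> = 1 / (x + y)\<^sup>2 * (1 / x + 1 / y)\<^sup>2" by (simp add: power_mult_distrib power_divide)
    also have "\<dots> \<le> 1 / (x + y)\<^sup>2 * (2 * ((1 / x)\<^sup>2 + (1 / y)\<^sup>2))"
      using sum_squares_bound[of "1/x" "1/y"]
      by (intro mult_left_mono) (simp add: power2_sum, simp)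
    finally show ?thesis unfolding xy(3) by (simp add: x_def y_def power_divide)
  qed
  then have "(\<Sum>j = 1..<n. 1 / (real j)\<^sup>2 * (1 / (real (n - j))\<^sup>2))
      \<le> 2 / (real n)\<^sup>2 * ((\<Sum>j = 1..<n. 1 / (real j)\<^sup>2) + (\<Sum>j = 1..<n. 1 / (real (n - j))\<^sup>2))"
    unfolding sum.distrib[symmetric] sum_distrib_left by (rule sum_mono)
  also have "(\<Sum>j = 1..<n. 1 / (real (n - j))\<^sup>2) = (\<Sum>j = 1..<n. 1 / (real j)\<^sup>2)"
    by (rule sum.reindex_bij_witness[where i = "\<lambda>j. n - j" and j = "\<lambda>j. n - j"]) auto
  also have "2 / (real n)\<^sup>2 * (\<dots> + \<dots>) \<le> 2 / (real n)\<^sup>2 * (2 + 2)"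
    by (intro mult_left_mono add_mono sum_inverse_squares_le) auto
  finally show ?thesis by simp
qed

lemma convolution_majorant:
  fixes x y :: "nat \<Rightarrow> real"
  assumes "\<And>j. j \<in> {1..<n} \<Longrightarrow> \<bar>x j\<bar> \<le> A / (real j)\<^sup>2 * r ^ j" "\<And>j. j \<in> {1..<n} \<Longrightarrow> \<bar>y j\<bar> \<le> B / (real j)\<^sup>2 * r ^ j"
    and "0 \<le> A" "0 \<le> B" "0 \<le> r"
  shows "(\<Sum>j = 1..<n. \<bar>x j\<bar> * \<bar>y (n - j)\<bar>) \<le> 8 * A * B / (real n)\<^sup>2 * r ^ n"
proof -
  have "\<bar>x j\<bar> * \<bar>y (n - j)\<bar> \<le> A * B * r ^ n * (1 / (real j)\<^sup>2 * (1 / (real (n - j))\<^sup>2))" if "j \<in> {1..<n}" for j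
  proof -
    have "\<bar>x j\<bar> * \<bar>y (n - j)\<bar> \<le> (A / (real j)\<^sup>2 * r ^ j) * (B / (real (n - j))\<^sup>2 * r ^ (n - j))"
      using that assms(1)[of j] assms(2)[of "n - j"] assms(3-5) by (intro mult_mono) auto
    also have "\<dots> = A * B * (r ^ j * r ^ (n - j)) * (1 / (real j)\<^sup>2 * (1 / (real (n - j))\<^sup>2))" by simp
    also have "r ^ j * r ^ (n - j) = r ^ n" using that by (simp flip: power_add)
    finally show ?thesis .
  qed
  then have "(\<Sum>j = 1..<n. \<bar>x j\<bar> * \<bar>y (n - j)\<bar>)
      \<le> A * B * r ^ n * (\<Sum>j = 1..<n. 1 / (real j)\<^sup>2 * (1 / (real (n - j))\<^sup>2))"
    unfolding sum_distrib_left by (rule sum_mono)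
  also have "\<dots> \<le> A * B * r ^ n * (8 / (real n)\<^sup>2)"
    using assms by (intro mult_left_mono convolution_inverse_squares_le) auto
  finally show ?thesis by (simp add: mult_ac)
qed

text \<open>The weight j/n comes from comparing coefficients of derivatives. It is at most 1, so
  differentiation costs nothing here.\<close>

lemma weighted_convolution_majorant:
  fixes x y :: "nat \<Rightarrow> real"
  assumes "\<And>j. j \<in> {1..<n} \<Longrightarrow> \<bar>x j\<bar> \<le> A / (real j)\<^sup>2 * r ^ j" "\<And>j. j \<in> {1..<n} \<Longrightarrow> \<bar>y j\<bar> \<le> B / (real j)\<^sup>2 * r ^ j"
    and "0 \<le> A" "0 \<le> B" "0 \<le> r"
  shows "\<bar>(\<Sum>j = 1..<n. real j * x j * y (n - j)) / real n\<bar> \<le> 8 * A * B / (real n)\<^sup>2 * r ^ n"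
proof (cases "n = 0")
  case False
  have "\<bar>\<Sum>j = 1..<n. real j * x j * y (n - j)\<bar> \<le> (\<Sum>j = 1..<n. real n * (\<bar>x j\<bar> * \<bar>y (n - j)\<bar>))"
    by (rule order_trans[OF sum_abs], rule sum_mono)
       (auto simp: abs_mult mult.assoc intro!: mult_right_mono)
  also have "\<dots> \<le> real n * (8 * A * B / (real n)\<^sup>2 * r ^ n)"
    unfolding sum_distrib_left[symmetric] by (intro mult_left_mono convolution_majorant assms) auto
  finally show ?thesis using False by (simp add: field_simps)
qed (use assms in simp)

text \<open>The recursions are those of the coefficients \<open>s\<close>, \<open>c\<close> of \<open>sin h\<close>, \<open>cos h\<close> for \<open>h = \<Sum> a\<^sub>n x\<^sup>n\<close>,
  obtained from \<open>(sin h)' = cos h \<cdot> h'\<close> and \<open>(cos h)' = - sin h \<cdot> h'\<close>.\<close>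

lemma sin_cos_coeff_majorant:
  fixes a s c :: "nat \<Rightarrow> real"
  assumes s: "\<And>n. n \<ge> 1 \<Longrightarrow> s n = a n + (\<Sum>j = 1..<n. real j * a j * c (n - j)) / real n"
    and c: "\<And>n. n \<ge> 1 \<Longrightarrow> c n = - (\<Sum>j = 1..<n. real j * a j * s (n - j)) / real n"
    and a: "\<And>n. n \<in> {1..<N} \<Longrightarrow> \<bar>a n\<bar> \<le> A / (real n)\<^sup>2 * r ^ n"
    and A: "0 \<le> A" "16 * A \<le> 1" "0 \<le> r"
  shows "n \<in> {1..<N} \<Longrightarrow> \<bar>s n\<bar> \<le> 2 * A / (real n)\<^sup>2 * r ^ n"
    and "n \<in> {1..<N} \<Longrightarrow> \<bar>c n\<bar> \<le> 2 * A / (real n)\<^sup>2 * r ^ n"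
    and "n \<in> {1..N} \<Longrightarrow> \<bar>(\<Sum>j = 1..<n. real j * a j * c (n - j)) / real n\<bar> \<le> 16 * A\<^sup>2 / (real n)\<^sup>2 * r ^ n"
proof -
  \<comment> \<open>Since \<open>16 * A \<le> 1\<close>, the quadratic correction is no larger than
    the majorant of \<open>a n\<close>; hence \<open>2 * A\<close> for \<open>s\<close> and
    \<open>c\<close>.\<close>
  have small: "16 * A\<^sup>2 / (real n)\<^sup>2 * r ^ n \<le> A / (real n)\<^sup>2 * r ^ n" for n
  proof -
    have "16 * A\<^sup>2 \<le> A" using mult_right_mono[OF A(2,1)] by (simp add: power2_eq_square mult.assoc)
    then show ?thesis using A by (intro mult_right_mono divide_right_mono) auto
  qed
  have conv: "\<bar>(\<Sum>j = 1..<n. real j * a j * y (n - j)) / real n\<bar> \<le> 16 * A\<^sup>2 / (real n)\<^sup>2 * r ^ n"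
    if "n \<le> N" "\<And>j. j \<in> {1..<n} \<Longrightarrow> \<bar>y j\<bar> \<le> 2 * A / (real j)\<^sup>2 * r ^ j" for n y
    using weighted_convolution_majorant[of n a A r y "2 * A"] that a A
    by (simp add: power2_eq_square mult_ac)
  have main: "n \<in> {1..<N} \<Longrightarrow> \<bar>s n\<bar> \<le> 2 * A / (real n)\<^sup>2 * r ^ n \<and> \<bar>c n\<bar> \<le> 2 * A / (real n)\<^sup>2 * r ^ n" for n
  proof (induction n rule: less_induct)
    case (less n)
    have "\<bar>(\<Sum>j = 1..<n. real j * a j * c (n - j)) / real n\<bar> \<le> 16 * A\<^sup>2 / (real n)\<^sup>2 * r ^ n"
      "\<bar>(\<Sum>j = 1..<n. real j * a j * s (n - j)) / real n\<bar> \<le> 16 * A\<^sup>2 / (real n)\<^sup>2 * r ^ n"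
      by (intro conv; use less in auto)+
    moreover have "\<bar>a n\<bar> \<le> A / (real n)\<^sup>2 * r ^ n" using a less by simp
    moreover have "2 * A / (real n)\<^sup>2 * r ^ n = A / (real n)\<^sup>2 * r ^ n + A / (real n)\<^sup>2 * r ^ n" by simp
    moreover have "0 \<le> A / (real n)\<^sup>2 * r ^ n" using A by simp
    moreover have "\<bar>s n\<bar> \<le> \<bar>a n\<bar> + \<bar>(\<Sum>j = 1..<n. real j * a j * c (n - j)) / real n\<bar>"
      "\<bar>c n\<bar> = \<bar>(\<Sum>j = 1..<n. real j * a j * s (n - j)) / real n\<bar>"
      using s[of n] c[of n] less.prems
        abs_triangle_ineq[of "a n" "(\<Sum>j = 1..<n. real j * a j * c (n - j)) / real n"] by auto
    ultimately show ?case using small[of n] by linarith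
  qed
  then show "n \<in> {1..<N} \<Longrightarrow> \<bar>s n\<bar> \<le> 2 * A / (real n)\<^sup>2 * r ^ n"
    "n \<in> {1..<N} \<Longrightarrow> \<bar>c n\<bar> \<le> 2 * A / (real n)\<^sup>2 * r ^ n" by auto
  \<comment> \<open>Only indices below \<open>n\<close> occur in the sum, so the bound reaches
    \<open>n = N\<close>, where \<open>a N\<close> is not yet controlled. This is what an induction
    on the coefficients requires.\<close>
  show "\<bar>(\<Sum>j = 1..<n. real j * a j * c (n - j)) / real n\<bar> \<le> 16 * A\<^sup>2 / (real n)\<^sup>2 * r ^ n" if "n \<in> {1..N}"
    using that main by (intro conv) auto
qed

section \<open>Coefficients of the slow graph\<close>

text \<open>\<open>a\<close>, \<open>s\<close>, \<open>c\<close> are the coefficients, as functions of \<open>\<theta>\<close>, of the power series in \<open>x\<close> of \<open>h\<close>, \<open>sin h\<close> and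
  \<open>cos h\<close>, where \<open>h\<close> is a formal solution of \<open>h\<^sub>\<theta> = - p sin h - l (h - x) (h\<^sub>x - 1)\<close>, written as
  \<open>h\<^sub>\<theta> = - p sin h - l ((h\<^sup>2)\<^sub>x / 2 - (x h)\<^sub>x + x)\<close>.\<close>

definition graph_rhs :: "(real \<Rightarrow> real) \<Rightarrow> real \<Rightarrow> (nat \<Rightarrow> real \<Rightarrow> real) \<Rightarrow> (nat \<Rightarrow> real \<Rightarrow> real) \<Rightarrow> nat \<Rightarrow> real \<Rightarrow> real"
  where "graph_rhs p l a s n t = - p t * s n t -
    l * (real (Suc n) / 2 * (\<Sum>j\<le>Suc n. a j t * a (Suc n - j) t) - real (Suc n) * a n t + (if n = 1 then 1 else 0))"

text \<open>\<open>a 0 = 0\<close> encodes the solution \<open>x = u = 0\<close>. The initial value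
  of \<open>a 1\<close> stays open because it is supplied by the Riccati equation.\<close>

definition graph_coeffs ::
    "real \<Rightarrow> real \<Rightarrow> (real \<Rightarrow> real) \<Rightarrow> real \<Rightarrow> (nat \<Rightarrow> real \<Rightarrow> real) \<Rightarrow> (nat \<Rightarrow> real \<Rightarrow> real) \<Rightarrow> (nat \<Rightarrow> real \<Rightarrow> real) \<Rightarrow> bool"
  where "graph_coeffs t0 t1 p l a s c \<longleftrightarrow>
    (\<forall>t. a 0 t = 0 \<and> s 0 t = 0 \<and> c 0 t = 1) \<and>
    (\<forall>n\<ge>1. \<forall>t. s n t = a n t + (\<Sum>j = 1..<n. real j * a j t * c (n - j) t) / real n) \<and>
    (\<forall>n\<ge>1. \<forall>t. c n t = - (\<Sum>j = 1..<n. real j * a j t * s (n - j) t) / real n) \<and>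
    (\<forall>n\<ge>2. a n t0 = 0) \<and>
    (\<forall>n. \<forall>t\<in>{t0..t1}. (a n has_real_derivative graph_rhs p l a s n t) (at t within {t0..t1}))"

text \<open>The part of \<open>graph_rhs\<close> left after all terms containing \<open>a n\<close>
  are split off; it involves lower coefficients only.\<close>

definition graph_source :: "(real \<Rightarrow> real) \<Rightarrow> real \<Rightarrow> (nat \<Rightarrow> real \<Rightarrow> real) \<Rightarrow> (nat \<Rightarrow> real \<Rightarrow> real) \<Rightarrow> nat \<Rightarrow> real \<Rightarrow> real"
  where "graph_source p l a c n t = - p t * ((\<Sum>j = 1..<n. real j * a j t * c (n - j) t) / real n) -
    l * (real (Suc n) / 2) * (\<Sum>j = 2..<n. a j t * a (Suc n - j) t)"

text \<open>The convolution of index \<open>Suc n\<close> would bring in \<open>a (Suc n)\<close>,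
  but only as a partner of \<open>a 0 = 0\<close>, so the system is triangular. The indices 1 and
  \<open>n\<close>, distinct as \<open>n \<ge> 2\<close>, contribute
  \<open>2 * a 1 t * a n t\<close>.\<close>

lemma graph_rhs_split:
  assumes "a 0 t = 0" "n \<ge> 2" "s n t = a n t + (\<Sum>j = 1..<n. real j * a j t * c (n - j) t) / real n"
  shows "graph_rhs p l a s n t = - (p t - l * real (Suc n) * (1 - a 1 t)) * a n t + graph_source p l a c n t"
proof -
  have "{..Suc n} = {0, 1, n, Suc n} \<union> {2..<n}" using assms(2) by auto
  then have "(\<Sum>j\<le>Suc n. a j t * a (Suc n - j) t) = (\<Sum>j\<in>{0, 1, n, Suc n} \<union> {2..<n}. a j t * a (Suc n - j) t)"
    by simp
  also have "\<dots> = (\<Sum>j\<in>{0, 1, n, Suc n}. a j t * a (Suc n - j) t) + (\<Sum>j = 2..<n. a j t * a (Suc n - j) t)"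
    by (rule sum.union_disjoint) auto
  also have "(\<Sum>j\<in>{0, 1, n, Suc n}. a j t * a (Suc n - j) t) = 2 * a 1 t * a n t"
    using assms(1,2) by (simp add: Suc_diff_le)
  finally show ?thesis
    using assms(2) unfolding graph_rhs_def graph_source_def assms(3) by (simp add: field_simps)
qed

text \<open>Triangularity permits well-founded recursion with choice: the entry at \<open>n\<close>
  is the triple of functions \<open>a n\<close>, \<open>s n\<close>, \<open>c n\<close>, the last
  two given algebraically. Continuity is carried along so that the next linear equation is
  solvable.\<close>

lemma graph_coeffs_exist:
  assumes p: "continuous_on {t0..t1} p"
    and a1: "\<And>t. t \<in> {t0..t1} \<Longrightarrow> (a1 has_real_derivative - p t * a1 t - l * ((a1 t)\<^sup>2 - 2 * a1 t + 1)) (at t within {t0..t1})"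
  shows "\<exists>a s c. graph_coeffs t0 t1 p l a s c \<and> a 1 = a1"
proof -
  have a1c: "continuous_on {t0..t1} a1" by (rule DERIV_continuous_on[OF a1])
  define a s c where "a f j = fst (f j)" and "s f j = fst (snd (f j))" and "c f j = snd (snd (f j))"
    for f :: "nat \<Rightarrow> (real \<Rightarrow> real) \<times> (real \<Rightarrow> real) \<times> (real \<Rightarrow> real)" and j
  define P where "P f n z \<longleftrightarrow>
      (n = 0 \<longrightarrow> z = (\<lambda>t. 0, \<lambda>t. 0, \<lambda>t. 1)) \<and> (n = 1 \<longrightarrow> fst z = a1) \<and>
      (n \<ge> 1 \<longrightarrow> fst (snd z) = (\<lambda>t. fst z t + (\<Sum>j = 1..<n. real j * a f j t * c f (n - j) t) / real n) \<and>
        snd (snd z) = (\<lambda>t. - (\<Sum>j = 1..<n. real j * a f j t * s f (n - j) t) / real n)) \<and>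
      (n \<ge> 2 \<longrightarrow> fst z t0 = 0 \<and> (\<forall>t\<in>{t0..t1}. (fst z has_real_derivative
        - (p t - l * real (Suc n) * (1 - a1 t)) * fst z t + graph_source p l (a f) (c f) n t) (at t within {t0..t1}))) \<and>
      continuous_on {t0..t1} (fst z) \<and> continuous_on {t0..t1} (fst (snd z)) \<and> continuous_on {t0..t1} (snd (snd z))"
    for f n and z :: "(real \<Rightarrow> real) \<times> (real \<Rightarrow> real) \<times> (real \<Rightarrow> real)"
  have "\<exists>f. \<forall>n. P f n (f n)"
  proof (rule dependent_wf_choice[OF wf_less_than])
    fix f g :: "nat \<Rightarrow> (real \<Rightarrow> real) \<times> (real \<Rightarrow> real) \<times> (real \<Rightarrow> real)" and n z
    assume "\<And>k. (k, n) \<in> less_than \<Longrightarrow> f k = g k"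
    then have eq: "a f j = a g j" "s f j = s g j" "c f j = c g j" if "j < n" for j
      using that by (simp_all add: a_def s_def c_def)
    \<comment> \<open>The index \<open>Suc n - j\<close> stays below \<open>n\<close> because the
      sum in \<open>graph_source\<close> starts at 2.\<close>
    moreover have "a f (Suc n - j) = a g (Suc n - j)" if "j \<in> {2..<n}" for j using that by (intro eq) auto
    ultimately show "P f n z = P g n z"
      unfolding P_def graph_source_def by (intro arg_cong2[where f = "(\<and>)"] imp_cong refl ball_cong) (simp_all cong: sum.cong_simp)
  next
    fix n and f :: "nat \<Rightarrow> (real \<Rightarrow> real) \<times> (real \<Rightarrow> real) \<times> (real \<Rightarrow> real)"
    assume "\<And>k. (k, n) \<in> less_than \<Longrightarrow> P f k (f k)"
    then have cont: "continuous_on {t0..t1} (a f j)" "continuous_on {t0..t1} (s f j)" "continuous_on {t0..t1} (c f j)"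
      if "j < n" for j
      using that by (auto simp: P_def a_def s_def c_def)
    define r where "r A t = A t + (\<Sum>j = 1..<n. real j * a f j t * c f (n - j) t) / real n" for A :: "real \<Rightarrow> real" and t
    define q where "q t = - (\<Sum>j = 1..<n. real j * a f j t * s f (n - j) t) / real n" for t
    have rq: "continuous_on {t0..t1} A \<Longrightarrow> continuous_on {t0..t1} (r A)" "continuous_on {t0..t1} q"
      if "n \<ge> 1" for A
      unfolding r_def q_def using that by (intro continuous_intros cont; auto)+
    consider "n = 0" | "n = 1" | "n \<ge> 2" by linarith
    then show "\<exists>z. P f n z"
    proof cases
      case 1
      then show ?thesis by (intro exI[of _ "(\<lambda>t. 0, \<lambda>t. 0, \<lambda>t. 1)"]) (simp add: P_def)
    next
      case 2
      have "P f n (a1, r a1, q)"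
        using 2 rq a1c by (simp add: P_def r_def[abs_def] q_def[abs_def])
      then show ?thesis by blast
    next
      case 3
      have "continuous_on {t0..t1} (graph_source p l (a f) (c f) n)"
        unfolding graph_source_def[abs_def] using 3 by (intro continuous_intros cont p) auto
      moreover have "continuous_on {t0..t1} (\<lambda>t. p t - l * real (Suc n) * (1 - a1 t))"
        by (intro continuous_intros p a1c)
      ultimately obtain A where A: "A t0 = 0" "\<And>t. t \<in> {t0..t1} \<Longrightarrow> (A has_real_derivative
          - (p t - l * real (Suc n) * (1 - a1 t)) * A t + graph_source p l (a f) (c f) n t) (at t within {t0..t1})"
        using linear_ode_exists by blast
      have "continuous_on {t0..t1} A" by (rule DERIV_continuous_on[OF A(2)])
      then have "P f n (A, r A, q)"
        unfolding P_def fst_conv snd_conv using 3 rq A by (auto simp: r_def[abs_def] q_def[abs_def])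
      then show ?thesis by blast
    qed
  qed
  then obtain f where f: "\<And>n. P f n (f n)" by blast
  have 0: "a f 0 t = 0" "s f 0 t = 0" "c f 0 t = 1" for t
    using f[of 0] by (simp_all add: P_def a_def s_def c_def)
  have sc: "s f n t = a f n t + (\<Sum>j = 1..<n. real j * a f j t * c f (n - j) t) / real n"
    "c f n t = - (\<Sum>j = 1..<n. real j * a f j t * s f (n - j) t) / real n" if "n \<ge> 1" for n t
    using f[of n] that unfolding P_def by (simp_all add: a_def s_def c_def)
  have 1: "a f 1 = a1" using f[of 1] by (simp add: P_def a_def)
  have 2: "a f n t0 = 0" "t \<in> {t0..t1} \<Longrightarrow> (a f n has_real_derivative
      - (p t - l * real (Suc n) * (1 - a1 t)) * a f n t + graph_source p l (a f) (c f) n t) (at t within {t0..t1})"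
    if "n \<ge> 2" for n t
    using f[of n] that unfolding P_def by (simp_all add: a_def)
  have "(a f n has_real_derivative graph_rhs p l (a f) (s f) n t) (at t within {t0..t1})" if t: "t \<in> {t0..t1}" for n t
  proof -
    consider "n = 0" | "n = 1" | "n \<ge> 2" by linarith
    then show ?thesis
    proof cases
      case 1
      have "a f 0 = (\<lambda>t. 0)" using 0 by auto
      then show ?thesis using 1 0 by (simp add: graph_rhs_def)
    next
      case 2
      have "graph_rhs p l (a f) (s f) 1 t = - p t * a1 t - l * ((a1 t)\<^sup>2 - 2 * a1 t + 1)"
        using 0 1 sc(1)[of 1] by (simp add: graph_rhs_def numeral_2_eq_2)
      then show ?thesis using a1[OF t] 1 2 by simp
    next
      case 3
      have "1 \<le> n" using 3 by simp
      then show ?thesis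
        using 2(2)[OF 3 t] graph_rhs_split[of "a f" t n "s f" "c f" p l, OF 0(1) 3 sc(1)] 1 by simp
    qed
  qed
  with 0 sc 1 2(1) show ?thesis unfolding graph_coeffs_def by blast
qed

text \<open>The weight \<open>\<rho>\<close> grows with \<open>\<theta>\<close>, that is, the radius of convergence shrinks. Its logarithmic derivative
  absorbs the factor \<open>n\<close> produced by \<open>h\<^sub>x\<close>.\<close>

lemma graph_coeffs_bound:
  assumes coeffs: "graph_coeffs t0 t1 p l a s c"
    and p: "continuous_on {t0..t1} p" "\<And>t. t \<in> {t0..t1} \<Longrightarrow> 0 \<le> p t"
    and \<rho>: "\<And>t. \<rho> t = \<rho>0 * exp (4 * \<bar>l\<bar> * (t - t0))" "\<rho>0 > 0" "\<And>t. t \<in> {t0..t1} \<Longrightarrow> \<rho> t \<le> r"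
    and a1: "\<And>t. t \<in> {t0..t1} \<Longrightarrow> \<bar>a 1 t\<bar> \<le> 1" "\<And>t. t \<in> {t0..t1} \<Longrightarrow> \<bar>a 1 t\<bar> \<le> A * \<rho>0"
    and A: "0 \<le> A" "(16 + 4 * r) * A \<le> 1"
    and n: "n \<ge> 2" and t: "t \<in> {t0..t1}"
  shows "\<bar>a n t\<bar> \<le> (16 + 4 * r) * A\<^sup>2 / (real n)\<^sup>2 * \<rho> t ^ n"
  using n t
proof (induction n arbitrary: t rule: less_induct)
  case (less n)
  let ?K = "16 + 4 * r"
  have 0: "a 0 t = 0" for t using coeffs by (simp add: graph_coeffs_def)
  have s: "k \<ge> 1 \<Longrightarrow> s k t = a k t + (\<Sum>j = 1..<k. real j * a j t * c (k - j) t) / real k"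
    and c: "k \<ge> 1 \<Longrightarrow> c k t = - (\<Sum>j = 1..<k. real j * a j t * s (k - j) t) / real k" for k t
    using coeffs unfolding graph_coeffs_def by blast+
  have rpos: "0 < \<rho> t" "0 < r" if "t \<in> {t0..t1}" for t
  proof -
    show "0 < \<rho> t" using \<rho>(2) by (simp add: \<rho>(1))
    then show "0 < r" using \<rho>(3)[OF that] by simp
  qed
  have r: "0 < r" using rpos less.prems by blast
  have A16: "16 * A \<le> 1"
  proof -
    have "16 * A \<le> ?K * A" using r A(1) by (intro mult_right_mono) auto
    then show ?thesis using A(2) by simp
  qed
  \<comment> \<open>The bound to be proved is quadratic in \<open>A\<close> and implies the linear
    majorant \<open>A / n^2\<close>, which is fed back into the convolutions; this closes the
    induction.\<close>
  have KA: "?K * A\<^sup>2 \<le> A" using mult_right_mono[OF A(2,1)] by (simp add: power2_eq_square mult.assoc)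
  have IH: "\<bar>a k t\<bar> \<le> A / (real k)\<^sup>2 * \<rho> t ^ k" if k: "k \<in> {1..<n}" and t: "t \<in> {t0..t1}" for k t
  proof (cases "k = 1")
    case True
    have "A * \<rho>0 \<le> A * \<rho> t"
      unfolding \<rho>(1) using \<rho>(2) t A(1) by (intro mult_left_mono) auto
    then show ?thesis using True a1(2)[OF t] by simp
  next
    case False
    then have "\<bar>a k t\<bar> \<le> ?K * A\<^sup>2 / (real k)\<^sup>2 * \<rho> t ^ k" using less.IH[of k t] k t by simp
    also have "\<dots> \<le> A / (real k)\<^sup>2 * \<rho> t ^ k"
      using KA rpos[OF t] by (intro mult_right_mono divide_right_mono) auto
    finally show ?thesis .
  qed
  \<comment> \<open>\<open>?w t\<close> is the reciprocal of \<open>\<rho> t ^ n\<close>.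
    Differentiating it adds \<open>4 * \<bar>l\<bar> * real n\<close> to the damping, so
    \<open>?q\<close> is the damping rate of the weighted coefficient \<open>?e\<close>.\<close>
  let ?q = "\<lambda>t. p t - l * real (Suc n) * (1 - a 1 t) + 4 * \<bar>l\<bar> * real n"
  let ?e = "\<lambda>t. a n t * (inverse \<rho>0 ^ n * exp (- (4 * \<bar>l\<bar> * real n) * (t - t0)))"
  let ?w = "\<lambda>t. inverse \<rho>0 ^ n * exp (- (4 * \<bar>l\<bar> * real n) * (t - t0))"
  have w: "?w t * \<rho> t ^ n = 1" for t
    using \<rho>(2) by (simp add: \<rho>(1) power_mult_distrib mult_ac field_simps flip: exp_of_nat_mult exp_add)
  have wpos: "?w t > 0" for t using \<rho>(2) by simp
  have der: "(a n has_real_derivative - (p t - l * real (Suc n) * (1 - a 1 t)) * a n t + graph_source p l a c n t)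
      (at t within {t0..t1})" if "t \<in> {t0..t1}" for t
  proof -
    have "(a n has_real_derivative graph_rhs p l a s n t) (at t within {t0..t1})"
      using coeffs that unfolding graph_coeffs_def by blast
    moreover have "1 \<le> n" using less.prems(1) by simp
    ultimately show ?thesis using graph_rhs_split[of a t n s c p l, OF 0 less.prems(1) s] by simp
  qed
  have "\<bar>?e t\<bar> \<le> ?K * A\<^sup>2 / (real n)\<^sup>2"
  proof (rule linear_ode_bound[where r = "\<lambda>t. graph_source p l a c n t * ?w t" and p = ?q, OF _ _ _ _ less.prems(2)])
    show "(?e has_real_derivative - ?q t * ?e t + graph_source p l a c n t * ?w t) (at t within {t0..t1})"
      if "t \<in> {t0..t1}" for t
      by (rule derivative_eq_intros der[OF that] refl)+ (simp add: algebra_simps)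
    have "continuous_on {t0..t1} (a 1)"
      by (rule DERIV_continuous_on) (use coeffs in \<open>unfold graph_coeffs_def, blast\<close>)
    then show "continuous_on {t0..t1} ?q" by (intro continuous_intros p)
    show "\<bar>?e t0\<bar> \<le> ?K * A\<^sup>2 / (real n)\<^sup>2"
      using coeffs less.prems(1) r unfolding graph_coeffs_def by simp
    fix t assume t: "t \<in> {t0..t1}"
    have "\<bar>(\<Sum>j = 1..<n. real j * a j t * c (n - j) t) / real n\<bar> \<le> 16 * A\<^sup>2 / (real n)\<^sup>2 * \<rho> t ^ n"
      by (rule sin_cos_coeff_majorant(3)[of "\<lambda>n. s n t" "\<lambda>n. a n t" "\<lambda>n. c n t" n A "\<rho> t"])
         (use s c IH t A(1) A16 rpos less.prems(1) in \<open>auto intro: less_imp_le\<close>)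
    then have 1: "\<bar>p t * ((\<Sum>j = 1..<n. real j * a j t * c (n - j) t) / real n)\<bar> \<le> p t * (16 * A\<^sup>2 / (real n)\<^sup>2 * \<rho> t ^ n)"
      unfolding abs_mult using p(2)[OF t] by (intro mult_mono) auto
    have "\<bar>\<Sum>j = 2..<n. a j t * a (Suc n - j) t\<bar> \<le> (\<Sum>j = 2..<n. \<bar>a j t\<bar> * \<bar>a (Suc n - j) t\<bar>)"
      by (rule order_trans[OF sum_abs]) (simp add: abs_mult)
    \<comment> \<open>The convolution bound runs over 1 to \<open>n\<close>, but the induction
      hypothesis stops below \<open>n\<close>. Setting the coefficients from index \<open>n\<close>
      on to zero changes no summand with \<open>2 \<le> j < n\<close>.\<close>
    also have "\<dots> = (\<Sum>j = 2..<n. \<bar>if j < n then a j t else 0\<bar> * \<bar>if Suc n - j < n then a (Suc n - j) t else 0\<bar>)"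
      by (rule sum.cong) auto
    also have "\<dots> \<le> (\<Sum>j = 1..<Suc n. \<bar>if j < n then a j t else 0\<bar> * \<bar>if Suc n - j < n then a (Suc n - j) t else 0\<bar>)"
      by (rule sum_mono2) auto
    also have "\<dots> \<le> 8 * A * A / (real (Suc n))\<^sup>2 * \<rho> t ^ Suc n"
      by (rule convolution_majorant) (use IH[OF _ t] A(1) rpos[OF t] in auto)
    also have "\<dots> = 8 * A\<^sup>2 / (real (Suc n))\<^sup>2 * \<rho> t * \<rho> t ^ n" by (simp add: power2_eq_square)
    also have "\<dots> \<le> 8 * A\<^sup>2 / (real (Suc n))\<^sup>2 * r * \<rho> t ^ n"
      using \<rho>(3)[OF t] rpos[OF t] by (intro mult_right_mono mult_left_mono) auto
    finally have "\<bar>l * (real (Suc n) / 2) * (\<Sum>j = 2..<n. a j t * a (Suc n - j) t)\<bar>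
        \<le> \<bar>l\<bar> * (real (Suc n) / 2) * (8 * A\<^sup>2 / (real (Suc n))\<^sup>2 * r * \<rho> t ^ n)"
      unfolding abs_mult by (intro mult_mono) auto
    also have "\<dots> = \<bar>l\<bar> * (1 / real (Suc n)) * (4 * r * A\<^sup>2 * \<rho> t ^ n)" by (simp add: power2_eq_square)
    \<comment> \<open>The estimate 1/(n+1) \<le> n (1/n^2) exhibits a factor
      \<open>\<bar>l\<bar> * real n\<close>, to be matched with a part of the damping
      \<open>?q\<close>.\<close>
    also have "\<dots> \<le> \<bar>l\<bar> * (real n * (1 / (real n)\<^sup>2)) * (4 * r * A\<^sup>2 * \<rho> t ^ n)"
      using r rpos[OF t] less.prems(1)
      by (intro mult_right_mono mult_left_mono) (auto simp: power2_eq_square intro!: divide_left_mono)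
    finally have 2: "\<bar>l * (real (Suc n) / 2) * (\<Sum>j = 2..<n. a j t * a (Suc n - j) t)\<bar>
        \<le> \<bar>l\<bar> * real n * (4 * r * A\<^sup>2 / (real n)\<^sup>2 * \<rho> t ^ n)"
      by (simp add: mult_ac)
    have "\<bar>graph_source p l a c n t\<bar> \<le> p t * (16 * A\<^sup>2 / (real n)\<^sup>2 * \<rho> t ^ n) + \<bar>l\<bar> * real n * (4 * r * A\<^sup>2 / (real n)\<^sup>2 * \<rho> t ^ n)"
      unfolding graph_source_def using 1 2 by linarith
    also have "\<dots> \<le> p t * (?K * A\<^sup>2 / (real n)\<^sup>2 * \<rho> t ^ n) + \<bar>l\<bar> * real n * (?K * A\<^sup>2 / (real n)\<^sup>2 * \<rho> t ^ n)"
      using p(2)[OF t] r rpos[OF t]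
      by (intro add_mono mult_left_mono mult_right_mono divide_right_mono) auto
    also have "\<dots> = (p t + \<bar>l\<bar> * real n) * (?K * A\<^sup>2 / (real n)\<^sup>2 * \<rho> t ^ n)"
      by (simp only: distrib_right)
    also have "\<dots> \<le> ?q t * (?K * A\<^sup>2 / (real n)\<^sup>2 * \<rho> t ^ n)"
    proof (rule mult_right_mono)
      \<comment> \<open>Origin of the rate 4 in \<open>\<rho>\<close>: as 2(n+1) \<le> 3n for
        \<open>n \<ge> 2\<close>, three quarters of the added damping outweigh the transport growth,
        and the remaining \<open>\<bar>l\<bar> * real n\<close> absorbs the quadratic
        source.\<close>
      have "l * real (Suc n) * (1 - a 1 t) \<le> \<bar>l * real (Suc n) * (1 - a 1 t)\<bar>" by simp
      also have "\<dots> \<le> \<bar>l\<bar> * real (Suc n) * 2"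
        unfolding abs_mult using a1(1)[OF t] by (intro mult_mono) auto
      also have "\<dots> \<le> \<bar>l\<bar> * (3 * real n)"
        unfolding mult.assoc using less.prems(1) by (intro mult_left_mono) auto
      finally show "p t + \<bar>l\<bar> * real n \<le> ?q t" by (simp add: algebra_simps)
    qed (use r rpos[OF t] in auto)
    finally have "\<bar>graph_source p l a c n t\<bar> * ?w t \<le> ?q t * (?K * A\<^sup>2 / (real n)\<^sup>2 * \<rho> t ^ n) * ?w t"
      using wpos by (intro mult_right_mono) (auto intro: less_imp_le)
    also have "\<dots> = ?K * A\<^sup>2 / (real n)\<^sup>2 * ?q t * (?w t * \<rho> t ^ n)" by (simp only: mult_ac)
    finally show "\<bar>graph_source p l a c n t * ?w t\<bar> \<le> ?K * A\<^sup>2 / (real n)\<^sup>2 * ?q t"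
      unfolding w abs_mult[of "graph_source p l a c n t"] abs_of_pos[OF wpos] by simp
  qed
  then have "\<bar>a n t\<bar> * ?w t \<le> ?K * A\<^sup>2 / (real n)\<^sup>2"
    unfolding abs_mult[of "a n t"] abs_of_pos[OF wpos] .
  then have "\<bar>a n t\<bar> * ?w t * \<rho> t ^ n \<le> ?K * A\<^sup>2 / (real n)\<^sup>2 * \<rho> t ^ n"
    using rpos[OF less.prems(2)] by (intro mult_right_mono) auto
  then show ?case using w[of t] by (simp add: mult.assoc)
qed

section \<open>Power series with smooth coefficients\<close>

text \<open>The strict inequality \<open>r * R < 1\<close> puts the radius of convergence beyond
  \<open>R\<close>, uniformly in \<open>t\<close>. The margin allows polynomial factors, hence any
  number of termwise derivatives.\<close>

definition geom_bounded :: "real set \<Rightarrow> real \<Rightarrow> (nat \<Rightarrow> real \<Rightarrow> real) \<Rightarrow> bool" where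
  "geom_bounded J R c \<longleftrightarrow> (\<exists>C r. 0 < r \<and> r * R < 1 \<and> (\<forall>n. \<forall>t\<in>J. \<bar>c n t\<bar> \<le> C * r ^ n))"

definition powser :: "(nat \<Rightarrow> real \<Rightarrow> real) \<Rightarrow> real \<times> real \<Rightarrow> real" where
  "powser c z = (\<Sum>n. c n (snd z) * fst z ^ n)"

definition powser_diffs :: "(nat \<Rightarrow> real \<Rightarrow> real) \<Rightarrow> nat \<Rightarrow> real \<Rightarrow> real" where
  "powser_diffs c n t = real (Suc n) * c (Suc n) t"

lemma geom_bounded_linear_factor:
  assumes r: "0 < r" "r * R < 1" and c: "\<And>n t. t \<in> J \<Longrightarrow> \<bar>c n t\<bar> \<le> C * real (Suc n) * r ^ n"
    and "0 < R"
  shows "geom_bounded J R c"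
proof -
  \<comment> \<open>Chosen so that \<open>r * (1 + \<delta>) * R\<close> is the midpoint of
    \<open>r * R\<close> and 1; Bernoulli's inequality then trades the linear factor for the larger
    ratio.\<close>
  define \<delta> where "\<delta> = (1 / (r * R) - 1) / 2"
  have \<delta>: "\<delta> > 0" using assms by (simp add: \<delta>_def field_simps)
  have "\<bar>c n t\<bar> \<le> (\<bar>C\<bar> * (1 + 1 / \<delta>)) * (r * (1 + \<delta>)) ^ n" if "t \<in> J" for n t
  proof -
    have "real (Suc n) \<le> (1 + 1 / \<delta>) * (1 + real n * \<delta>)" using \<delta> by (simp add: field_simps)
    also have "\<dots> \<le> (1 + 1 / \<delta>) * (1 + \<delta>) ^ n"
      using \<delta> linear_plus_1_le_power[of \<delta> n] by (intro mult_left_mono) (auto simp: add.commute mult.commute)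
    finally have n: "real (Suc n) \<le> (1 + 1 / \<delta>) * (1 + \<delta>) ^ n" .
    have "\<bar>c n t\<bar> \<le> C * (real (Suc n) * r ^ n)" using c[OF that] by (simp add: mult.assoc)
    also have "\<dots> \<le> \<bar>C\<bar> * (real (Suc n) * r ^ n)" using r by (intro mult_right_mono) auto
    also have "\<dots> \<le> \<bar>C\<bar> * ((1 + 1 / \<delta>) * (1 + \<delta>) ^ n * r ^ n)"
      using r by (intro mult_left_mono mult_right_mono n) auto
    finally show ?thesis by (simp add: power_mult_distrib mult_ac)
  qed
  moreover have "r * (1 + \<delta>) * R < 1"
  proof -
    have "r * (1 + \<delta>) * R = (1 + r * R) / 2" using assms by (simp add: \<delta>_def field_simps)
    then show ?thesis using r by simp
  qed
  moreover have "0 < r * (1 + \<delta>)" using r \<delta> by simp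
  ultimately show ?thesis unfolding geom_bounded_def by blast
qed

lemma geom_bounded_diffs:
  assumes "geom_bounded J R c" "0 < R"
  shows "geom_bounded J R (powser_diffs c)"
proof -
  obtain C r where r: "0 < r" "r * R < 1" and c: "\<And>n t. t \<in> J \<Longrightarrow> \<bar>c n t\<bar> \<le> C * r ^ n"
    using assms(1) unfolding geom_bounded_def by blast
  show ?thesis
  proof (rule geom_bounded_linear_factor[OF r _ assms(2), where C = "C * r"])
    show "\<bar>powser_diffs c n t\<bar> \<le> C * r * real (Suc n) * r ^ n" if "t \<in> J" for n t
      using mult_left_mono[OF c[OF that, of "Suc n"], of "real (Suc n)"]
      by (simp add: powser_diffs_def abs_mult mult_ac)
  qed
qed

lemma geom_bounded_funpow_diffs:
  "geom_bounded J R c \<Longrightarrow> 0 < R \<Longrightarrow> geom_bounded J R ((powser_diffs ^^ j) c)"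
  by (induction j) (auto intro: geom_bounded_diffs)

lemma geom_bounded_majorant:
  assumes "geom_bounded J R c" "0 < R"
  obtains M where "summable M" "\<And>n x t. \<bar>x\<bar> \<le> R \<Longrightarrow> t \<in> J \<Longrightarrow> \<bar>c n t * x ^ n\<bar> \<le> M n"
proof -
  obtain C r where r: "0 < r" "r * R < 1" and c: "\<And>n t. t \<in> J \<Longrightarrow> \<bar>c n t\<bar> \<le> C * r ^ n"
    using assms(1) unfolding geom_bounded_def by blast
  have "\<bar>c n t * x ^ n\<bar> \<le> C * (r * R) ^ n" if "\<bar>x\<bar> \<le> R" "t \<in> J" for n x t
  proof -
    have "\<bar>c n t\<bar> * \<bar>x\<bar> ^ n \<le> (C * r ^ n) * R ^ n"
      using c[OF that(2), of n] that(1) by (intro mult_mono power_mono) auto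
    then show ?thesis by (simp add: abs_mult power_abs power_mult_distrib)
  qed
  moreover have "summable (\<lambda>n. C * (r * R) ^ n)"
    using r assms(2) by (intro summable_mult summable_geometric) simp
  ultimately show ?thesis using that by blast
qed

lemma powser_summable:
  assumes "geom_bounded J R c" "0 < R" "\<bar>x\<bar> \<le> R" "t \<in> J"
  shows "summable (\<lambda>n. \<bar>c n t * x ^ n\<bar>)" "summable (\<lambda>n. c n t * x ^ n)"
proof -
  obtain M where M: "summable M" "\<And>n x t. \<bar>x\<bar> \<le> R \<Longrightarrow> t \<in> J \<Longrightarrow> \<bar>c n t * x ^ n\<bar> \<le> M n"
    using geom_bounded_majorant[OF assms(1,2)] by blast
  show "summable (\<lambda>n. \<bar>c n t * x ^ n\<bar>)"
    by (rule summable_comparison_test[OF _ M(1)]) (use M(2)[OF assms(3,4)] in auto)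
  then show "summable (\<lambda>n. c n t * x ^ n)" by (rule summable_rabs_cancel)
qed

lemma powser_dx:
  assumes "geom_bounded J R c" "0 < R" "\<bar>x\<bar> < R" "t \<in> J"
  shows "((\<lambda>x. powser c (x, t)) has_real_derivative powser (powser_diffs c) (x, t)) (at x)"
proof -
  have "((\<lambda>x. \<Sum>n. c n t * x ^ n) has_real_derivative (\<Sum>n. diffs (\<lambda>n. c n t) n * x ^ n)) (at x)"
    by (rule termdiffs_strong'[where K = R]) (use powser_summable(2)[OF assms(1,2) _ assms(4)] assms(3) in auto)
  then show ?thesis by (simp add: powser_def powser_diffs_def diffs_def)
qed

lemma powser_continuous_on:
  assumes "geom_bounded J R c" "0 < R" "\<And>n. continuous_on J (c n)"
  shows "continuous_on ({-R<..<R} \<times> J) (powser c)"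
proof -
  obtain M where M: "summable M" "\<And>n x t. \<bar>x\<bar> \<le> R \<Longrightarrow> t \<in> J \<Longrightarrow> \<bar>c n t * x ^ n\<bar> \<le> M n"
    by (rule geom_bounded_majorant[OF assms(1,2)]) blast
  have "uniform_limit ({-R<..<R} \<times> J) (\<lambda>n z. \<Sum>i<n. c i (snd z) * fst z ^ i) (\<lambda>z. \<Sum>i. c i (snd z) * fst z ^ i) sequentially"
    by (rule Weierstrass_m_test[OF _ M(1)]) (use M(2) in auto)
  then have "continuous_on ({-R<..<R} \<times> J) (\<lambda>z. \<Sum>i. c i (snd z) * fst z ^ i)"
  proof (rule uniform_limit_theorem[rotated])
    have "continuous_on ({-R<..<R} \<times> J) (\<lambda>z. c i (snd z))" for i
      by (rule continuous_on_compose2[OF assms(3) continuous_on_snd[OF continuous_on_id]]) auto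
    then show "\<forall>\<^sub>F n in sequentially. continuous_on ({-R<..<R} \<times> J) (\<lambda>z. \<Sum>i<n. c i (snd z) * fst z ^ i)"
      by (intro always_eventually allI continuous_on_sum continuous_on_mult continuous_intros)
  qed simp
  then show ?thesis by (simp add: powser_def[abs_def])
qed

lemma powser_dt:
  assumes "geom_bounded J R c" "geom_bounded J R d" "0 < R" "\<bar>x\<bar> < R" "open J" "convex J" "t \<in> J"
    and "\<And>n t. t \<in> J \<Longrightarrow> (c n has_real_derivative d n t) (at t)"
  shows "((\<lambda>t. powser c (x, t)) has_real_derivative powser d (x, t)) (at t)"
proof -
  obtain M where M: "summable M" "\<And>n x t. \<bar>x\<bar> \<le> R \<Longrightarrow> t \<in> J \<Longrightarrow> \<bar>d n t * x ^ n\<bar> \<le> M n"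
    by (rule geom_bounded_majorant[OF assms(2,3)]) blast
  have "((\<lambda>t. \<Sum>n. c n t * x ^ n) has_real_derivative (\<Sum>n. d n t * x ^ n)) (at t)"
  proof (rule has_field_derivative_series'(2)[OF assms(6)])
    show "((\<lambda>t. c n t * x ^ n) has_real_derivative d n s * x ^ n) (at s within J)" if "s \<in> J" for n s
      by (rule has_field_derivative_at_within) (auto intro!: derivative_eq_intros assms(8)[OF that])
    show "uniformly_convergent_on J (\<lambda>n t. \<Sum>i<n. d i t * x ^ i)"
      by (rule Weierstrass_m_test'[OF _ M(1)]) (use M(2)[of x] assms(4) in auto)
    show "summable (\<lambda>n. c n t * x ^ n)" using powser_summable(2)[OF assms(1,3) _ assms(7)] assms(4) by simp
    show "t \<in> interior J" using assms(5,7) by (simp add: interior_open)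
  qed (rule assms(7))
  then show ?thesis by (simp add: powser_def)
qed

lemma powser_mult:
  assumes "geom_bounded J R c" "geom_bounded J R d" "0 < R" "\<bar>x\<bar> < R" "t \<in> J"
  shows "(\<lambda>n. (\<Sum>i\<le>n. c i t * d (n - i) t) * x ^ n) sums (powser c (x, t) * powser d (x, t))"
proof -
  have "(\<lambda>n. \<Sum>i\<le>n. (c i t * x ^ i) * (d (n - i) t * x ^ (n - i))) sums
      ((\<Sum>n. c n t * x ^ n) * (\<Sum>n. d n t * x ^ n))"
    by (rule Cauchy_product_sums) (use powser_summable(1)[OF _ assms(3) _ assms(5)] assms in auto)
  moreover have "(\<Sum>i\<le>n. (c i t * x ^ i) * (d (n - i) t * x ^ (n - i))) = (\<Sum>i\<le>n. c i t * d (n - i) t) * x ^ n" for n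
    unfolding sum_distrib_right
  proof (rule sum.cong[OF refl])
    fix i assume "i \<in> {..n}"
    then have "x ^ n = x ^ i * x ^ (n - i)" by (simp flip: power_add)
    then show "(c i t * x ^ i) * (d (n - i) t * x ^ (n - i)) = c i t * d (n - i) t * x ^ n" by simp
  qed
  ultimately show ?thesis by (simp add: powser_def)
qed

text \<open>Both partial derivatives exist and the one in \<open>t\<close> is continuous, which
  gives the total derivative. The \<open>t\<close>-partial is presented as a multiple of
  \<open>id_blinfun\<close> since its continuity is that of a map into bounded linear
  operators.\<close>

lemma powser_has_derivative:
  assumes c: "geom_bounded J R c" and d: "geom_bounded J R d" and R: "0 < R" and J: "open J" "convex J"
    and der: "\<And>n t. t \<in> J \<Longrightarrow> (c n has_real_derivative d n t) (at t)"
    and dcont: "\<And>n. continuous_on J (d n)" and z: "z \<in> {-R<..<R} \<times> J"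
  shows "(powser c has_derivative (\<lambda>v. powser (powser_diffs c) z * fst v + powser d z * snd v)) (at z)"
proof -
  obtain x t where xt: "z = (x, t)" by fastforce
  let ?X = "{-R<..<R}"
  have z': "x \<in> ?X" "t \<in> J" using z xt by auto
  have "((\<lambda>(x, t). powser c (x, t)) has_derivative
      (\<lambda>(u, v). powser (powser_diffs c) (x, t) * u + blinfun_apply (powser d (x, t) *\<^sub>R id_blinfun) v))
      (at (x, t) within ?X \<times> J)"
  proof (rule has_derivative_partialsI)
    show "((\<lambda>x. powser c (x, t)) has_derivative (*) (powser (powser_diffs c) (x, t))) (at x within ?X)"
      using powser_dx[OF c R _ z'(2), of x] z'(1)
      by (auto simp: has_field_derivative_def intro: has_derivative_at_withinI)
    show "((\<lambda>t. powser c (y, t)) has_derivative blinfun_apply (powser d (y, s) *\<^sub>R id_blinfun)) (at s within J)"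
      if "y \<in> ?X" "s \<in> J" for y s
    proof -
      have "blinfun_apply (powser d (y, s) *\<^sub>R id_blinfun) = (*) (powser d (y, s))"
        by (auto simp: scaleR_blinfun.rep_eq)
      then show ?thesis
        using powser_dt[OF c d R _ J that(2) der, of y] that(1)
        by (auto simp: has_field_derivative_def intro: has_derivative_at_withinI)
    qed
    have "continuous_on (?X \<times> J) (\<lambda>z. powser d z *\<^sub>R (id_blinfun :: real \<Rightarrow>\<^sub>L real))"
      by (intro continuous_intros powser_continuous_on d R dcont)
    then show "continuous (at (x, t) within ?X \<times> J) (\<lambda>(x, t). powser d (x, t) *\<^sub>R (id_blinfun :: real \<Rightarrow>\<^sub>L real))"
      using z' by (simp add: continuous_on_eq_continuous_within case_prod_unfold)
  qed (use z' J in auto)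
  moreover have "at (x, t) within ?X \<times> J = at (x, t)"
    using z' J by (intro at_within_open open_Times) auto
  ultimately show ?thesis
    by (simp add: xt case_prod_unfold scaleR_blinfun.rep_eq)
qed

text \<open>If \<open>h\<close> solves a first order equation \<open>h\<^sub>t = \<Phi>(x, t, h, h\<^sub>x)\<close>, all \<open>x\<close>-derivatives of \<open>h\<^sub>t\<close> lie in the
  following algebra, because it is closed under \<open>\<partial>/\<partial>x\<close>.\<close>

inductive jet_expr :: "(nat \<Rightarrow> real \<times> real \<Rightarrow> real) \<Rightarrow> (real \<Rightarrow> real) \<Rightarrow> (real \<times> real \<Rightarrow> real) \<Rightarrow> bool"
  for h g where
  jet: "jet_expr h g (h j)"
| sin: "jet_expr h g (\<lambda>z. sin (h 0 z))"
| cos: "jet_expr h g (\<lambda>z. cos (h 0 z))"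
| fst: "jet_expr h g fst"
| coeff: "jet_expr h g (\<lambda>z. g (snd z))"
| const: "jet_expr h g (\<lambda>z. k)"
| add: "jet_expr h g e \<Longrightarrow> jet_expr h g f \<Longrightarrow> jet_expr h g (\<lambda>z. e z + f z)"
| mult: "jet_expr h g e \<Longrightarrow> jet_expr h g f \<Longrightarrow> jet_expr h g (\<lambda>z. e z * f z)"

lemma jet_expr_dx:
  assumes "jet_expr h g e"
    and h: "\<And>j x y. (x, y) \<in> S \<Longrightarrow> ((\<lambda>x. h j (x, y)) has_real_derivative h (Suc j) (x, y)) (at x)"
  shows "\<exists>e'. jet_expr h g e' \<and> (\<forall>x y. (x, y) \<in> S \<longrightarrow> ((\<lambda>x. e (x, y)) has_real_derivative e' (x, y)) (at x))"
  using assms(1)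
proof induction
  case (jet j)
  then show ?case using h jet_expr.jet by blast
next
  case sin
  show ?case
    by (rule exI[of _ "\<lambda>z. cos (h 0 z) * h 1 z"])
       (auto intro!: jet_expr.intros derivative_eq_intros h)
next
  case cos
  show ?case
    by (intro exI[of _ "\<lambda>z. (-1) * (sin (h 0 z) * h 1 z)"] conjI jet_expr.intros)
       (auto intro!: derivative_eq_intros h)
next
  case fst
  show ?case by (rule exI[of _ "\<lambda>z. 1"]) (auto intro!: jet_expr.intros derivative_eq_intros)
next
  case coeff
  show ?case by (rule exI[of _ "\<lambda>z. 0"]) (auto intro!: jet_expr.intros)
next
  case (const k)
  show ?case by (rule exI[of _ "\<lambda>z. 0"]) (auto intro!: jet_expr.intros)
next
  case (add e f)
  then obtain e' f' where "jet_expr h g e'" "jet_expr h g f'"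
    "\<And>x y. (x, y) \<in> S \<Longrightarrow> ((\<lambda>x. e (x, y)) has_real_derivative e' (x, y)) (at x)"
    "\<And>x y. (x, y) \<in> S \<Longrightarrow> ((\<lambda>x. f (x, y)) has_real_derivative f' (x, y)) (at x)" by blast
  then show ?case
    by (intro exI[of _ "\<lambda>z. e' z + f' z"]) (auto intro!: jet_expr.intros derivative_eq_intros)
next
  case (mult e f)
  then obtain e' f' where *: "jet_expr h g e'" "jet_expr h g f'"
    "\<And>x y. (x, y) \<in> S \<Longrightarrow> ((\<lambda>x. e (x, y)) has_real_derivative e' (x, y)) (at x)"
    "\<And>x y. (x, y) \<in> S \<Longrightarrow> ((\<lambda>x. f (x, y)) has_real_derivative f' (x, y)) (at x)" by blast
  show ?case
    by (intro exI[of _ "\<lambda>z. e' z * f z + f' z * e z"])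
       (use * mult.hyps in \<open>auto intro!: jet_expr.intros derivative_eq_intros\<close>)
qed

lemma jet_expr_Ck_on:
  assumes "jet_expr h g e" "open S" "\<And>j. Ck_on n S (h j)" "Ck_on n UNIV g"
  shows "Ck_on n S e"
  using assms(1)
proof induction
  case sin
  show ?case by (rule Ck_on_compose[OF assms(2) open_UNIV _ assms(3)]) (simp_all add: Ck_on_sin_cos)
next
  case cos
  show ?case by (rule Ck_on_compose[OF assms(2) open_UNIV _ assms(3)]) (simp_all add: Ck_on_sin_cos)
next
  case fst
  show ?case by (rule Ck_on_linear[OF bounded_linear_fst assms(2)])
next
  case coeff
  show ?case
    by (rule Ck_on_compose[OF assms(2) open_UNIV _ Ck_on_linear[OF bounded_linear_snd assms(2)] assms(4)]) simp
qed (auto intro: assms Ck_on_const Ck_on_add Ck_on_mult)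

text \<open>\<open>h j\<close> and \<open>k j\<close> are the \<open>j\<close>-th
  \<open>x\<close>-derivatives of \<open>h\<close> and of \<open>h\<^sub>t\<close>. If every
  \<open>h j\<close> is of class C^n, so is every \<open>k j\<close>, being a jet expression; then
  both partial derivatives of each \<open>h j\<close> are C^n. One order is thus gained for all
  \<open>j\<close> simultaneously.\<close>

lemma first_order_pde_smooth:
  fixes h k :: "nat \<Rightarrow> real \<times> real \<Rightarrow> real"
  assumes S: "open S" and cont: "\<And>j. continuous_on S (h j)"
    and der: "\<And>j z. z \<in> S \<Longrightarrow> (h j has_derivative (\<lambda>v. h (Suc j) z * fst v + k j z * snd v)) (at z)"
    and kx: "\<And>j x y. (x, y) \<in> S \<Longrightarrow> ((\<lambda>x. k j (x, y)) has_real_derivative k (Suc j) (x, y)) (at x)"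
    and pde: "jet_expr h g \<Phi>" "\<And>z. z \<in> S \<Longrightarrow> k 0 z = \<Phi> z"
    and g: "\<And>n. Ck_on n UNIV g"
  shows "smooth_on S (h j)"
proof -
  have hx: "((\<lambda>x. h j (x, y)) has_real_derivative h (Suc j) (x, y)) (at x)" if "(x, y) \<in> S" for j x y
  proof -
    have "((\<lambda>x. (x, y)) has_derivative (\<lambda>u. (u, 0))) (at x)" by (auto intro!: derivative_eq_intros)
    from has_derivative_compose[OF this der[OF that]] show ?thesis
      by (simp add: has_field_derivative_def)
  qed
  have k: "\<exists>e. jet_expr h g e \<and> (\<forall>z\<in>S. k j z = e z)" for j
  proof (induction j)
    case 0
    then show ?case using pde by blast
  next
    case (Suc j)
    then obtain e where e: "jet_expr h g e" "\<And>z. z \<in> S \<Longrightarrow> k j z = e z" by blast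
    obtain e' where e': "jet_expr h g e'"
      "\<And>x y. (x, y) \<in> S \<Longrightarrow> ((\<lambda>x. e (x, y)) has_real_derivative e' (x, y)) (at x)"
      using jet_expr_dx[OF e(1) hx] by blast
    have "k (Suc j) (x, y) = e' (x, y)" if xy: "(x, y) \<in> S" for x y
    proof -
      have "open ((\<lambda>x. (x, y)) -` S)" by (intro open_vimage S continuous_intros)
      then have "((\<lambda>x. e (x, y)) has_real_derivative k (Suc j) (x, y)) (at x)"
        by (rule has_field_derivative_transform_within_open[OF kx[OF xy, of j]]) (use e(2) xy in auto)
      then show ?thesis using e'(2)[OF xy] DERIV_unique by blast
    qed
    then show ?case using e'(1) by auto
  qed
  have "Ck_on n S (h j)" for n j
  proof (induction n arbitrary: j)
    case 0
    then show ?case using cont by simp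
  next
    case (Suc n)
    have kC: "Ck_on n S (k j)"
    proof -
      obtain e where e: "jet_expr h g e" "\<And>z. z \<in> S \<Longrightarrow> k j z = e z" using k by blast
      show ?thesis
        by (rule Ck_on_cong_imp[OF S _ jet_expr_Ck_on[OF e(1) S Suc g]]) (simp add: e(2))
    qed
    show ?case
      by (rule Ck_on_SucI[OF S der]) (auto intro!: Ck_on_add Ck_on_mult Ck_on_const S Suc kC)
  qed
  then show ?thesis by (simp add: smooth_on_def)
qed

section \<open>From the formal series to a smooth solution of the invariance equation\<close>

lemma graph_coeffs_continuous:
  assumes coeffs: "graph_coeffs t0 t1 p l a s c"
  shows "continuous_on {t0..t1} (a n)" "continuous_on {t0..t1} (s n)" "continuous_on {t0..t1} (c n)"
proof -
  have a: "continuous_on {t0..t1} (a n)" for n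
    by (rule DERIV_continuous_on) (use coeffs in \<open>unfold graph_coeffs_def, blast\<close>)
  have "continuous_on {t0..t1} (s n) \<and> continuous_on {t0..t1} (c n)"
  proof (induction n rule: less_induct)
    case (less n)
    show ?case
    proof (cases "n = 0")
      case True
      have "s 0 = (\<lambda>t. 0)" "c 0 = (\<lambda>t. 1)" using coeffs by (auto simp: graph_coeffs_def)
      then show ?thesis using True by simp
    next
      case False
      have "s n = (\<lambda>t. a n t + (\<Sum>j = 1..<n. real j * a j t * c (n - j) t) / real n)"
        "c n = (\<lambda>t. - (\<Sum>j = 1..<n. real j * a j t * s (n - j) t) / real n)"
        using coeffs False by (auto simp: graph_coeffs_def)
      moreover have "continuous_on {t0..t1} (s (n - j))" "continuous_on {t0..t1} (c (n - j))" if "j \<in> {1..<n}" for j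
        using less[of "n - j"] that by auto
      ultimately show ?thesis using False by (auto intro!: continuous_intros a)
    qed
  qed
  with a show "continuous_on {t0..t1} (a n)" "continuous_on {t0..t1} (s n)" "continuous_on {t0..t1} (c n)" by auto
qed

lemma powser_zero_left: "powser c (0, t) = c 0 t"
  by (simp add: powser_def)

lemma powser_bound:
  assumes "\<And>n. \<bar>c n t\<bar> \<le> B * r ^ n" "0 \<le> r" "r * R \<le> 1 / 2" "\<bar>x\<bar> \<le> R"
  shows "\<bar>powser c (x, t)\<bar> \<le> 2 * B"
proof -
  have B: "0 \<le> B" using assms(1)[of 0] by simp
  have "norm (c n t * x ^ n) \<le> B * (1 / 2) ^ n" for n
  proof -
    have "\<bar>c n t\<bar> * \<bar>x\<bar> ^ n \<le> (B * r ^ n) * R ^ n"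
      using assms B by (intro mult_mono power_mono) auto
    also have "\<dots> = B * (r * R) ^ n" by (simp add: power_mult_distrib)
    also have "\<dots> \<le> B * (1 / 2) ^ n"
      using assms B by (intro mult_left_mono power_mono mult_nonneg_nonneg) auto
    finally show ?thesis by (simp add: abs_mult power_abs)
  qed
  then have "norm (\<Sum>n. c n t * x ^ n) \<le> (\<Sum>n. B * (1 / 2) ^ n)"
    by (intro norm_suminf_le summable_mult summable_geometric) auto
  also have "\<dots> = 2 * B" by (simp add: suminf_mult suminf_geometric summable_geometric)
  finally show ?thesis by (simp add: powser_def)
qed

lemma sum_Suc_convolution:
  fixes a y :: "nat \<Rightarrow> real"
  shows "(\<Sum>i\<le>n. real (Suc i) * a (Suc i) * y (n - i)) =
    (\<Sum>j = 1..<Suc n. real j * a j * y (Suc n - j)) + real (Suc n) * a (Suc n) * y 0"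
proof -
  have "(\<Sum>i\<le>n. real (Suc i) * a (Suc i) * y (n - i)) = (\<Sum>j = 1..Suc n. real j * a j * y (Suc n - j))"
    by (rule sum.reindex_bij_witness[where i = "\<lambda>j. j - 1" and j = Suc]) auto
  also have "{1..Suc n} = insert (Suc n) {1..<Suc n}" by auto
  finally show ?thesis by simp
qed

text \<open>No series is substituted into another: the recursions say \<open>S' = H' C\<close> and
  \<open>C' = - H' S\<close> for the sums, so \<open>(S - sin H)^2 + (C - cos H)^2\<close> has
  derivative zero, and it vanishes at \<open>x = 0\<close>.\<close>

lemma powser_sin_cos:
  assumes coeffs: "graph_coeffs t0 t1 p l a s c"
    and gb: "geom_bounded J R a" "geom_bounded J R s" "geom_bounded J R c" and R: "0 < R"
    and x: "\<bar>x\<bar> < R" and t: "t \<in> J"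
  shows "powser s (x, t) = sin (powser a (x, t))"
proof -
  have 0: "a 0 t = 0" "s 0 t = 0" "c 0 t = 1" using coeffs by (auto simp: graph_coeffs_def)
  have rec: "real (Suc n) * s (Suc n) t = (\<Sum>i\<le>n. real (Suc i) * a (Suc i) t * c (n - i) t)"
    "real (Suc n) * c (Suc n) t = - (\<Sum>i\<le>n. real (Suc i) * a (Suc i) t * s (n - i) t)" for n
  proof -
    \<comment> \<open>The factors 1 and 0 hold the places of \<open>c 0 t\<close> and
      \<open>s 0 t\<close>, so that the result matches \<open>sum_Suc_convolution\<close>
      literally.\<close>
    have clear: "v = w + X / k \<Longrightarrow> k * v = X + k * w * 1" "v = - X / k \<Longrightarrow> k * v = - (X + k * w * 0)"
      if "k \<noteq> 0" for k v w X :: real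
      using that by (simp_all add: field_simps)
    have "s (Suc n) t = a (Suc n) t + (\<Sum>j = 1..<Suc n. real j * a j t * c (Suc n - j) t) / real (Suc n)"
      using coeffs unfolding graph_coeffs_def by simp
    from clear(1)[OF of_nat_neq_0 this]
    show "real (Suc n) * s (Suc n) t = (\<Sum>i\<le>n. real (Suc i) * a (Suc i) t * c (n - i) t)"
      unfolding sum_Suc_convolution[of "\<lambda>n. a n t" "\<lambda>n. c n t"] 0 .
    have "c (Suc n) t = - (\<Sum>j = 1..<Suc n. real j * a j t * s (Suc n - j) t) / real (Suc n)"
      using coeffs unfolding graph_coeffs_def by simp
    from clear(2)[OF of_nat_neq_0 this]
    show "real (Suc n) * c (Suc n) t = - (\<Sum>i\<le>n. real (Suc i) * a (Suc i) t * s (n - i) t)"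
      unfolding sum_Suc_convolution[of "\<lambda>n. a n t" "\<lambda>n. s n t"] 0 .
  qed
  let ?H = "\<lambda>x. powser a (x, t)" and ?S = "\<lambda>x. powser s (x, t)" and ?C = "\<lambda>x. powser c (x, t)"
    and ?H' = "\<lambda>x. powser (powser_diffs a) (x, t)"
  note d = geom_bounded_diffs[OF gb(1) R]
  have H: "(?H has_real_derivative ?H' x) (at x)" if "\<bar>x\<bar> < R" for x
    by (rule powser_dx[OF gb(1) R that t])
  have S: "(?S has_real_derivative ?H' x * ?C x) (at x)" if "\<bar>x\<bar> < R" for x
  proof -
    have "powser (powser_diffs s) (x, t) = ?H' x * ?C x"
      using powser_mult[OF d gb(3) R that t] by (simp add: powser_def sums_iff powser_diffs_def rec del: of_nat_Suc)
    then show ?thesis using powser_dx[OF gb(2) R that t] by simp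
  qed
  have C: "(?C has_real_derivative - (?H' x * ?S x)) (at x)" if "\<bar>x\<bar> < R" for x
  proof -
    have "powser (powser_diffs c) (x, t) = - (?H' x * ?S x)"
      using sums_minus[OF powser_mult[OF d gb(2) R that t]]
      by (simp add: powser_def sums_iff powser_diffs_def rec del: of_nat_Suc)
    then show ?thesis using powser_dx[OF gb(3) R that t] by simp
  qed
  let ?E = "\<lambda>x. (?S x - sin (?H x))\<^sup>2 + (?C x - cos (?H x))\<^sup>2"
  have "(?E has_real_derivative 0) (at y within {-R<..<R})" if "y \<in> {-R<..<R}" for y
  proof -
    have y: "\<bar>y\<bar> < R" using that by auto
    have "(?E has_real_derivative 0) (at y)"
      by (rule derivative_eq_intros H[OF y] S[OF y] C[OF y] refl)+ (simp add: algebra_simps)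
    then show ?thesis by (rule has_field_derivative_at_within)
  qed
  from has_field_derivative_zero_constant[OF _ this]
  obtain k where k: "\<And>y. y \<in> {-R<..<R} \<Longrightarrow> ?E y = k" by auto
  have "?E x = k" by (rule k) (use x in auto)
  also have "k = ?E 0" by (rule k[symmetric]) (use R in auto)
  also have "\<dots> = 0" by (simp add: powser_zero_left 0)
  finally have "?E x = 0" .
  then show ?thesis by (simp add: sum_power2_eq_zero_iff)
qed

text \<open>The equation is checked coefficientwise, in the divergence form of
  \<open>graph_rhs\<close>. This requires that the coefficients of \<open>h\<^sub>\<theta>\<close>
  are geometrically bounded too, since they are the termwise \<open>t\<close>-derivatives.\<close>

lemma graph_series:
  assumes coeffs: "graph_coeffs t0 t1 p l a s c" and p: "\<And>n. Ck_on n UNIV p"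
    and R: "0 < R" "0 < r" "r * R \<le> 1 / 2" and A: "0 \<le> A" "16 * A \<le> 1"
    and a: "\<And>n t. n \<ge> 1 \<Longrightarrow> t \<in> {t0..t1} \<Longrightarrow> \<bar>a n t\<bar> \<le> A / (real n)\<^sup>2 * r ^ n"
  defines "D \<equiv> {-R<..<R} \<times> {t0<..<t1}"
  shows "smooth_on D (powser a)"
    and "z \<in> D \<Longrightarrow> (powser a has_derivative (\<lambda>v. powser (powser_diffs a) z * fst v +
      (- p (snd z) * sin (powser a z) - l * (powser a z - fst z) * (powser (powser_diffs a) z - 1)) * snd v)) (at z)"
proof -
  define J where "J = {t0<..<t1}"
  have J: "open J" "convex J" "J \<subseteq> {t0..t1}" by (auto simp: J_def)
  have rR: "r * R < 1" using R by simp
  have 0: "a 0 t = 0" "s 0 t = 0" "c 0 t = 1" for t using coeffs by (auto simp: graph_coeffs_def)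
  have sc: "\<bar>s n t\<bar> \<le> 2 * A / (real n)\<^sup>2 * r ^ n" "\<bar>c n t\<bar> \<le> 2 * A / (real n)\<^sup>2 * r ^ n"
    if "n \<ge> 1" "t \<in> {t0..t1}" for n t
    using that sin_cos_coeff_majorant(1,2)[of "\<lambda>n. s n t" "\<lambda>n. a n t" "\<lambda>n. c n t" "Suc n" A r n] coeffs A R a
    unfolding graph_coeffs_def by auto
  have drop: "B / (real n)\<^sup>2 * r ^ n \<le> B * r ^ n" if "0 \<le> B" "n \<ge> 1" for B n
  proof -
    have "B / (real n)\<^sup>2 \<le> B / 1" using that by (intro divide_left_mono) auto
    then show ?thesis using R by (intro mult_right_mono) auto
  qed
  have a': "\<bar>a n t\<bar> \<le> A * r ^ n" and s': "\<bar>s n t\<bar> \<le> 2 * A * r ^ n" and c': "\<bar>c n t\<bar> \<le> (1 + 2 * A) * r ^ n"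
    if "t \<in> J" for n t
  proof -
    have t: "t \<in> {t0..t1}" using that J by auto
    show "\<bar>a n t\<bar> \<le> A * r ^ n" using a[OF _ t, of n] drop[of A n] A 0 R by (cases "n = 0") auto
    show "\<bar>s n t\<bar> \<le> 2 * A * r ^ n" using sc(1)[OF _ t, of n] drop[of "2 * A" n] A 0 R by (cases "n = 0") auto
    have "\<bar>c n t\<bar> \<le> 2 * A * r ^ n" if "n \<noteq> 0" using sc(2)[OF _ t, of n] drop[of "2 * A" n] A that by auto
    moreover have "0 \<le> r ^ n" using R by simp
    ultimately show "\<bar>c n t\<bar> \<le> (1 + 2 * A) * r ^ n"
      using A 0(3)[of t] by (cases "n = 0") (auto simp: algebra_simps intro: order_trans)
  qed
  have gb: "geom_bounded J R a" "geom_bounded J R s" "geom_bounded J R c"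
    unfolding geom_bounded_def using R rR a' s' c' by blast+
  \<comment> \<open>Coefficients of \<open>h^2\<close>; below, \<open>b\<close> are those of
    \<open>x h\<close> and \<open>d\<close> those of \<open>h\<^sub>\<theta>\<close>.\<close>
  define q where "q n t = (\<Sum>j\<le>n. a j t * a (n - j) t)" for n t
  have q: "\<bar>q n t\<bar> \<le> A\<^sup>2 * real (Suc n) * r ^ n" if "t \<in> J" for n t
  proof -
    have "\<bar>q n t\<bar> \<le> (\<Sum>j\<le>n. A\<^sup>2 * r ^ n)"
      unfolding q_def
    proof (rule order_trans[OF sum_abs], rule sum_mono)
      fix j assume j: "j \<in> {..n}"
      have "\<bar>a j t\<bar> * \<bar>a (n - j) t\<bar> \<le> (A * r ^ j) * (A * r ^ (n - j))"
        using a'[OF that] A R by (intro mult_mono) auto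
      also have "\<dots> = A\<^sup>2 * (r ^ j * r ^ (n - j))" by (simp add: power2_eq_square)
      also have "r ^ j * r ^ (n - j) = r ^ n" using j by (simp flip: power_add)
      finally show "\<bar>a j t * a (n - j) t\<bar> \<le> A\<^sup>2 * r ^ n" by (simp add: abs_mult)
    qed
    then show ?thesis by (simp add: mult_ac)
  qed
  have gq: "geom_bounded J R q" by (rule geom_bounded_linear_factor[OF R(2) rR q R(1)])
  define b where "b n t = (case n of 0 \<Rightarrow> 0 | Suc m \<Rightarrow> a m t)" for n t
  have gb_b: "geom_bounded J R b"
    unfolding geom_bounded_def
  proof (intro exI conjI allI ballI)
    show "\<bar>b n t\<bar> \<le> A / r * r ^ n" if "t \<in> J" for n t
      using a'[OF that] A R by (cases n) (auto simp: b_def)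
  qed (use R rR in auto)
  define d where "d = graph_rhs p l a s"
  have pc: "continuous_on {t0..t1} p" using Ck_on_imp_continuous_on[OF p[of 0]] continuous_on_subset by blast
  have d_eq: "d n t = - p t * s n t - l * (powser_diffs q n t / 2 - powser_diffs b n t + (if n = 1 then 1 else 0))" for n t
    by (simp add: d_def graph_rhs_def powser_diffs_def q_def b_def)
  have gd: "geom_bounded J R d"
  proof -
    have "compact (p ` {t0..t1})" by (rule compact_continuous_image[OF pc]) simp
    then obtain P where P: "\<And>t. t \<in> {t0..t1} \<Longrightarrow> \<bar>p t\<bar> \<le> P"
      using compact_imp_bounded bounded_real by (metis imageI)
    obtain C1 r1 where 1: "0 < r1" "r1 * R < 1" "\<And>n t. t \<in> J \<Longrightarrow> \<bar>powser_diffs q n t\<bar> \<le> C1 * r1 ^ n"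
      using geom_bounded_diffs[OF gq R(1)] unfolding geom_bounded_def by blast
    obtain C2 r2 where 2: "0 < r2" "r2 * R < 1" "\<And>n t. t \<in> J \<Longrightarrow> \<bar>powser_diffs b n t\<bar> \<le> C2 * r2 ^ n"
      using geom_bounded_diffs[OF gb_b R(1)] unfolding geom_bounded_def by blast
    define m where "m = max r (max r1 r2)"
    have m: "0 < m" "m * R < 1" "r \<le> m" "r1 \<le> m" "r2 \<le> m" using R rR 1 2 by (auto simp: m_def max_def)
    show ?thesis
      unfolding geom_bounded_def
    proof (intro exI conjI allI ballI)
      fix n t assume t: "t \<in> J"
      have "\<bar>p t * s n t\<bar> \<le> P * (2 * A * r ^ n)"
        unfolding abs_mult using P[of t] s'[OF t, of n] t J A R by (intro mult_mono) auto
      also have "\<dots> \<le> P * (2 * A * m ^ n)"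
        using m R A P[of t] t J by (intro mult_left_mono power_mono) auto
      finally have 3: "\<bar>p t * s n t\<bar> \<le> P * (2 * A * m ^ n)" .
      have "\<bar>powser_diffs q n t\<bar> \<le> \<bar>C1\<bar> * m ^ n" "\<bar>powser_diffs b n t\<bar> \<le> \<bar>C2\<bar> * m ^ n"
        using order_trans[OF 1(3)[OF t] mult_mono[OF abs_ge_self power_mono[OF m(4)]]]
          order_trans[OF 2(3)[OF t] mult_mono[OF abs_ge_self power_mono[OF m(5)]]] 1(1) 2(1) by auto
      moreover have "\<bar>if n = 1 then 1 else 0\<bar> \<le> 1 / m * m ^ n" using m by simp
      ultimately have "\<bar>powser_diffs q n t / 2 - powser_diffs b n t + (if n = 1 then 1 else 0)\<bar>
          \<le> \<bar>C1\<bar> * m ^ n + \<bar>C2\<bar> * m ^ n + 1 / m * m ^ n"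
        by linarith
      then have "\<bar>powser_diffs q n t / 2 - powser_diffs b n t + (if n = 1 then 1 else 0)\<bar>
          \<le> (\<bar>C1\<bar> + \<bar>C2\<bar> + 1 / m) * m ^ n"
        by (simp only: distrib_right)
      then have "\<bar>l * (powser_diffs q n t / 2 - powser_diffs b n t + (if n = 1 then 1 else 0))\<bar> \<le> \<bar>l\<bar> * ((\<bar>C1\<bar> + \<bar>C2\<bar> + 1 / m) * m ^ n)"
        unfolding abs_mult[of l] by (rule mult_left_mono) simp
      with 3 have "\<bar>d n t\<bar> \<le> P * (2 * A * m ^ n) + \<bar>l\<bar> * ((\<bar>C1\<bar> + \<bar>C2\<bar> + 1 / m) * m ^ n)"
        unfolding d_eq by linarith
      then show "\<bar>d n t\<bar> \<le> (P * 2 * A + \<bar>l\<bar> * (\<bar>C1\<bar> + \<bar>C2\<bar> + 1 / m)) * m ^ n"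
        by (simp only: distrib_right mult.assoc)
    qed (use m in auto)
  qed
  have a_der: "(a n has_real_derivative d n t) (at t)" if "t \<in> J" for n t
  proof -
    have "(a n has_real_derivative d n t) (at t within {t0..t1})"
      using coeffs that J unfolding graph_coeffs_def d_def by blast
    then show ?thesis using that by (simp add: J_def at_within_Icc_at)
  qed
  have contJ: "continuous_on J (a n)" "continuous_on J (s n)" "continuous_on J p" for n
    using graph_coeffs_continuous[OF coeffs] pc continuous_on_subset J(3) by blast+
  have dcont: "continuous_on J (d n)" for n
    unfolding d_def graph_rhs_def[abs_def] by (cases "n = 1") (auto intro!: continuous_intros contJ)
  \<comment> \<open>The \<open>x\<close>-derivatives of \<open>h\<close> and of
    \<open>h\<^sub>\<theta>\<close>, in the shape expected by
    \<open>first_order_pde_smooth\<close>.\<close>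
  define H where "H j = powser ((powser_diffs ^^ j) a)" for j
  define K where "K j = powser ((powser_diffs ^^ j) d)" for j
  have H_pow: "geom_bounded J R ((powser_diffs ^^ j) a)" "geom_bounded J R ((powser_diffs ^^ j) d)" for j
    by (intro geom_bounded_funpow_diffs gb gd R)+
  have "\<forall>n. (\<forall>t\<in>J. ((powser_diffs ^^ j) a n has_real_derivative (powser_diffs ^^ j) d n t) (at t)) \<and>
      continuous_on J ((powser_diffs ^^ j) a n) \<and> continuous_on J ((powser_diffs ^^ j) d n)" for j
  proof (induction j)
    case (Suc j)
    then show ?case
      by (auto simp: powser_diffs_def[abs_def] intro!: derivative_eq_intros continuous_intros)
  qed (use a_der contJ dcont in auto)
  note coeff_der = this
  have H_der: "(H j has_derivative (\<lambda>v. H (Suc j) z * fst v + K j z * snd v)) (at z)" if "z \<in> D" for j z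
    unfolding H_def K_def using that coeff_der
    by (simp, intro powser_has_derivative[OF H_pow R(1) J(1,2)]) (auto simp: D_def J_def)
  have H_cont: "continuous_on D (H j)" for j
    unfolding H_def D_def J_def[symmetric] by (rule powser_continuous_on[OF H_pow(1) R(1)]) (use coeff_der in blast)
  have K_dx: "((\<lambda>x. K j (x, y)) has_real_derivative K (Suc j) (x, y)) (at x)" if "(x, y) \<in> D" for j x y
    unfolding K_def using powser_dx[OF H_pow(2) R(1), of x y] that by (auto simp: D_def J_def)
  have pde: "K 0 (x, t) = - p t * sin (H 0 (x, t)) - l * (H 0 (x, t) - x) * (H 1 (x, t) - 1)"
    if "(x, t) \<in> D" for x t
  proof -
    have x: "\<bar>x\<bar> < R" and t: "t \<in> J" using that by (auto simp: D_def J_def)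
    have H0: "((\<lambda>x. H 0 (x, t)) has_real_derivative H 1 (x, t)) (at x)"
      using powser_dx[OF gb(1) R(1) x t] by (simp add: H_def)
    have xs: "x \<in> {-R<..<R}" using x by auto
    \<comment> \<open>Differentiating \<open>h^2\<close> both as a series and as a product
      identifies \<open>powser (powser_diffs q)\<close> with \<open>2 h h\<^sub>x\<close>; the same
      device treats \<open>x h\<close>.\<close>
    have "powser q (y, t) = H 0 (y, t) * H 0 (y, t)" if "y \<in> {-R<..<R}" for y
      using powser_mult[OF gb(1) gb(1) R(1) _ t, of y] that by (auto simp: powser_def q_def H_def sums_iff)
    then have "((\<lambda>y. H 0 (y, t) * H 0 (y, t)) has_real_derivative powser (powser_diffs q) (x, t)) (at x)"
      using has_field_derivative_transform_within_open[OF powser_dx[OF gq R(1) x t] _ xs] by auto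
    moreover have "((\<lambda>y. H 0 (y, t) * H 0 (y, t)) has_real_derivative 2 * H 0 (x, t) * H 1 (x, t)) (at x)"
      by (rule derivative_eq_intros H0 refl)+ simp
    ultimately have q1: "powser (powser_diffs q) (x, t) = 2 * H 0 (x, t) * H 1 (x, t)" by (rule DERIV_unique)
    have "powser b (y, t) = y * H 0 (y, t)" if "y \<in> {-R<..<R}" for y
    proof -
      have "summable (\<lambda>n. a n t * y ^ n)" "summable (\<lambda>n. b n t * y ^ n)"
        using powser_summable(2)[OF _ R(1) _ t] gb(1) gb_b that by auto
      from suminf_split_head[OF this(2)] suminf_mult[OF this(1), of y] show ?thesis
        by (simp add: powser_def H_def b_def mult_ac)
    qed
    then have "((\<lambda>y. y * H 0 (y, t)) has_real_derivative powser (powser_diffs b) (x, t)) (at x)"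
      using has_field_derivative_transform_within_open[OF powser_dx[OF gb_b R(1) x t] _ xs] by auto
    moreover have "((\<lambda>y. y * H 0 (y, t)) has_real_derivative H 0 (x, t) + x * H 1 (x, t)) (at x)"
      by (rule derivative_eq_intros H0 refl)+ simp
    ultimately have b1: "powser (powser_diffs b) (x, t) = H 0 (x, t) + x * H 1 (x, t)" by (rule DERIV_unique)
    have s1: "powser s (x, t) = sin (H 0 (x, t))"
      using powser_sin_cos[OF coeffs gb R(1) x t] by (simp add: H_def)
    have sums: "(\<lambda>n. e n t * x ^ n) sums powser e (x, t)" if "geom_bounded J R e" for e
      using powser_summable(2)[OF that R(1) _ t, of x] x by (simp add: powser_def summable_sums)
    have "(\<lambda>n. - p t * (s n t * x ^ n) - l * (powser_diffs q n t * x ^ n / 2 - powser_diffs b n t * x ^ n +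
        (if n = 1 then x ^ n else 0))) sums
        (- p t * powser s (x, t) - l * (powser (powser_diffs q) (x, t) / 2 - powser (powser_diffs b) (x, t) + x ^ 1))"
      by (intro sums_diff sums_mult sums_add sums_divide sums sums_single gb geom_bounded_diffs gq gb_b R)
    moreover have "d n t * x ^ n = - p t * (s n t * x ^ n) - l * (powser_diffs q n t * x ^ n / 2 - powser_diffs b n t * x ^ n +
        (if n = 1 then x ^ n else 0))" for n
      unfolding d_eq by (simp add: algebra_simps)
    ultimately have "K 0 (x, t) = - p t * powser s (x, t) -
        l * (powser (powser_diffs q) (x, t) / 2 - powser (powser_diffs b) (x, t) + x ^ 1)"
      by (simp add: K_def powser_def sums_iff)
    then show ?thesis unfolding q1 b1 s1 by (simp add: algebra_simps)
  qed
  have "smooth_on D (H 0)"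
  proof (rule first_order_pde_smooth[where h = H and k = K, OF _ H_cont H_der K_dx])
    show "jet_expr H p (\<lambda>z. ((-1) * p (snd z)) * sin (H 0 z) + ((-l) * (H 0 z + (-1) * fst z)) * (H 1 z + (-1)))"
      by (intro jet_expr.intros)
    show "K 0 z = ((-1) * p (snd z)) * sin (H 0 z) + ((-l) * (H 0 z + (-1) * fst z)) * (H 1 z + (-1))" if "z \<in> D" for z
      using pde[of "fst z" "snd z"] that by simp
  qed (auto simp: D_def intro!: open_Times p)
  then show "smooth_on D (powser a)" by (simp add: H_def)
  show "(powser a has_derivative (\<lambda>v. powser (powser_diffs a) z * fst v +
      (- p (snd z) * sin (powser a z) - l * (powser a z - fst z) * (powser (powser_diffs a) z - 1)) * snd v)) (at z)"
    if "z \<in> D"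
    using H_der[OF that, of 0] pde[of "fst z" "snd z"] that by (simp add: H_def)
qed

section \<open>Existence of the slow graph\<close>

text \<open>Here \<open>x = \<Omega> - k\<pi>\<close>, \<open>G = (-1)\<^sup>k F\<close> and the manifold is \<open>\<omega> + x = H (x, \<theta>)\<close>; the coefficient of \<open>snd v\<close> is
  the value of \<open>H\<^sub>\<theta>\<close> that makes the graph invariant.\<close>

definition slow_graph :: "(real \<Rightarrow> real) \<Rightarrow> real \<Rightarrow> real \<Rightarrow> real \<Rightarrow> real \<Rightarrow> real \<Rightarrow> real \<Rightarrow>
    (real \<times> real \<Rightarrow> real) \<Rightarrow> (real \<times> real \<Rightarrow> real) \<Rightarrow> bool" where
  "slow_graph G l R t0 t1 C eps H H' \<longleftrightarrow> smooth_on ({-R<..<R} \<times> {t0<..<t1}) H \<and>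
    (\<forall>x t. x \<in> {-R<..<R} \<longrightarrow> t \<in> {t0<..<t1} \<longrightarrow>
      (H has_derivative (\<lambda>v. H' (x, t) * fst v +
        (- G t / eps * sin (H (x, t)) - l * (H (x, t) - x) * (H' (x, t) - 1)) * snd v)) (at (x, t)) \<and>
      \<bar>H (x, t) + eps * l * x / G t\<bar> \<le> C * eps\<^sup>2 \<and> \<bar>H' (x, t)\<bar> \<le> C)"

lemma abs_bounded_on_Icc:
  fixes f :: "real \<Rightarrow> real"
  assumes "continuous_on {a..b} f"
  obtains B where "B \<ge> 0" "\<And>t. t \<in> {a..b} \<Longrightarrow> \<bar>f t\<bar> \<le> B"
proof -
  have "compact (f ` {a..b})" by (rule compact_continuous_image[OF assms]) simp
  then obtain B where "\<forall>y\<in>f ` {a..b}. \<bar>y\<bar> \<le> B" using compact_imp_bounded bounded_real by metis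
  then show thesis by (intro that[of "\<bar>B\<bar>"]) force+
qed

lemma positive_on_Icc_lower_bound:
  fixes f :: "real \<Rightarrow> real"
  assumes "continuous_on {a..b} f" "\<And>t. t \<in> {a..b} \<Longrightarrow> 0 < f t"
  obtains m where "m > 0" "\<And>t. t \<in> {a..b} \<Longrightarrow> m \<le> f t"
proof (cases "a \<le> b")
  case True
  then obtain s where "s \<in> {a..b}" "\<forall>t\<in>{a..b}. f s \<le> f t"
    using continuous_attains_inf[OF _ _ assms(1)] by auto
  then show thesis using that[of "f s"] assms(2) by auto
qed (use that[of 1] in auto)

text \<open>The quadratic term is truncated to \<open>\<psi>\<close>, bounded and Lipschitz with
  constant \<open>4 * \<bar>l\<bar>\<close>; the condition
  \<open>8 * \<bar>l\<bar> * eps \<le> f0\<close> is then the stiffness demanded by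
  \<open>stiff_ode_exists\<close>. The quasi-static bound keeps the solution in [-1, 1], so the
  truncation never acts on it.\<close>

lemma riccati_slope:
  assumes "t0 < t1" and G: "\<And>t. t \<in> {t0..t1} \<Longrightarrow> f0 \<le> G t" "f0 > 0"
    and G': "\<And>t. t \<in> {t0..t1} \<Longrightarrow> (G has_real_derivative G' t) (at t)" "\<And>t. t \<in> {t0..t1} \<Longrightarrow> \<bar>G' t\<bar> \<le> g1"
    and eps: "0 < eps" "8 * \<bar>l\<bar> * eps \<le> f0"
  shows "\<exists>y. \<forall>t\<in>{t0..t1}. (y has_real_derivative - (G t / eps) * y t - l * ((y t)\<^sup>2 - 2 * y t + 1)) (at t within {t0..t1}) \<and>
    \<bar>y t\<bar> \<le> 4 * \<bar>l\<bar> / f0 * eps \<and> \<bar>y t + eps * l / G t\<bar> \<le> (12 * l\<^sup>2 / f0 + \<bar>l\<bar> * g1 / f0\<^sup>2) / f0 * eps\<^sup>2"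
proof -
  define \<psi> where "\<psi> u = - l * (1 - max (-1) (min 1 u))\<^sup>2" for u :: real
  define p where "p t = G t / eps" for t
  have Gc: "continuous_on {t0..t1} G" by (rule DERIV_continuous_on) (use G'(1) has_field_derivative_at_within in blast)
  have pc: "continuous_on {t0..t1} p" unfolding p_def by (intro continuous_intros Gc) (use eps in auto)
  have p: "f0 / eps \<le> p t" if "t \<in> {t0..t1}" for t using G(1)[OF that] eps by (simp add: p_def divide_right_mono)
  have \<psi>_bound: "\<bar>\<psi> u\<bar> \<le> 4 * \<bar>l\<bar>" for u
  proof -
    have "(1 - max (-1) (min 1 u))\<^sup>2 \<le> 2\<^sup>2" by (rule power_mono) auto
    then have "\<bar>l\<bar> * (1 - max (-1) (min 1 u))\<^sup>2 \<le> \<bar>l\<bar> * 4" by (intro mult_left_mono) auto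
    then show ?thesis by (simp add: \<psi>_def abs_mult)
  qed
  have \<psi>_lip: "\<bar>\<psi> u - \<psi> v\<bar> \<le> 4 * \<bar>l\<bar> * \<bar>u - v\<bar>" for u v
  proof -
    let ?u = "max (-1) (min 1 u)" and ?v = "max (-1) (min 1 v)"
    have "\<psi> u - \<psi> v = l * ((2 - ?u - ?v) * (?u - ?v))" by (simp add: \<psi>_def power2_eq_square algebra_simps)
    then have "\<bar>\<psi> u - \<psi> v\<bar> = \<bar>l\<bar> * (\<bar>2 - ?u - ?v\<bar> * \<bar>?u - ?v\<bar>)" by (simp add: abs_mult)
    also have "\<dots> \<le> \<bar>l\<bar> * (4 * \<bar>u - v\<bar>)"
    proof (intro mult_left_mono mult_mono)
      have "\<bar>2 - x - y\<bar> \<le> 4" if "- 1 \<le> x" "x \<le> 1" "- 1 \<le> y" "y \<le> 1" for x y :: real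
        using that by linarith
      from this[of ?u ?v] show "\<bar>2 - ?u - ?v\<bar> \<le> 4" by (simp only: max.cobounded1 max.bounded_iff min.cobounded1 le_minus_one_simps(3)) simp
    qed auto
    finally show ?thesis by simp
  qed
  \<comment> \<open>Starting at the leading-order equilibrium makes the initial error in the refined
    estimate zero.\<close>
  have "\<exists>y. y t0 = - (eps * l / G t0) \<and> (\<forall>t\<in>{t0..t1}. (y has_real_derivative - p t * y t + \<psi> (y t)) (at t within {t0..t1}))"
  proof (rule stiff_ode_exists[OF _ pc _ \<psi>_lip])
    show "2 * (4 * \<bar>l\<bar>) \<le> p t" if "t \<in> {t0..t1}" for t
      using p[OF that] eps by (intro order_trans[OF _ p[OF that]]) (simp add: field_simps)
  qed (use assms(1) in simp)
  then obtain y where y: "y t0 = - (eps * l / G t0)"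
    "\<And>t. t \<in> {t0..t1} \<Longrightarrow> (y has_real_derivative - p t * y t + \<psi> (y t)) (at t within {t0..t1})" by blast
  have yb: "\<bar>y t\<bar> \<le> 4 * \<bar>l\<bar> / f0 * eps" if "t \<in> {t0..t1}" for t
  proof (rule linear_ode_bound[OF y(2) pc _ _ that])
    show "\<bar>\<psi> (y s)\<bar> \<le> 4 * \<bar>l\<bar> / f0 * eps * p s" if "s \<in> {t0..t1}" for s
    proof -
      have "4 * \<bar>l\<bar> = 4 * \<bar>l\<bar> / f0 * eps * (f0 / eps)" using eps G(2) by simp
      also have "\<dots> \<le> 4 * \<bar>l\<bar> / f0 * eps * p s" using p[OF that] eps G(2) by (intro mult_left_mono) auto
      finally show ?thesis using \<psi>_bound[of "y s"] by linarith
    qed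
    have "f0 \<le> G t0" using G(1) assms(1) by simp
    then have "eps * \<bar>l\<bar> / G t0 \<le> eps * \<bar>l\<bar> / f0" using eps G(2) by (intro divide_left_mono) auto
    also have "\<dots> \<le> 4 * (eps * \<bar>l\<bar> / f0)"
    proof -
      have "0 \<le> eps * \<bar>l\<bar> / f0" using eps G(2) by simp
      then show ?thesis by linarith
    qed
    finally show "\<bar>y t0\<bar> \<le> 4 * \<bar>l\<bar> / f0 * eps" using \<open>f0 \<le> G t0\<close> eps G(2) by (simp add: y(1) abs_mult mult_ac)
  qed
  have y1: "\<bar>y t\<bar> \<le> 1" if "t \<in> {t0..t1}" for t
  proof -
    have "4 * \<bar>l\<bar> / f0 * eps \<le> 1" using eps G(2) by (simp add: field_simps)
    then show ?thesis using yb[OF that] by simp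
  qed
  have \<psi>y: "\<psi> (y t) = - l * ((y t)\<^sup>2 - 2 * y t + 1)" if "t \<in> {t0..t1}" for t
  proof -
    have "max (-1) (min 1 (y t)) = y t" using y1[OF that] by (auto simp: abs_le_iff)
    then show ?thesis by (simp add: \<psi>_def power2_eq_square algebra_simps)
  qed
  have yder: "(y has_real_derivative - (G t / eps) * y t - l * ((y t)\<^sup>2 - 2 * y t + 1)) (at t within {t0..t1})"
    if "t \<in> {t0..t1}" for t
    using y(2)[OF that] \<psi>y[OF that] by (simp add: p_def)
  let ?K = "12 * l\<^sup>2 / f0 + \<bar>l\<bar> * g1 / f0\<^sup>2"
  have g1: "0 \<le> g1" using G'(2)[of t0] assms(1) by auto
  have "\<bar>y t + eps * l / G t\<bar> \<le> ?K / f0 * eps\<^sup>2" if "t \<in> {t0..t1}" for t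
  \<comment> \<open>The error \<open>y + eps * l / G\<close> obeys the same damped equation, with a
    source of order \<open>eps\<close>: the constant term \<open>l\<close> cancels. Division by
    damping of order \<open>1 / eps\<close> gives order \<open>eps^2\<close>.\<close>
  proof (rule linear_ode_bound[where r = "\<lambda>t. l * (2 * y t - (y t)\<^sup>2) - eps * l * G' t / (G t)\<^sup>2", OF _ pc _ _ that])
    fix s assume s: "s \<in> {t0..t1}"
    have Gs: "0 < G s" using G(1)[OF s] G(2) by simp
    show "((\<lambda>t. y t + eps * l / G t) has_real_derivative - p s * (y s + eps * l / G s) +
        (l * (2 * y s - (y s)\<^sup>2) - eps * l * G' s / (G s)\<^sup>2)) (at s within {t0..t1})"
      by (rule DERIV_cong[OF DERIV_add[OF yder[OF s]
            DERIV_divide[OF DERIV_const[of "eps * l"] has_field_derivative_at_within[OF G'(1)[OF s]]]]])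
         (use Gs eps in \<open>auto simp: p_def power2_eq_square field_simps\<close>)
    have "\<bar>2 * y s - (y s)\<^sup>2\<bar> = \<bar>2 - y s\<bar> * \<bar>y s\<bar>" by (simp add: power2_eq_square algebra_simps flip: abs_mult)
    also have "\<dots> \<le> 3 * (4 * \<bar>l\<bar> / f0 * eps)" using y1[OF s] yb[OF s] by (intro mult_mono) auto
    finally have "\<bar>l * (2 * y s - (y s)\<^sup>2)\<bar> \<le> \<bar>l\<bar> * (3 * (4 * \<bar>l\<bar> / f0 * eps))"
      unfolding abs_mult by (rule mult_left_mono) simp
    also have "\<dots> = 12 * l\<^sup>2 / f0 * eps" by (simp add: power2_eq_square flip: abs_mult)
    finally have 1: "\<bar>l * (2 * y s - (y s)\<^sup>2)\<bar> \<le> 12 * l\<^sup>2 / f0 * eps" .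
    have "\<bar>eps * l * G' s / (G s)\<^sup>2\<bar> = eps * \<bar>l\<bar> * \<bar>G' s\<bar> / (G s)\<^sup>2" using eps by (simp add: abs_mult)
    also have "\<dots> \<le> eps * \<bar>l\<bar> * g1 / f0\<^sup>2"
      using eps G'(2)[OF s] g1 G(1)[OF s] G(2) by (intro frac_le mult_left_mono power_mono) auto
    finally have "\<bar>l * (2 * y s - (y s)\<^sup>2) - eps * l * G' s / (G s)\<^sup>2\<bar> \<le> 12 * l\<^sup>2 / f0 * eps + eps * \<bar>l\<bar> * g1 / f0\<^sup>2"
      using 1 by linarith
    also have "\<dots> = ?K * eps" by (simp add: algebra_simps)
    also have "\<dots> = ?K / f0 * eps\<^sup>2 * (f0 / eps)" using eps G(2) by (simp add: power2_eq_square)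
    also have "\<dots> \<le> ?K / f0 * eps\<^sup>2 * p s"
      using p[OF s] eps G(2) g1 by (intro mult_left_mono) auto
    finally show "\<bar>l * (2 * y s - (y s)\<^sup>2) - eps * l * G' s / (G s)\<^sup>2\<bar> \<le> ?K / f0 * eps\<^sup>2 * p s" .
  next
    show "\<bar>y t0 + eps * l / G t0\<bar> \<le> ?K / f0 * eps\<^sup>2" using G(2) g1 by (simp add: y(1))
  qed
  then show ?thesis using yder yb by blast
qed

lemma slow_graph_exists_pos:
  assumes G: "smooth_on UNIV G" "\<And>t. t \<in> {t0..t1} \<Longrightarrow> 0 < G t" and "t0 < t1" and R: "0 < R"
  shows "\<exists>eps0>0. \<exists>C. \<forall>eps\<in>{0<..<eps0}. \<exists>H H'. slow_graph G l R t0 t1 C eps H H'"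
proof -
  have Gd: "(G has_real_derivative deriv G t) (at t)" for t by (rule smooth_on_real_deriv(1)[OF G(1)])
  have Gc: "continuous_on {t0..t1} G"
    by (rule DERIV_continuous_on) (rule has_field_derivative_at_within[OF Gd])
  obtain f0 where f0: "f0 > 0" "\<And>t. t \<in> {t0..t1} \<Longrightarrow> f0 \<le> G t"
    using positive_on_Icc_lower_bound[OF Gc G(2)] by blast
  obtain g1 where g1: "g1 \<ge> 0" "\<And>t. t \<in> {t0..t1} \<Longrightarrow> \<bar>deriv G t\<bar> \<le> g1"
    using abs_bounded_on_Icc[OF continuous_on_subset[OF smooth_on_real_deriv(2)[OF G(1)] subset_UNIV]] by blast
  \<comment> \<open>\<open>r * R = 1 / 2\<close> gives convergence on the whole box;
    \<open>\<rho>0\<close> is such that the growing weight reaches just \<open>r\<close> at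
    \<open>t1\<close>; \<open>\<kappa>\<close> turns the Riccati bound into
    \<open>A * \<rho>0\<close> with \<open>A = \<kappa> * eps\<close>. \<open>C\<close> collects the
    terms of order at least 2, the error of the linear one, and a bound for the slope.\<close>
  define r where "r = 1 / (2 * R)"
  define \<rho>0 where "\<rho>0 = r * exp (- (4 * \<bar>l\<bar> * (t1 - t0)))"
  define \<kappa> where "\<kappa> = 4 * \<bar>l\<bar> / f0 / \<rho>0"
  define K where "K = 16 + 4 * r"
  define C1 where "C1 = (12 * l\<^sup>2 / f0 + \<bar>l\<bar> * g1 / f0\<^sup>2) / f0"
  define C where "C = 2 * K * \<kappa>\<^sup>2 + R * C1 + r"
  \<comment> \<open>The summands 1 in the denominators prevent division by zero when
    \<open>l = 0\<close>. The two bounds serve the Riccati equation and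
    \<open>K * A \<le> 1\<close>.\<close>
  define eps0 where "eps0 = min (f0 / (8 * \<bar>l\<bar> + 1)) (1 / (K * \<kappa> + 1))"
  have r: "0 < r" "r * R = 1 / 2" using R by (auto simp: r_def)
  have \<rho>0: "0 < \<rho>0" using r by (simp add: \<rho>0_def)
  have \<kappa>: "0 \<le> \<kappa>" using f0 \<rho>0 by (simp add: \<kappa>_def)
  have K: "16 \<le> K" using r by (simp add: K_def)
  have "0 \<le> K * \<kappa>" using K \<kappa> by (intro mult_nonneg_nonneg) simp_all
  then have K\<kappa>: "0 < K * \<kappa> + 1" by linarith
  have C1: "0 \<le> C1" using f0 g1 by (simp add: C1_def)
  have "0 < eps0" using f0 K\<kappa> by (simp add: eps0_def)
  moreover have "\<exists>H H'. slow_graph G l R t0 t1 C eps H H'" if eps_in: "eps \<in> {0<..<eps0}" for eps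
  proof -
    have eps: "0 < eps" "eps \<le> f0 / (8 * \<bar>l\<bar> + 1)" "eps \<le> 1 / (K * \<kappa> + 1)" using eps_in by (auto simp: eps0_def)
    have eps1: "8 * \<bar>l\<bar> * eps \<le> f0" using eps f0 by (simp add: field_simps)
    define A where "A = \<kappa> * eps"
    have KA: "K * A \<le> 1"
      using eps(1,3) K\<kappa> by (simp add: A_def field_simps)
    have A: "0 \<le> A" using \<kappa> eps by (simp add: A_def)
    have A16: "16 * A \<le> 1" using mult_right_mono[OF K A] KA by simp
    obtain a1 where a1: "\<And>t. t \<in> {t0..t1} \<Longrightarrow>
        (a1 has_real_derivative - (G t / eps) * a1 t - l * ((a1 t)\<^sup>2 - 2 * a1 t + 1)) (at t within {t0..t1})"
      "\<And>t. t \<in> {t0..t1} \<Longrightarrow> \<bar>a1 t\<bar> \<le> 4 * \<bar>l\<bar> / f0 * eps" "\<And>t. t \<in> {t0..t1} \<Longrightarrow> \<bar>a1 t + eps * l / G t\<bar> \<le> C1 * eps\<^sup>2"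
      using riccati_slope[OF \<open>t0 < t1\<close> f0(2,1) Gd g1(2) eps(1) eps1] unfolding C1_def by blast
    define p where "p t = G t / eps" for t
    have p_smooth: "Ck_on n UNIV p" for n
      using Ck_on_mult[OF open_UNIV Ck_on_const[OF open_UNIV, of n "1 / eps"], of G] G(1)
      by (simp add: smooth_on_def p_def[abs_def])
    have pc: "continuous_on {t0..t1} p" using Ck_on_imp_continuous_on[OF p_smooth] continuous_on_subset by blast
    have p0: "0 \<le> p t" if "t \<in> {t0..t1}" for t using f0(2)[OF that] f0(1) eps(1) by (simp add: p_def)
    obtain a s c where asc: "graph_coeffs t0 t1 p l a s c" "a 1 = a1"
      using graph_coeffs_exist[OF pc a1(1)[folded p_def]] by blast
    define \<rho> where "\<rho> t = \<rho>0 * exp (4 * \<bar>l\<bar> * (t - t0))" for t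
    have \<rho>: "0 \<le> \<rho> t" "\<rho> t \<le> r" if "t \<in> {t0..t1}" for t
    proof -
      have "\<rho> t = r * exp (4 * \<bar>l\<bar> * (t - t1))" by (simp add: \<rho>_def \<rho>0_def algebra_simps flip: exp_add)
      also have "\<dots> \<le> r * 1" using r that by (intro mult_left_mono) (auto simp: mult_le_0_iff mult_nonneg_nonpos)
      finally show "\<rho> t \<le> r" by simp
      show "0 \<le> \<rho> t" using \<rho>0 by (simp add: \<rho>_def)
    qed
    have a1A: "\<bar>a 1 t\<bar> \<le> A * \<rho>0" if "t \<in> {t0..t1}" for t
      using a1(2)[OF that] \<rho>0 unfolding asc(2) by (simp add: A_def \<kappa>_def)
    have a1': "\<bar>a 1 t\<bar> \<le> 1" if "t \<in> {t0..t1}" for t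
    proof -
      have "4 * \<bar>l\<bar> / f0 * eps \<le> 1" using eps1 eps(1) f0 by (simp add: field_simps)
      then show ?thesis using a1(2)[OF that] unfolding asc(2) by simp
    qed
    have a2: "\<bar>a n t\<bar> \<le> K * A\<^sup>2 / (real n)\<^sup>2 * r ^ n" if "n \<ge> 2" "t \<in> {t0..t1}" for n t
    proof -
      have "\<bar>a n t\<bar> \<le> K * A\<^sup>2 / (real n)\<^sup>2 * \<rho> t ^ n"
        unfolding K_def
        by (rule graph_coeffs_bound[OF asc(1) pc _ \<rho>_def \<rho>0 _ a1' a1A A KA[unfolded K_def] that])
           (use p0 \<rho> in auto)
      also have "\<dots> \<le> K * A\<^sup>2 / (real n)\<^sup>2 * r ^ n"
        using \<rho>[OF that(2)] K by (intro mult_left_mono power_mono) auto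
      finally show ?thesis .
    qed
    have KA2: "K * A\<^sup>2 \<le> A" using mult_right_mono[OF KA A] by (simp add: power2_eq_square mult.assoc)
    have a: "\<bar>a n t\<bar> \<le> A / (real n)\<^sup>2 * r ^ n" if "n \<ge> 1" "t \<in> {t0..t1}" for n t
    proof (cases "n = 1")
      case True
      have "\<rho>0 \<le> r" using \<rho>(2)[of t0] \<open>t0 < t1\<close> by (simp add: \<rho>_def)
      then have "A * \<rho>0 \<le> A * r" using A by (rule mult_left_mono)
      then show ?thesis using a1A[OF that(2)] True by simp
    next
      case False
      then have "\<bar>a n t\<bar> \<le> K * A\<^sup>2 / (real n)\<^sup>2 * r ^ n" using a2 that by simp
      also have "\<dots> \<le> A / (real n)\<^sup>2 * r ^ n"
        using KA2 r by (intro mult_right_mono divide_right_mono) auto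
      finally show ?thesis .
    qed
    note graph = graph_series[OF asc(1) p_smooth R r(1) _ A A16 a]
    have "slow_graph G l R t0 t1 C eps (powser a) (powser (powser_diffs a))"
      unfolding slow_graph_def
    proof (intro conjI allI impI)
      show "smooth_on ({-R<..<R} \<times> {t0<..<t1}) (powser a)" using graph(1) r by simp
      fix x t assume xt: "x \<in> {-R<..<R}" "t \<in> {t0<..<t1}"
      then have x: "\<bar>x\<bar> \<le> R" and t: "t \<in> {t0..t1}" by auto
      show "(powser a has_derivative (\<lambda>v. powser (powser_diffs a) (x, t) * fst v +
        (- G t / eps * sin (powser a (x, t)) - l * (powser a (x, t) - x) * (powser (powser_diffs a) (x, t) - 1)) * snd v)) (at (x, t))"
        using graph(2)[of "(x, t)"] r xt by (simp add: p_def)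
      have "\<bar>powser (powser_diffs a) (x, t)\<bar> \<le> 2 * (A * r)"
      proof (rule powser_bound[OF _ _ _ x])
        fix n
        have "real (Suc n) * \<bar>a (Suc n) t\<bar> \<le> real (Suc n) * (A / (real (Suc n))\<^sup>2 * r ^ Suc n)"
          using a[of "Suc n" t] t by (intro mult_left_mono) auto
        also have "\<dots> = 1 / real (Suc n) * (A * r * r ^ n)" by (simp add: power2_eq_square)
        also have "\<dots> \<le> 1 * (A * r * r ^ n)" using A r by (intro mult_right_mono) auto
        finally show "\<bar>powser_diffs a n t\<bar> \<le> A * r * r ^ n" by (simp add: powser_diffs_def abs_mult)
      qed (use r in auto)
      also have "\<dots> = 2 * A * r" by simp
      also have "\<dots> \<le> 1 * r" using A16 A r by (intro mult_right_mono) auto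
      also have "\<dots> \<le> C" using K C1 R by (simp add: C_def)
      finally show "\<bar>powser (powser_diffs a) (x, t)\<bar> \<le> C" .
      \<comment> \<open>Removing the linear coefficient leaves a tail of size \<open>A^2\<close>,
        hence of order \<open>eps^2\<close>; the linear term is compared with
        \<open>- eps * l * x / G t\<close> by the refined Riccati estimate.\<close>
      define b where "b n s = (if n = 1 then 0 else a n s)" for n s
      have b: "\<bar>b n t\<bar> \<le> K * A\<^sup>2 * r ^ n" for n
      proof -
        consider "n = 0" | "n = 1" | "n \<ge> 2" by linarith
        then show ?thesis
        proof cases
          case 1
          then show ?thesis using asc(1) K by (simp add: b_def graph_coeffs_def)
        next
          case 2
          then show ?thesis using K r by (simp add: b_def)
        next
          case 3
          then have "\<bar>b n t\<bar> \<le> K * A\<^sup>2 / (real n)\<^sup>2 * r ^ n" using a2[OF 3 t] by (simp add: b_def)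
          also have "\<dots> \<le> K * A\<^sup>2 / 1 * r ^ n"
            using 3 K r by (intro mult_right_mono divide_left_mono) auto
          finally show ?thesis by simp
        qed
      qed
      have "geom_bounded {t} R b"
        unfolding geom_bounded_def using b r by (intro exI[of _ "K * A\<^sup>2"] exI[of _ r]) auto
      then have "summable (\<lambda>n. b n t * x ^ n)" by (rule powser_summable(2)[OF _ R x]) simp
      then have "(\<lambda>n. b n t * x ^ n + (if n = 1 then a1 t * x ^ n else 0)) sums (powser b (x, t) + a1 t * x ^ 1)"
        by (intro sums_add sums_single) (simp add: powser_def summable_sums)
      moreover have "b n t * x ^ n + (if n = 1 then a1 t * x ^ n else 0) = a n t * x ^ n" for n
        by (simp add: b_def asc(2)[symmetric])
      ultimately have "powser a (x, t) = powser b (x, t) + a1 t * x" by (simp add: powser_def sums_iff)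
      then have "powser a (x, t) + eps * l * x / G t = powser b (x, t) + (a1 t + eps * l / G t) * x"
        by (simp add: algebra_simps)
      also have "\<bar>\<dots>\<bar> \<le> 2 * (K * A\<^sup>2) + C1 * eps\<^sup>2 * R"
      proof (rule order_trans[OF abs_triangle_ineq], rule add_mono)
        show "\<bar>powser b (x, t)\<bar> \<le> 2 * (K * A\<^sup>2)" by (rule powser_bound[where c = b and r = r, OF b _ _ x]) (use r in auto)
        show "\<bar>(a1 t + eps * l / G t) * x\<bar> \<le> C1 * eps\<^sup>2 * R"
          unfolding abs_mult using a1(3)[OF t] x C1 by (intro mult_mono) auto
      qed
      also have "\<dots> = (2 * K * \<kappa>\<^sup>2 + R * C1) * eps\<^sup>2" by (simp add: A_def power_mult_distrib algebra_simps)
      also have "\<dots> \<le> C * eps\<^sup>2" using r by (intro mult_right_mono) (auto simp: C_def)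
      finally show "\<bar>powser a (x, t) + eps * l * x / G t\<bar> \<le> C * eps\<^sup>2" .
    qed
    then show ?thesis by blast
  qed
  ultimately show ?thesis by blast
qed

text \<open>For \<open>G < 0\<close> the graph is attracting in backward time: reversing \<open>t\<close> turns \<open>(G, l)\<close> into \<open>(- G, - l)\<close>.\<close>

lemma slow_graph_reverse:
  assumes "slow_graph (\<lambda>t. - G (- t)) (- l) R (- t1) (- t0) C eps H H'"
  shows "slow_graph G l R t0 t1 C eps (\<lambda>z. H (fst z, - snd z)) (\<lambda>z. H' (fst z, - snd z))"
  unfolding slow_graph_def
proof (intro conjI allI impI)
  let ?m = "\<lambda>z :: real \<times> real. (fst z, - snd z)"
  have m: "bounded_linear ?m"
    by (intro bounded_linear_Pair bounded_linear_fst bounded_linear_minus bounded_linear_snd)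
  show "smooth_on ({-R<..<R} \<times> {t0<..<t1}) (\<lambda>z. H (?m z))"
    unfolding smooth_on_def
  proof
    fix n
    have "Ck_on n ({-R<..<R} \<times> {-t1<..<-t0}) H" using assms by (simp add: slow_graph_def smooth_on_def)
    then show "Ck_on n ({-R<..<R} \<times> {t0<..<t1}) (\<lambda>z. H (?m z))"
      by (rule Ck_on_compose[OF _ _ _ Ck_on_linear[OF m], rotated 4]) (auto intro!: open_Times)
  qed
  fix x t assume xt: "x \<in> {-R<..<R}" "t \<in> {t0<..<t1}"
  then have xt': "x \<in> {-R<..<R}" "- t \<in> {-t1<..<-t0}" by auto
  have H: "(H has_derivative (\<lambda>v. H' (x, - t) * fst v +
      (- (- G t) / eps * sin (H (x, - t)) + l * (H (x, - t) - x) * (H' (x, - t) - 1)) * snd v)) (at (?m (x, t)))"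
    using assms[unfolded slow_graph_def, THEN conjunct2, rule_format, OF xt'] by simp
  have "(?m has_derivative ?m) (at (x, t))" by (rule bounded_linear_imp_has_derivative[OF m])
  from has_derivative_compose[OF this H]
  show "((\<lambda>z. H (?m z)) has_derivative (\<lambda>v. H' (?m (x, t)) * fst v +
      (- G t / eps * sin (H (?m (x, t))) - l * (H (?m (x, t)) - x) * (H' (?m (x, t)) - 1)) * snd v)) (at (x, t))"
    by (rule has_derivative_eq_rhs) (auto simp: fun_eq_iff algebra_simps)
  show "\<bar>H (?m (x, t)) + eps * l * x / G t\<bar> \<le> C * eps\<^sup>2" "\<bar>H' (?m (x, t))\<bar> \<le> C"
    using assms[unfolded slow_graph_def, THEN conjunct2, rule_format, OF xt'] by simp_all
qed

lemma slow_graph_exists: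
  assumes G: "smooth_on UNIV G" "(\<forall>t\<in>{t0..t1}. 0 < G t) \<or> (\<forall>t\<in>{t0..t1}. G t < 0)" and "t0 < t1" "0 < R"
  shows "\<exists>eps0>0. \<exists>C. \<forall>eps\<in>{0<..<eps0}. \<exists>H H'. slow_graph G l R t0 t1 C eps H H'"
  using G(2)
proof
  assume "\<forall>t\<in>{t0..t1}. G t < 0"
  moreover have "smooth_on UNIV (\<lambda>t. - G (- t))"
    unfolding smooth_on_def
  proof
    fix n
    have "Ck_on n UNIV (\<lambda>t. G (- t))"
      by (rule Ck_on_compose[OF open_UNIV open_UNIV _ Ck_on_minus[OF open_UNIV Ck_on_id]])
         (use G(1) in \<open>auto simp: smooth_on_def\<close>)
    then show "Ck_on n UNIV (\<lambda>t. - G (- t))" by (rule Ck_on_minus[OF open_UNIV])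
  qed
  ultimately obtain eps0 C where "eps0 > 0"
    "\<forall>eps\<in>{0<..<eps0}. \<exists>H H'. slow_graph (\<lambda>t. - G (- t)) (- l) R (- t1) (- t0) C eps H H'"
    using slow_graph_exists_pos[of "\<lambda>t. - G (- t)" "- t1" "- t0" R "- l"] assms(3,4) by force
  then show ?thesis using slow_graph_reverse by meson
qed (use slow_graph_exists_pos[OF G(1) _ assms(3,4)] in blast)

section \<open>Comparison estimates and surfaces\<close>

lemma sin_add_int_pi: "sin (u + of_int k * pi) = (-1) powi k * sin (u :: real)"
proof (cases "even k")
  case True
  then obtain m where "k = 2 * m" by blast
  then show ?thesis using sin.plus_of_int[of u m] True by (simp add: power_int_minus_left mult_ac)
next
  case False
  have shift: "sin (v + of_int m * (2 * pi)) = sin v" for v and m :: int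
    using sin.plus_of_int[of v m] by simp
  from False obtain m where "k = 2 * m + 1" by (blast elim: oddE)
  then have eq: "u + of_int k * pi = (u + pi) + of_int m * (2 * pi)" by (simp add: algebra_simps)
  have "sin (u + of_int k * pi) = sin (u + pi)" unfolding eq shift ..
  then show ?thesis using False by (simp add: power_int_minus_left)
qed

text \<open>\<open>e^2\<close> multiplied by \<open>exp (- 2 * L * t)\<close> is nonincreasing, and
  multiplied by \<open>exp (2 * L * t)\<close> nondecreasing. Both directions are used, as local
  invariance concerns backward time too.\<close>

lemma gronwall_zero:
  fixes e e' :: "real \<Rightarrow> real"
  assumes der: "\<And>t. t \<in> {c..d} \<Longrightarrow> (e has_real_derivative e' t) (at t within {c..d})"
    and le: "\<And>t. t \<in> {c..d} \<Longrightarrow> \<bar>e' t\<bar> \<le> L * \<bar>e t\<bar>"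
    and s: "s \<in> {c..d}" "e s = 0" and t: "t \<in> {c..d}"
  shows "e t = 0"
proof -
  have ee: "\<bar>e t * e' t\<bar> \<le> L * (e t)\<^sup>2" if "t \<in> {c..d}" for t
    using mult_left_mono[OF le[OF that], of "\<bar>e t\<bar>"] by (simp add: abs_mult power2_eq_square mult_ac)
  consider "s \<le> t" | "t \<le> s" by linarith
  then have "(e t)\<^sup>2 \<le> 0"
  proof cases
    case 1
    have "(e t)\<^sup>2 * exp (- 2 * L * t) \<le> (e s)\<^sup>2 * exp (- 2 * L * s)"
    proof (rule nonincreasing_on_Icc[where a = c and b = d and f = "\<lambda>t. (e t)\<^sup>2 * exp (- 2 * L * t)"
          and f' = "\<lambda>t. 2 * (e t * e' t - L * (e t)\<^sup>2) * exp (- 2 * L * t)"])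
      fix t assume t: "t \<in> {c..d}"
      show "((\<lambda>t. (e t)\<^sup>2 * exp (- 2 * L * t)) has_real_derivative
          2 * (e t * e' t - L * (e t)\<^sup>2) * exp (- 2 * L * t)) (at t within {c..d})"
        by (rule derivative_eq_intros der[OF t] refl)+ (simp add: algebra_simps power2_eq_square)
      show "2 * (e t * e' t - L * (e t)\<^sup>2) * exp (- 2 * L * t) \<le> 0"
        using ee[OF t] by (simp add: mult_le_0_iff abs_le_iff)
    qed (use 1 s t in auto)
    then show ?thesis using s(2) by (simp add: mult_le_0_iff)
  next
    case 2
    have "- ((e s)\<^sup>2 * exp (2 * L * s)) \<le> - ((e t)\<^sup>2 * exp (2 * L * t))"
    proof (rule nonincreasing_on_Icc[where a = c and b = d and f = "\<lambda>t. - ((e t)\<^sup>2 * exp (2 * L * t))"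
          and f' = "\<lambda>t. - (2 * (e t * e' t + L * (e t)\<^sup>2) * exp (2 * L * t))"])
      fix t assume t: "t \<in> {c..d}"
      show "((\<lambda>t. - ((e t)\<^sup>2 * exp (2 * L * t))) has_real_derivative
          - (2 * (e t * e' t + L * (e t)\<^sup>2) * exp (2 * L * t))) (at t within {c..d})"
        by (rule derivative_eq_intros der[OF t] refl)+ (simp add: algebra_simps power2_eq_square)
      show "- (2 * (e t * e' t + L * (e t)\<^sup>2) * exp (2 * L * t)) \<le> 0"
        using ee[OF t] by (simp add: zero_le_mult_iff abs_le_iff)
    qed (use 2 s t in auto)
    then show ?thesis using s(2) by (simp add: mult_le_0_iff)
  qed
  then show ?thesis by simp
qed

text \<open>By the mean value theorem the increment is \<open>d * cos \<xi>\<close> with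
  \<open>\<bar>\<xi>\<bar> \<le> 1 < pi / 3\<close>, where the cosine is at least 1/2. The extra
  factor \<open>d\<close> makes the estimate independent of its sign.\<close>

lemma sin_diff_ge:
  fixes u d :: real
  assumes "\<bar>u\<bar> \<le> 1 / 2" "\<bar>d\<bar> \<le> 1 / 2"
  shows "d\<^sup>2 / 2 \<le> d * (sin (u + d) - sin u)"
proof -
  have mvt: "\<exists>\<xi>. \<bar>\<xi>\<bar> \<le> 1 \<and> sin y - sin x = (y - x) * cos \<xi>" if xy: "x < y" "\<bar>x\<bar> \<le> 1" "\<bar>y\<bar> \<le> 1" for x y :: real
  proof -
    obtain z where "x < z" "z < y" "sin y - sin x = (y - x) * cos z"
      using MVT2[OF xy(1), of sin cos] DERIV_sin by blast
    then show ?thesis using xy by (intro exI[of _ z]) auto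
  qed
  have "\<exists>\<xi>. \<bar>\<xi>\<bar> \<le> 1 \<and> sin (u + d) - sin u = d * cos \<xi>"
  proof -
    consider "d > 0" | "d = 0" | "d < 0" by linarith
    then show ?thesis
    proof cases
      case 1
      then show ?thesis using mvt[of u "u + d"] assms by auto
    next
      case 2
      then show ?thesis by (auto intro: exI[of _ 0])
    next
      case 3
      then have "u + d < u" "\<bar>u + d\<bar> \<le> 1" "\<bar>u\<bar> \<le> 1" using assms by auto
      from mvt[OF this] obtain \<xi> where "\<bar>\<xi>\<bar> \<le> 1" "sin u - sin (u + d) = - d * cos \<xi>" by auto
      then show ?thesis by (intro exI[of _ \<xi>]) simp
    qed
  qed
  then obtain \<xi> where \<xi>: "\<bar>\<xi>\<bar> \<le> 1" "sin (u + d) - sin u = d * cos \<xi>" by blast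
  have "cos (pi / 3) \<le> cos \<bar>\<xi>\<bar>" using \<xi>(1) pi_gt3 by (intro cos_monotone_0_pi_le) auto
  then have "1 / 2 \<le> cos \<xi>" by (simp add: cos_60)
  then have "d\<^sup>2 * (1 / 2) \<le> d\<^sup>2 * cos \<xi>" by (intro mult_left_mono) auto
  then show ?thesis unfolding \<xi>(2) by (simp add: power2_eq_square)
qed

text \<open>While \<open>\<bar>e\<bar> \<le> 1 / 2\<close>, the sine difference damps
  \<open>e^2\<close> at rate \<gamma> and \<open>m\<close> costs at most \<gamma>/2, so
  \<open>e^2\<close> decays at rate \<gamma>/2. The decay in turn prevents \<open>e\<close> from
  reaching the threshold.\<close>

lemma exponential_decay:
  fixes e \<eta> g m :: "real \<Rightarrow> real"
  assumes der: "\<And>t. t \<in> {0..T} \<Longrightarrow>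
      (e has_real_derivative - g t * (sin (\<eta> t + e t) - sin (\<eta> t)) + m t * e t) (at t within {0..T})"
    and g: "\<And>t. t \<in> {0..T} \<Longrightarrow> \<gamma> \<le> g t" and m: "\<And>t. t \<in> {0..T} \<Longrightarrow> \<bar>m t\<bar> \<le> \<gamma> / 4"
    and \<eta>: "\<And>t. t \<in> {0..T} \<Longrightarrow> \<bar>\<eta> t\<bar> \<le> 1 / 2" and init: "\<bar>e 0\<bar> < 1 / 2" and t: "t \<in> {0..T}"
  shows "\<bar>e t\<bar> \<le> exp (- \<gamma> / 4 * t) * \<bar>e 0\<bar>"
proof -
  have cont: "continuous_on {0..T} e" by (rule DERIV_continuous_on[OF der])
  have \<gamma>: "0 \<le> \<gamma>" using m[OF t] by linarith
  have decay: "(e s)\<^sup>2 * exp (\<gamma> / 2 * s) \<le> (e 0)\<^sup>2"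
    if s: "s \<in> {0..T}" and small: "\<And>r. 0 < r \<Longrightarrow> r < s \<Longrightarrow> \<bar>e r\<bar> \<le> 1 / 2" for s
  proof -
    have "(e s)\<^sup>2 * exp (\<gamma> / 2 * s) \<le> (e 0)\<^sup>2 * exp (\<gamma> / 2 * 0)"
    proof (rule DERIV_nonpos_imp_decreasing_open[of 0 s "\<lambda>s. (e s)\<^sup>2 * exp (\<gamma> / 2 * s)"])
      fix r assume r: "0 < r" "r < s"
      then have rT: "r \<in> {0..T}" "at r within {0..T} = at r" using s by (auto simp: at_within_Icc_at)
      let ?y = "2 * e r * (- g r * (sin (\<eta> r + e r) - sin (\<eta> r)) + m r * e r) * exp (\<gamma> / 2 * r) + (e r)\<^sup>2 * (exp (\<gamma> / 2 * r) * (\<gamma> / 2))"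
      have "((\<lambda>s. (e s)\<^sup>2 * exp (\<gamma> / 2 * s)) has_real_derivative ?y) (at r)"
        by (rule derivative_eq_intros der[OF rT(1), unfolded rT(2)] refl)+ simp
      moreover have "?y \<le> 0"
      proof -
        have 1: "(e r)\<^sup>2 / 2 \<le> e r * (sin (\<eta> r + e r) - sin (\<eta> r))" by (rule sin_diff_ge[OF \<eta>[OF rT(1)] small[OF r]])
        have "\<gamma> * ((e r)\<^sup>2 / 2) \<le> g r * (e r * (sin (\<eta> r + e r) - sin (\<eta> r)))"
          using g[OF rT(1)] 1 \<gamma> by (intro mult_mono) (auto intro: order_trans[OF _ 1])
        moreover have "m r * (e r)\<^sup>2 \<le> \<gamma> / 4 * (e r)\<^sup>2" using m[OF rT(1)] by (intro mult_right_mono) auto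
        ultimately have "2 * (- (g r * (e r * (sin (\<eta> r + e r) - sin (\<eta> r)))) + m r * (e r)\<^sup>2) + \<gamma> / 2 * (e r)\<^sup>2 \<le> 0"
          by simp
        then have "(2 * (- (g r * (e r * (sin (\<eta> r + e r) - sin (\<eta> r)))) + m r * (e r)\<^sup>2) + \<gamma> / 2 * (e r)\<^sup>2) * exp (\<gamma> / 2 * r) \<le> 0"
          by (simp add: mult_le_0_iff)
        also have "(2 * (- (g r * (e r * (sin (\<eta> r + e r) - sin (\<eta> r)))) + m r * (e r)\<^sup>2) + \<gamma> / 2 * (e r)\<^sup>2) * exp (\<gamma> / 2 * r) = ?y"
          by (simp add: power2_eq_square algebra_simps)
        finally show ?thesis .
      qed
      ultimately show "\<exists>y. ((\<lambda>s. (e s)\<^sup>2 * exp (\<gamma> / 2 * s)) has_real_derivative y) (at r) \<and> y \<le> 0" by blast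
    next
      show "continuous_on {0..s} (\<lambda>s. (e s)\<^sup>2 * exp (\<gamma> / 2 * s))"
        by (intro continuous_intros continuous_on_subset[OF cont]) (use s in auto)
    qed (use s in auto)
    then show ?thesis by simp
  qed
  have small: "\<bar>e s\<bar> < 1 / 2" if s: "s \<in> {0..T}" for s
  proof (rule ccontr)
    assume "\<not> \<bar>e s\<bar> < 1 / 2"
    \<comment> \<open>The first time at which the threshold is reached: the decay estimate holds up
      to it and contradicts \<open>\<bar>e 0\<bar> < 1 / 2\<close>.\<close>
    define S where "S = {0..T} \<inter> (\<lambda>r. \<bar>e r\<bar>) -` {1 / 2..}"
    have "closed S" unfolding S_def by (intro continuous_closed_preimage continuous_intros cont)
    moreover have "S \<noteq> {}" using s \<open>\<not> \<bar>e s\<bar> < 1 / 2\<close> by (auto simp: S_def)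
    moreover have "bdd_below S" by (auto simp: S_def intro: bdd_belowI[of _ 0])
    ultimately have r: "Inf S \<in> S" and min: "\<And>q. q \<in> S \<Longrightarrow> Inf S \<le> q"
      by (auto intro: closed_contains_Inf cInf_lower)
    have rT: "Inf S \<in> {0..T}" "1 / 2 \<le> \<bar>e (Inf S)\<bar>" using r by (auto simp: S_def)
    have "(e (Inf S))\<^sup>2 * exp (\<gamma> / 2 * Inf S) \<le> (e 0)\<^sup>2"
    proof (rule decay[OF rT(1)])
      fix q assume q: "0 < q" "q < Inf S"
      then have "q \<notin> S" using min[of q] by auto
      then show "\<bar>e q\<bar> \<le> 1 / 2" using q rT(1) by (auto simp: S_def)
    qed
    moreover have "(e (Inf S))\<^sup>2 * 1 \<le> (e (Inf S))\<^sup>2 * exp (\<gamma> / 2 * Inf S)"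
      using rT(1) \<gamma> by (intro mult_left_mono) auto
    ultimately have "\<bar>e (Inf S)\<bar> \<le> \<bar>e 0\<bar>" by (simp add: abs_le_square_iff)
    then show False using rT(2) init by simp
  qed
  have "(e t)\<^sup>2 * exp (\<gamma> / 2 * t) \<le> (e 0)\<^sup>2"
    by (rule decay[OF t]) (use small t in \<open>auto intro: less_imp_le\<close>)
  also have "exp (\<gamma> / 2 * t) = (exp (\<gamma> / 4 * t))\<^sup>2" by (simp add: power2_eq_square flip: exp_add)
  finally have "\<bar>e t * exp (\<gamma> / 4 * t)\<bar> \<le> \<bar>e 0\<bar>" unfolding abs_le_square_iff by (simp add: power_mult_distrib)
  then have "\<bar>e t\<bar> * exp (\<gamma> / 4 * t) * exp (- \<gamma> / 4 * t) \<le> \<bar>e 0\<bar> * exp (- \<gamma> / 4 * t)"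
    by (intro mult_right_mono) (auto simp: abs_mult)
  then show ?thesis by (simp add: mult_ac flip: exp_add)
qed

section \<open>Charts of surfaces: projections and transport by diffeomorphisms\<close>

lemma homeomorphism_inverse_image:
  assumes "homeomorphism U V f g" "f ` (M \<inter> U) = N \<inter> V"
  shows "g ` (N \<inter> V) = M \<inter> U"
proof -
  have "g ` f ` (M \<inter> U) = M \<inter> U" using assms(1) by (force simp: homeomorphism_def image_iff)
  then show ?thesis using assms(2) by simp
qed

text \<open>Composing a chart inverse with the projection gives a continuous injection from an open
  set of the plane into the plane; invariance of domain makes its image open. This links the
  chart-based \<open>surface_boundary\<close> to the base coordinates, in which solutions are
  followed.\<close>

lemma interior_of_graph_base:
  fixes M :: "state set"
  assumes "straightens_to M {(x, y, z). x = 0} p" "p \<in> M" and inj: "inj_on snd M"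
  shows "snd p \<in> interior (snd ` M)"
proof -
  let ?N = "{(x :: real, y :: real, z :: real). x = 0}"
  obtain U V and f g :: "state \<Rightarrow> state" where UV: "open U" "open V" "p \<in> U" "homeomorphism U V f g" "f ` (M \<inter> U) = ?N \<inter> V"
    using assms(1) unfolding straightens_to_def by blast
  have gN: "g ` (?N \<inter> V) = M \<inter> U" by (rule homeomorphism_inverse_image[OF UV(4,5)])
  define j where "j = (\<lambda>w :: real \<times> real. (0 :: real, w))"
  define W where "W = j -` V"
  have jN: "j w \<in> ?N \<inter> V" if "w \<in> W" for w using that by (cases w) (auto simp: W_def j_def)
  have gM: "g (j w) \<in> M" if "w \<in> W" for w
    using imageI[OF jN[OF that], of g] unfolding gN by simp
  have oW: "open W" unfolding W_def j_def by (intro open_vimage UV(2) continuous_intros)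
  have cW: "continuous_on W (\<lambda>w. snd (g (j w)))"
  proof -
    have "continuous_on V g" using UV(4) by (simp add: homeomorphism_def)
    moreover have "continuous_on W j" unfolding j_def by (intro continuous_intros)
    ultimately have "continuous_on W (\<lambda>w. g (j w))"
      by (rule continuous_on_compose2) (simp add: W_def image_subset_iff)
    then show ?thesis by (rule continuous_on_snd)
  qed
  have iW: "inj_on (\<lambda>w. snd (g (j w))) W"
  proof (rule inj_onI)
    fix v w assume vw: "v \<in> W" "w \<in> W" "snd (g (j v)) = snd (g (j w))"
    have "g (j v) = g (j w)" using inj_onD[OF inj vw(3) gM[OF vw(1)] gM[OF vw(2)]] .
    then have "f (g (j v)) = f (g (j w))" by (rule arg_cong)
    moreover have fg: "f (g y) = y" if "y \<in> V" for y using UV(4) that by (simp add: homeomorphism_def)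
    ultimately have "j v = j w" using fg[of "j v"] fg[of "j w"] vw(1,2) unfolding W_def by (simp only: vimage_eq)
    then show "v = w" by (simp add: j_def)
  qed
  have im: "open ((\<lambda>w. snd (g (j w))) ` W)" by (rule invariance_of_domain[OF cW oW iW])
  have sub: "(\<lambda>w. snd (g (j w))) ` W \<subseteq> snd ` M" using gM by (simp add: image_subset_iff)
  have "snd p \<in> (\<lambda>w. snd (g (j w))) ` W"
  proof -
    have fp: "f p \<in> ?N \<inter> V" using imageI[of p "M \<inter> U" f] UV(3) assms(2) unfolding UV(5) by simp
    then have w: "f p = j (snd (f p))" by (cases "f p") (auto simp: j_def)
    moreover have "g (f p) = p" using UV(3,4) by (simp add: homeomorphism_def)
    moreover have "snd (f p) \<in> W" using fp w by (simp add: W_def)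
    ultimately show ?thesis by (intro image_eqI[of _ _ "snd (f p)"]) simp_all
  qed
  then show ?thesis by (rule interiorI[OF im _ sub])
qed

lemma smooth_on_compose:
  fixes f :: "'a::euclidean_space \<Rightarrow> 'b::euclidean_space" and g :: "'b \<Rightarrow> 'c::real_normed_vector"
  assumes "smooth_on S f" "smooth_on T g" "open S" "open T" "f ` S \<subseteq> T"
  shows "smooth_on S (\<lambda>x. g (f x))"
  unfolding smooth_on_def
proof
  show "Ck_on n S (\<lambda>x. g (f x))" for n
    by (rule Ck_on_compose[OF assms(3,4,5)]) (use assms(1,2) in \<open>simp_all add: smooth_on_def\<close>)
qed

lemma smooth_on_subset: "smooth_on S f \<Longrightarrow> T \<subseteq> S \<Longrightarrow> smooth_on T f"
  unfolding smooth_on_def using Ck_on_subset by blast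

lemma straightens_to_image:
  assumes \<Phi>: "open W" "smooth_on W \<Phi>" "smooth_on W \<Psi>" "homeomorphism W W \<Phi> \<Psi>"
    and "M \<subseteq> W" "p \<in> M" "straightens_to M N p"
  shows "straightens_to (\<Phi> ` M) N (\<Phi> p)"
proof -
  obtain U V f g where UV: "open U" "open V" "p \<in> U" "smooth_on U f" "smooth_on V g" "homeomorphism U V f g"
    "f ` (M \<inter> U) = N \<inter> V"
    using assms(7) unfolding straightens_to_def by blast
  have \<Phi>h: "\<And>x. x \<in> W \<Longrightarrow> \<Psi> (\<Phi> x) = x" "\<And>x. x \<in> W \<Longrightarrow> \<Phi> (\<Psi> x) = x" "\<Phi> ` W = W" "\<Psi> ` W = W"
    "continuous_on W \<Phi>" "continuous_on W \<Psi>"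
    using \<Phi>(4) by (auto simp: homeomorphism_def)
  have fh: "\<And>x. x \<in> U \<Longrightarrow> g (f x) = x" "\<And>y. y \<in> V \<Longrightarrow> f (g y) = y" "f ` U = V" "g ` V = U"
    "continuous_on U f" "continuous_on V g"
    using UV(6) by (auto simp: homeomorphism_def)
  \<comment> \<open>\<open>\<Phi>\<close> maps \<open>W\<close> onto itself but \<open>U\<close>
    need not lie in \<open>W\<close>; both chart domains are cut down so that the composites with
    \<open>\<Phi>\<close> and \<open>\<Psi>\<close> are defined.\<close>
  define U' where "U' = W \<inter> \<Psi> -` (U \<inter> W)"
  define V' where "V' = V \<inter> g -` (U \<inter> W)"
  have "open U'" unfolding U'_def by (rule continuous_open_preimage[OF \<Phi>h(6)]) (use \<Phi>(1) UV(1) in auto)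
  have "open V'" unfolding V'_def by (rule continuous_open_preimage[OF fh(6)]) (use \<Phi>(1) UV(1,2) in auto)
  have mapU: "\<Psi> y \<in> U \<inter> W" "f (\<Psi> y) \<in> V'" "\<Phi> (g (f (\<Psi> y))) = y" if "y \<in> U'" for y
  proof -
    show 1: "\<Psi> y \<in> U \<inter> W" using that by (simp add: U'_def)
    then show "f (\<Psi> y) \<in> V'" using fh(1,3) by (auto simp: V'_def)
    show "\<Phi> (g (f (\<Psi> y))) = y" using that 1 fh(1) \<Phi>h(2) by (simp add: U'_def)
  qed
  have mapV: "g v \<in> U \<inter> W" "\<Phi> (g v) \<in> U'" "f (\<Psi> (\<Phi> (g v))) = v" if "v \<in> V'" for v
  proof -
    show 1: "g v \<in> U \<inter> W" using that by (simp add: V'_def)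
    then show "\<Phi> (g v) \<in> U'" using \<Phi>h(1,3) by (auto simp: U'_def)
    show "f (\<Psi> (\<Phi> (g v))) = v" using that 1 fh(2) \<Phi>h(1) by (simp add: V'_def)
  qed
  have sf: "smooth_on U' (\<lambda>y. f (\<Psi> y))"
    by (rule smooth_on_compose[OF smooth_on_subset[OF \<Phi>(3)] UV(4) \<open>open U'\<close> UV(1)]) (use mapU in \<open>auto simp: U'_def\<close>)
  have sg: "smooth_on V' (\<lambda>v. \<Phi> (g v))"
    by (rule smooth_on_compose[OF smooth_on_subset[OF UV(5)] \<Phi>(2) \<open>open V'\<close> \<Phi>(1)]) (use mapV in \<open>auto simp: V'_def\<close>)
  have "homeomorphism U' V' (\<lambda>y. f (\<Psi> y)) (\<lambda>v. \<Phi> (g v))"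
    unfolding homeomorphism_def
  proof (intro conjI ballI)
    have "v \<in> (\<lambda>y. f (\<Psi> y)) ` U'" if "v \<in> V'" for v
      by (rule image_eqI[of _ "\<lambda>y. f (\<Psi> y)", OF mapV(3)[OF that, symmetric] mapV(2)[OF that]])
    then show "(\<lambda>y. f (\<Psi> y)) ` U' = V'" using mapU(2) by blast
    have "y \<in> (\<lambda>v. \<Phi> (g v)) ` V'" if "y \<in> U'" for y
      by (rule image_eqI[of _ "\<lambda>v. \<Phi> (g v)", OF mapU(3)[OF that, symmetric] mapU(2)[OF that]])
    then show "(\<lambda>v. \<Phi> (g v)) ` V' = U'" using mapV(2) by blast
    show "continuous_on U' (\<lambda>y. f (\<Psi> y))" "continuous_on V' (\<lambda>v. \<Phi> (g v))"
      using sf sg by (auto simp: smooth_on_def intro: Ck_on_imp_continuous_on[of 0])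
    show "\<Phi> (g (f (\<Psi> y))) = y" if "y \<in> U'" for y by (rule mapU(3)[OF that])
    show "f (\<Psi> (\<Phi> (g v))) = v" if "v \<in> V'" for v by (rule mapV(3)[OF that])
  qed
  moreover have "(\<lambda>y. f (\<Psi> y)) ` (\<Phi> ` M \<inter> U') = N \<inter> V'"
  proof (intro equalityI subsetI)
    fix v assume "v \<in> (\<lambda>y. f (\<Psi> y)) ` (\<Phi> ` M \<inter> U')"
    then obtain x where x: "x \<in> M" "\<Phi> x \<in> U'" "v = f (\<Psi> (\<Phi> x))" by blast
    then have "\<Psi> (\<Phi> x) = x" using \<Phi>h(1)[of x] assms(5) by blast
    then show "v \<in> N \<inter> V'" using x mapU[OF x(2)] UV(7) by auto
  next
    fix v assume v: "v \<in> N \<inter> V'"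
    then have "v \<in> f ` (M \<inter> U)" using UV(7) by (auto simp: V'_def)
    then obtain x where x: "x \<in> M" "x \<in> U" "v = f x" by blast
    then have "g v = x" using fh(1) by simp
    then have "\<Phi> x \<in> U'" "f (\<Psi> (\<Phi> x)) = v" using mapV(2,3)[of v] v by auto
    then show "v \<in> (\<lambda>y. f (\<Psi> y)) ` (\<Phi> ` M \<inter> U')" using x(1) by (intro image_eqI[of _ _ "\<Phi> x"]) auto
  qed
  moreover have "\<Phi> p \<in> U'"
  proof -
    have "p \<in> W" using assms(5,6) by blast
    then show ?thesis using UV(3) \<Phi>h(1,3) by (auto simp: U'_def)
  qed
  ultimately show ?thesis
    unfolding straightens_to_def using \<open>open U'\<close> \<open>open V'\<close> sf sg by blast
qed

section \<open>The perturbed manifolds\<close>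

text \<open>The conditions in \<open>small\<close> give \<open>eps^2 \<le> eps\<close>, a
  perturbation \<open>lam * (1 + C)\<close> of at most a quarter of the damping
  \<open>f0 / eps\<close>, and graph heights of at most 1/2, the range of
  \<open>sin_diff_ge\<close>.\<close>

locale slow_graph_family =
  fixes F :: "real \<Rightarrow> real" and lam :: real and k :: int and R t0 t1 C f0 f1 eps0 :: real
    and H H' :: "real \<Rightarrow> real \<times> real \<Rightarrow> real"
  assumes lam: "lam > 0" and R: "R > 0" and C: "C \<ge> 0" and f0: "f0 > 0"
    and F: "\<And>t. t \<in> {t0<..<t1} \<Longrightarrow> f0 \<le> \<bar>F t\<bar>" "\<And>t. t \<in> {t0<..<t1} \<Longrightarrow> \<bar>F t\<bar> \<le> f1"
    and small: "eps0 \<le> 1" "4 * (lam * (1 + C)) * eps0 \<le> f0" "(C + lam * R / f0) * eps0 \<le> 1 / 2"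
    and graph: "\<And>eps. eps \<in> {0<..<eps0} \<Longrightarrow> slow_graph (\<lambda>t. (-1) powi k * F t) lam R t0 t1 C eps (H eps) (H' eps)"
begin

abbreviation kpi :: real where "kpi \<equiv> of_int k * pi"

definition G :: "real \<Rightarrow> real" where "G t = (-1) powi k * F t"

definition box :: "(real \<times> real) set" where "box = {(\<Omega>, \<theta>). \<Omega> - kpi \<in> {-R<..<R} \<and> \<theta> \<in> {t0<..<t1}}"

definition height :: "real \<Rightarrow> real \<times> real \<Rightarrow> real" where "height eps q = H eps (fst q - kpi, snd q)"

text \<open>On the critical plane \<omega> equals \<open>kpi\<close> minus \<Omega>, so this shear
  carries it to the slow graph. As an ambient diffeomorphism of the tube over \<open>box\<close>,
  with inverse \<open>unshift\<close>, it also transports charts.\<close>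

definition shift :: "real \<Rightarrow> state \<Rightarrow> state" where "shift eps p = (fst p + height eps (snd p), snd p)"

definition unshift :: "real \<Rightarrow> state \<Rightarrow> state" where "unshift eps p = (fst p - height eps (snd p), snd p)"

lemma abs_G: "\<bar>G t\<bar> = \<bar>F t\<bar>"
  by (simp add: G_def abs_mult power_int_abs)

lemma open_box: "open box"
proof -
  have "box = (\<lambda>q. (fst q - kpi, snd q)) -` ({-R<..<R} \<times> {t0<..<t1})"
    by (auto simp: box_def)
  then show ?thesis by (auto intro!: open_vimage open_Times continuous_intros)
qed

lemma height_bounds:
  assumes "eps \<in> {0<..<eps0}" "(\<Omega>, \<theta>) \<in> box"
  shows "\<bar>height eps (\<Omega>, \<theta>) + eps * lam * (\<Omega> - kpi) / G \<theta>\<bar> \<le> C * eps\<^sup>2"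
    and "\<bar>height eps (\<Omega>, \<theta>)\<bar> \<le> (C + lam * R / f0) * eps" and "\<bar>height eps (\<Omega>, \<theta>)\<bar> \<le> 1 / 2"
    and "\<bar>H' eps (\<Omega> - kpi, \<theta>)\<bar> \<le> C"
proof -
  have eps: "0 < eps" "eps < eps0" using assms(1) by auto
  have b: "\<Omega> - kpi \<in> {-R<..<R}" "\<theta> \<in> {t0<..<t1}" using assms(2) by (auto simp: box_def)
  note g = graph[OF assms(1), unfolded slow_graph_def, THEN conjunct2, rule_format, OF b]
  show 1: "\<bar>height eps (\<Omega>, \<theta>) + eps * lam * (\<Omega> - kpi) / G \<theta>\<bar> \<le> C * eps\<^sup>2"
    using g by (simp add: height_def G_def)
  show "\<bar>H' eps (\<Omega> - kpi, \<theta>)\<bar> \<le> C" using g by simp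
  have "\<bar>eps * lam * (\<Omega> - kpi) / G \<theta>\<bar> = eps * lam * \<bar>\<Omega> - kpi\<bar> / \<bar>G \<theta>\<bar>"
    using eps lam by (simp add: abs_mult)
  also have "\<dots> \<le> eps * lam * R / f0"
    using eps lam R f0 F(1)[OF b(2)] b(1) by (intro frac_le mult_left_mono) (auto simp: abs_G)
  finally have 2: "\<bar>eps * lam * (\<Omega> - kpi) / G \<theta>\<bar> \<le> eps * lam * R / f0" .
  have "eps\<^sup>2 \<le> eps" using eps small(1) by (simp add: power2_eq_square mult_left_le)
  then have "C * eps\<^sup>2 \<le> C * eps" using C by (rule mult_left_mono)
  show 3: "\<bar>height eps (\<Omega>, \<theta>)\<bar> \<le> (C + lam * R / f0) * eps" 
  proof -
    have "(C + lam * R / f0) * eps = C * eps + eps * lam * R / f0" by (simp add: algebra_simps)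
    moreover have "\<bar>a\<bar> \<le> B + D" if "\<bar>a + b\<bar> \<le> A" "\<bar>b\<bar> \<le> D" "A \<le> B" for a b A B D :: real
      using that by linarith
    ultimately show ?thesis using 1 2 \<open>C * eps\<^sup>2 \<le> C * eps\<close> by metis
  qed
  have "(C + lam * R / f0) * eps \<le> (C + lam * R / f0) * eps0"
    using eps C lam R f0 by (intro mult_left_mono) auto
  then show "\<bar>height eps (\<Omega>, \<theta>)\<bar> \<le> 1 / 2" using 3 small(3) by linarith
qed

section \<open>Deviation of solutions from the graph, in either direction of time\<close>

lemma solution_components:
  assumes "solution (\<lambda>p. \<tau> *\<^sub>R field F lam eps p) (\<lambda>t. (\<omega> t, \<Omega> t, \<theta> t)) J" "t \<in> J"
  shows "(\<omega> has_real_derivative \<tau> * (- sin (\<Omega> t + \<omega> t) * F (\<theta> t) / eps)) (at t within J)"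
    and "(\<Omega> has_real_derivative \<tau> * (lam * \<omega> t)) (at t within J)"
    and "(\<theta> has_real_derivative \<tau>) (at t within J)"
proof -
  let ?x = "\<lambda>t. (\<omega> t, \<Omega> t, \<theta> t)"
  have *: "(?x has_vector_derivative (\<tau> * (- sin (\<Omega> t + \<omega> t) * F (\<theta> t) / eps), \<tau> * (lam * \<omega> t), \<tau>)) (at t within J)"
    using assms by (simp add: solution_def field_def)
  from bounded_linear.has_vector_derivative[OF bounded_linear_fst *]
    bounded_linear.has_vector_derivative[OF bounded_linear_fst bounded_linear.has_vector_derivative[OF bounded_linear_snd *]]
    bounded_linear.has_vector_derivative[OF bounded_linear_snd bounded_linear.has_vector_derivative[OF bounded_linear_snd *]]
  show "(\<omega> has_real_derivative \<tau> * (- sin (\<Omega> t + \<omega> t) * F (\<theta> t) / eps)) (at t within J)"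
    "(\<Omega> has_real_derivative \<tau> * (lam * \<omega> t)) (at t within J)" "(\<theta> has_real_derivative \<tau>) (at t within J)"
    by (simp_all add: has_real_derivative_iff_has_vector_derivative)
qed

text \<open>The rate of change of the deviation vanishes with it, whence invariance and, near the graph,
  attraction.\<close>

definition deviation :: "real \<Rightarrow> (real \<Rightarrow> real) \<Rightarrow> (real \<Rightarrow> real) \<Rightarrow> (real \<Rightarrow> real) \<Rightarrow> real \<Rightarrow> real" where
  "deviation eps \<omega> \<Omega> \<theta> t = \<omega> t - (height eps (\<Omega> t, \<theta> t) - (\<Omega> t - kpi))"

text \<open>With \<open>u = h + e\<close>, the value of \<open>H\<^sub>\<theta>\<close> in
  \<open>slow_graph\<close> cancels every term that does not vanish with the deviation
  \<open>e\<close>. The factor \<tau> covers the reversed flow, \<tau> = -1, by which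
  \<open>repelling\<close> is defined.\<close>

lemma deviation_derivative:
  assumes sol: "solution (\<lambda>p. \<tau> *\<^sub>R field F lam eps p) (\<lambda>t. (\<omega> t, \<Omega> t, \<theta> t)) J" and t: "t \<in> J"
    and b: "(\<Omega> t, \<theta> t) \<in> box" and eps: "eps \<in> {0<..<eps0}"
  shows "(deviation eps \<omega> \<Omega> \<theta> has_real_derivative
      - (\<tau> * G (\<theta> t) / eps) * (sin (height eps (\<Omega> t, \<theta> t) + deviation eps \<omega> \<Omega> \<theta> t) - sin (height eps (\<Omega> t, \<theta> t))) +
      \<tau> * lam * (1 - H' eps (\<Omega> t - kpi, \<theta> t)) * deviation eps \<omega> \<Omega> \<theta> t) (at t within J)"
proof -
  note der = solution_components[OF sol t]
  define x where "x = \<Omega> t - kpi"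
  define h where "h = height eps (\<Omega> t, \<theta> t)"
  define h' where "h' = H' eps (x, \<theta> t)"
  define e where "e = deviation eps \<omega> \<Omega> \<theta> t"
  have bx: "x \<in> {-R<..<R}" "\<theta> t \<in> {t0<..<t1}" using b by (auto simp: box_def x_def)
  have Hd: "(H eps has_derivative (\<lambda>v. h' * fst v + (- G (\<theta> t) / eps * sin h - lam * (h - x) * (h' - 1)) * snd v)) (at (\<Omega> t - kpi, \<theta> t))"
    using graph[OF eps, unfolded slow_graph_def, THEN conjunct2, rule_format, OF bx]
    by (simp add: G_def h_def h'_def height_def x_def)
  have pd: "((\<lambda>t. (\<Omega> t - kpi, \<theta> t)) has_derivative (\<lambda>s. (\<tau> * (lam * \<omega> t) * s, \<tau> * s))) (at t within J)"
    using der(2,3) by (auto simp: has_field_derivative_def intro!: derivative_eq_intros)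
  have "((\<lambda>t. height eps (\<Omega> t, \<theta> t)) has_derivative
      (\<lambda>s. h' * (\<tau> * (lam * \<omega> t) * s) + (- G (\<theta> t) / eps * sin h - lam * (h - x) * (h' - 1)) * (\<tau> * s))) (at t within J)"
    using has_derivative_compose[OF pd Hd] by (simp add: height_def)
  then have hd: "((\<lambda>t. height eps (\<Omega> t, \<theta> t)) has_real_derivative
      \<tau> * (h' * (lam * \<omega> t) + (- G (\<theta> t) / eps * sin h - lam * (h - x) * (h' - 1)))) (at t within J)"
    unfolding has_field_derivative_def by (rule has_derivative_eq_rhs) (auto simp: fun_eq_iff algebra_simps)
  have sin: "sin (\<Omega> t + \<omega> t) * F (\<theta> t) = sin (h + e) * G (\<theta> t)"
  proof -
    have "\<Omega> t + \<omega> t = (h + e) + kpi" by (simp add: e_def deviation_def h_def)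
    then show ?thesis by (simp add: sin_add_int_pi G_def)
  qed
  have \<omega>: "\<omega> t = h + e - x" by (simp add: e_def deviation_def h_def x_def)
  have "(deviation eps \<omega> \<Omega> \<theta> has_real_derivative
      \<tau> * (- sin (\<Omega> t + \<omega> t) * F (\<theta> t) / eps) - (\<tau> * (h' * (lam * \<omega> t) + (- G (\<theta> t) / eps * sin h - lam * (h - x) * (h' - 1))) - \<tau> * (lam * \<omega> t))) (at t within J)"
    unfolding deviation_def[abs_def] by (rule derivative_eq_intros der hd refl)+ simp
  also have "\<tau> * (- sin (\<Omega> t + \<omega> t) * F (\<theta> t) / eps) - (\<tau> * (h' * (lam * \<omega> t) + (- G (\<theta> t) / eps * sin h - lam * (h - x) * (h' - 1))) - \<tau> * (lam * \<omega> t))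
    = - (\<tau> * G (\<theta> t) / eps) * (sin (h + e) - sin h) + \<tau> * lam * (1 - h') * e"
  proof -
    have "- sin (\<Omega> t + \<omega> t) * F (\<theta> t) = - (sin (h + e) * G (\<theta> t))" using sin by simp
    then show ?thesis unfolding \<omega> by (simp add: algebra_simps add_divide_distrib diff_divide_distrib)
  qed
  finally show ?thesis by (simp add: h_def e_def h'_def x_def)
qed

text \<open>Sine is Lipschitz with constant 1 and \<open>H'\<close> is bounded by \<open>C\<close>.
  The Lipschitz constant blows up as \<open>eps\<close> tends to 0, which is harmless since only the
  value zero is propagated.\<close>

lemma deviation_zero:
  assumes sol: "solution (field F lam eps) (\<lambda>t. (\<omega> t, \<Omega> t, \<theta> t)) {c..d}" and eps: "eps \<in> {0<..<eps0}"
    and b: "\<And>t. t \<in> {c..d} \<Longrightarrow> (\<Omega> t, \<theta> t) \<in> box"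
    and s: "s \<in> {c..d}" "deviation eps \<omega> \<Omega> \<theta> s = 0" and t: "t \<in> {c..d}"
  shows "deviation eps \<omega> \<Omega> \<theta> t = 0"
proof (rule gronwall_zero[where e = "deviation eps \<omega> \<Omega> \<theta>" and L = "f1 / eps + lam * (1 + C)", OF _ _ s t])
  fix t assume t: "t \<in> {c..d}"
  have sol': "solution (\<lambda>p. 1 *\<^sub>R field F lam eps p) (\<lambda>t. (\<omega> t, \<Omega> t, \<theta> t)) {c..d}" using sol by simp
  note deviation_derivative[OF sol' t b[OF t] eps]
  then show "(deviation eps \<omega> \<Omega> \<theta> has_real_derivative
      - (1 * G (\<theta> t) / eps) * (sin (height eps (\<Omega> t, \<theta> t) + deviation eps \<omega> \<Omega> \<theta> t) - sin (height eps (\<Omega> t, \<theta> t))) +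
      1 * lam * (1 - H' eps (\<Omega> t - kpi, \<theta> t)) * deviation eps \<omega> \<Omega> \<theta> t) (at t within {c..d})" .
  let ?e = "deviation eps \<omega> \<Omega> \<theta> t" and ?h = "height eps (\<Omega> t, \<theta> t)" and ?h' = "H' eps (\<Omega> t - kpi, \<theta> t)"
  have "\<theta> t \<in> {t0<..<t1}" using b[OF t] by (simp add: box_def)
  then have f1: "\<bar>F (\<theta> t)\<bar> \<le> f1" by (rule F(2))
  then have "0 \<le> f1 / eps" using eps by (intro divide_nonneg_pos) auto
  moreover have "\<bar>G (\<theta> t)\<bar> / eps \<le> f1 / eps" using f1 eps by (intro divide_right_mono) (auto simp: abs_G)
  moreover have "\<bar>sin (?h + ?e) - sin ?h\<bar> \<le> \<bar>?e\<bar>" 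
  proof -
    have "sin (?h + ?e) - sin ?h = 2 * sin (?e / 2) * cos (?h + ?e / 2)"
      unfolding sin_diff_sin by (simp add: field_simps)
    then have "\<bar>sin (?h + ?e) - sin ?h\<bar> = 2 * (\<bar>sin (?e / 2)\<bar> * \<bar>cos (?h + ?e / 2)\<bar>)" by (simp add: abs_mult)
    also have "\<dots> \<le> 2 * (\<bar>?e / 2\<bar> * 1)"
      by (intro mult_left_mono mult_mono abs_sin_x_le_abs_x abs_cos_le_one) auto
    finally show ?thesis by simp
  qed
  ultimately have "\<bar>- (1 * G (\<theta> t) / eps) * (sin (?h + ?e) - sin ?h)\<bar> \<le> f1 / eps * \<bar>?e\<bar>"
    unfolding abs_mult using eps by (intro mult_mono) auto
  moreover have "\<bar>1 - ?h'\<bar> \<le> 1 + C" using height_bounds(4)[OF eps b[OF t]] by linarith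
  then have "\<bar>1 * lam * (1 - ?h') * ?e\<bar> \<le> lam * (1 + C) * \<bar>?e\<bar>"
    unfolding abs_mult using lam by (intro mult_mono) auto
  ultimately show "\<bar>- (1 * G (\<theta> t) / eps) * (sin (?h + ?e) - sin ?h) + 1 * lam * (1 - ?h') * ?e\<bar>
      \<le> (f1 / eps + lam * (1 + C)) * \<bar>?e\<bar>"
    unfolding distrib_right by linarith
qed

lemma deviation_decay:
  assumes sol: "solution (\<lambda>p. \<tau> *\<^sub>R field F lam eps p) (\<lambda>t. (\<omega> t, \<Omega> t, \<theta> t)) {0..T}" and eps: "eps \<in> {0<..<eps0}"
    and b: "\<And>t. t \<in> {0..T} \<Longrightarrow> (\<Omega> t, \<theta> t) \<in> box"
    and \<tau>: "\<bar>\<tau>\<bar> = 1" "\<And>t. t \<in> {t0<..<t1} \<Longrightarrow> f0 \<le> \<tau> * G t"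
    and init: "\<bar>deviation eps \<omega> \<Omega> \<theta> 0\<bar> < 1 / 2" and t: "t \<in> {0..T}"
  shows "\<bar>deviation eps \<omega> \<Omega> \<theta> t\<bar> \<le> exp (- (f0 / eps) / 4 * t) * \<bar>deviation eps \<omega> \<Omega> \<theta> 0\<bar>"
proof (rule exponential_decay[OF deviation_derivative[OF sol _ b eps] _ _ _ init t])
  fix s assume s: "s \<in> {0..T}"
  have "\<theta> s \<in> {t0<..<t1}" using b[OF s] by (simp add: box_def)
  then show "f0 / eps \<le> \<tau> * G (\<theta> s) / eps" using \<tau>(2) eps by (intro divide_right_mono) auto
  show "\<bar>height eps (\<Omega> s, \<theta> s)\<bar> \<le> 1 / 2" by (rule height_bounds(3)[OF eps b[OF s]])
  have "\<bar>1 - H' eps (\<Omega> s - kpi, \<theta> s)\<bar> \<le> 1 + C" using height_bounds(4)[OF eps b[OF s]] by linarith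
  then have "\<bar>\<tau> * lam * (1 - H' eps (\<Omega> s - kpi, \<theta> s))\<bar> \<le> 1 * lam * (1 + C)"
    unfolding abs_mult \<tau>(1) using lam by (intro mult_mono) auto
  also have "\<dots> \<le> f0 / eps / 4"
  proof -
    have "4 * (lam * (1 + C)) * eps \<le> 4 * (lam * (1 + C)) * eps0" using eps lam C by (intro mult_left_mono) auto
    then show ?thesis using small(2) eps by (simp add: field_simps)
  qed
  finally show "\<bar>\<tau> * lam * (1 - H' eps (\<Omega> s - kpi, \<theta> s))\<bar> \<le> f0 / eps / 4" .
qed auto

lemma smooth_on_height:
  assumes "eps \<in> {0<..<eps0}"
  shows "smooth_on box (height eps)"
proof -
  have "smooth_on box (\<lambda>q :: real \<times> real. (fst q - kpi, snd q))"
    unfolding smooth_on_def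
    by (intro allI Ck_on_Pair Ck_on_diff open_box Ck_on_const Ck_on_linear bounded_linear_fst bounded_linear_snd)
  moreover have "smooth_on ({-R<..<R} \<times> {t0<..<t1}) (H eps)"
    using graph[OF assms] by (simp add: slow_graph_def)
  ultimately have "smooth_on box (\<lambda>q. H eps (fst q - kpi, snd q))"
    by (rule smooth_on_compose[OF _ _ open_box]) (auto simp: box_def intro!: open_Times)
  then show ?thesis by (simp add: height_def[abs_def])
qed

lemma open_tube: "open (UNIV \<times> box :: state set)"
  by (rule open_Times[OF open_UNIV open_box])

lemma smooth_on_shift:
  assumes "eps \<in> {0<..<eps0}"
  shows "smooth_on (UNIV \<times> box) (shift eps)" "smooth_on (UNIV \<times> box) (unshift eps)"
proof -
  have "smooth_on (UNIV \<times> box) (\<lambda>p :: state. height eps (snd p))"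
    by (rule smooth_on_compose[OF _ smooth_on_height[OF assms] open_tube open_box])
       (auto simp: smooth_on_def intro!: Ck_on_linear bounded_linear_snd open_tube)
  then have h: "Ck_on n (UNIV \<times> box) (\<lambda>p :: state. height eps (snd p))" for n by (simp add: smooth_on_def)
  have f: "Ck_on n (UNIV \<times> box) (fst :: state \<Rightarrow> real)" and s: "Ck_on n (UNIV \<times> box) (snd :: state \<Rightarrow> real \<times> real)" for n
    by (intro Ck_on_linear open_tube bounded_linear_fst bounded_linear_snd)+
  show "smooth_on (UNIV \<times> box) (shift eps)"
    unfolding smooth_on_def shift_def[abs_def] by (intro allI Ck_on_Pair Ck_on_add h f s open_tube)
  show "smooth_on (UNIV \<times> box) (unshift eps)"
    unfolding smooth_on_def unshift_def[abs_def] by (intro allI Ck_on_Pair Ck_on_diff h f s open_tube)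
qed

lemma homeomorphism_shift:
  assumes "eps \<in> {0<..<eps0}"
  shows "homeomorphism (UNIV \<times> box) (UNIV \<times> box) (shift eps) (unshift eps)"
proof (rule homeomorphismI)
  show "continuous_on (UNIV \<times> box) (shift eps)" "continuous_on (UNIV \<times> box) (unshift eps)"
    using smooth_on_shift[OF assms] Ck_on_imp_continuous_on unfolding smooth_on_def by blast+
qed (auto simp: shift_def unshift_def)

section \<open>The slow manifold as the image of a critical manifold\<close>

context
  fixes M0 :: "state set"
  assumes crit: "critical_manifold F k M0" and M0_box: "snd ` M0 \<subseteq> box"
begin

lemma M0_eq: "p \<in> M0 \<Longrightarrow> fst p = kpi - fst (snd p)"
  using crit unfolding critical_manifold_def by force

lemma M0_tube: "M0 \<subseteq> UNIV \<times> box"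
  using M0_box by force

lemma shift_M0: "shift eps ` M0 = (\<lambda>(\<omega>, \<Omega>, \<theta>). (height eps (\<Omega>, \<theta>) - (\<Omega> - kpi), \<Omega>, \<theta>)) ` M0"
  by (rule image_cong[OF refl]) (use M0_eq in \<open>force simp: shift_def\<close>)

lemma mem_shift_M0: "(\<omega>, \<Omega>, \<theta>) \<in> shift eps ` M0 \<longleftrightarrow>
    (\<Omega>, \<theta>) \<in> snd ` M0 \<and> \<omega> = height eps (\<Omega>, \<theta>) - (\<Omega> - kpi)"
  unfolding shift_M0 by force

lemma snd_shift_M0: "snd ` shift eps ` M0 = snd ` M0"
  by (simp add: shift_def image_image)

lemma inj_on_snd_shift_M0: "inj_on snd (shift eps ` M0)"
  unfolding shift_M0 by (auto simp: inj_on_def)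

lemma smooth_surface_shift_M0:
  assumes "eps \<in> {0<..<eps0}"
  shows "smooth_surface (shift eps ` M0)"
  using crit unfolding critical_manifold_def smooth_surface_def
  by (auto intro!: straightens_to_image[OF open_tube smooth_on_shift[OF assms] homeomorphism_shift[OF assms] M0_tube])

lemma homeomorphism_shift_M0:
  assumes "eps \<in> {0<..<eps0}"
  shows "homeomorphism M0 (shift eps ` M0) (shift eps) (unshift eps)"
proof (rule homeomorphism_of_subsets[OF homeomorphism_shift[OF assms] M0_tube])
  show "shift eps ` M0 \<subseteq> UNIV \<times> box" using M0_tube by (auto simp: shift_def)
qed simp

lemma diffeomorphic_shift_M0:
  assumes "eps \<in> {0<..<eps0}"
  shows "diffeomorphic M0 (shift eps ` M0)"
  unfolding diffeomorphic_def
proof (intro exI conjI)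
  show "shift eps ` M0 \<subseteq> UNIV \<times> box" using M0_tube by (auto simp: shift_def)
qed (use M0_tube open_tube smooth_on_shift[OF assms] homeomorphism_shift_M0[OF assms] in auto)

lemma dist_shift:
  assumes "eps \<in> {0<..<eps0}" "p \<in> M0"
  shows "dist p (shift eps p) \<le> (C + lam * R / f0) * eps"
proof -
  have "dist p (shift eps p) = \<bar>height eps (snd p)\<bar>" by (cases p) (simp add: shift_def dist_prod_def dist_real_def)
  also have "\<dots> \<le> (C + lam * R / f0) * eps"
    using height_bounds(2)[OF assms(1), of "fst (snd p)" "snd (snd p)"] M0_box assms(2) by auto
  finally show ?thesis .
qed

lemma slow_manifold_shift_M0: "slow_manifold M0 eps0 (\<lambda>eps. shift eps ` M0)"
  unfolding slow_manifold_def
proof (intro conjI exI[of _ "C + lam * R / f0"] ballI)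
  fix eps assume eps: "eps \<in> {0<..<eps0}"
  show "infdist p M0 \<le> (C + lam * R / f0) * eps" if "p \<in> shift eps ` M0" for p
    using that dist_shift[OF eps] by (auto intro!: infdist_le2 simp: dist_commute)
  show "infdist q (shift eps ` M0) \<le> (C + lam * R / f0) * eps" if "q \<in> M0" for q
    by (rule infdist_le2[OF _ dist_shift[OF eps that]]) (use that in blast)
qed (simp_all add: smooth_surface_shift_M0 diffeomorphic_shift_M0)

text \<open>Away from the surface boundary the base point is interior to the projection of the
  manifold, so by continuity it stays there for nearby times. Meanwhile the deviation stays zero,
  and the two facts together are membership.\<close>

lemma locally_invariant_shift_M0:
  assumes eps: "eps \<in> {0<..<eps0}"
  shows "locally_invariant (field F lam eps) (shift eps ` M0)"
  unfolding locally_invariant_def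
proof (intro allI impI ballI)
  fix x a b s
  let ?M = "shift eps ` M0"
  assume sol: "solution (field F lam eps) x {a..b}" and s: "s \<in> {a..b}" and xs: "x s \<in> ?M - surface_boundary ?M"
  define \<omega> \<Omega> \<theta> where "\<omega> t = fst (x t)" and "\<Omega> t = fst (snd (x t))" and "\<theta> t = snd (snd (x t))" for t
  have x: "x = (\<lambda>t. (\<omega> t, \<Omega> t, \<theta> t))" by (simp add: \<omega>_def \<Omega>_def \<theta>_def)
  define N where "N = interior (snd ` ?M)"
  have N: "open N" "N \<subseteq> snd ` M0" using interior_subset[of "snd ` ?M"] by (simp_all add: N_def snd_shift_M0)
  have "straightens_to ?M {(x, y, z). x = 0} (x s)" using xs by (simp add: surface_boundary_def)
  then have "snd (x s) \<in> N"
    unfolding N_def by (rule interior_of_graph_base) (use xs inj_on_snd_shift_M0 in auto)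
  moreover have "continuous (at s within {a..b}) (\<lambda>t. snd (x t))"
    using sol s by (intro continuous_snd has_vector_derivative_continuous) (auto simp: solution_def)
  ultimately have "\<forall>\<^sub>F t in at s within {a..b}. snd (x t) \<in> N"
    using N(1) by (auto simp: continuous_within dest: topological_tendstoD)
  then obtain \<delta> where \<delta>: "\<delta> > 0" "\<And>t. t \<in> {a..b} \<Longrightarrow> dist t s < \<delta> \<Longrightarrow> snd (x t) \<in> N"
    using \<open>snd (x s) \<in> N\<close> unfolding eventually_at by metis
  \<comment> \<open>A compact interval around \<open>s\<close>, clipped at \<open>a\<close> and
    \<open>b\<close>; half of \<delta> keeps its end points strictly within the
    neighbourhood.\<close>
  define c d where "c = max a (s - \<delta> / 2)" and "d = min b (s + \<delta> / 2)"
  have cd: "{c..d} \<subseteq> {a..b}" by (auto simp: c_def d_def)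
  have near: "snd (x t) \<in> N" if "t \<in> {c..d}" for t
    using that \<delta>(1) by (intro \<delta>(2)) (auto simp: c_def d_def dist_real_def)
  have sol': "solution (field F lam eps) (\<lambda>t. (\<omega> t, \<Omega> t, \<theta> t)) {c..d}"
    using sol cd has_vector_derivative_within_subset unfolding solution_def x[symmetric] by blast
  have boxed: "(\<Omega> t, \<theta> t) \<in> box" if "t \<in> {c..d}" for t
    using near[OF that] N(2) M0_box by (auto simp: \<Omega>_def \<theta>_def)
  have s_cd: "s \<in> {c..d}" using s \<delta>(1) by (auto simp: c_def d_def)
  have dev_s: "deviation eps \<omega> \<Omega> \<theta> s = 0" using xs by (simp add: x mem_shift_M0 deviation_def)
  have dev: "deviation eps \<omega> \<Omega> \<theta> t = 0" if "t \<in> {c..d}" for t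
    by (rule deviation_zero[OF sol' eps _ s_cd dev_s that]) (rule boxed)
  have "x t \<in> ?M" if t: "t \<in> {c..d}" for t
  proof -
    have "(\<Omega> t, \<theta> t) \<in> snd ` M0" using near[OF t] N(2) by (auto simp: \<Omega>_def \<theta>_def)
    then show ?thesis using dev[OF t] by (simp add: x mem_shift_M0 deviation_def)
  qed
  moreover have "t \<in> {c..d}" if "t \<in> {a..b}" "\<bar>t - s\<bar> < \<delta> / 2" for t
  proof -
    have "s - \<delta> / 2 \<le> t" "t \<le> s + \<delta> / 2" using that(2) by linarith+
    then show ?thesis using that(1) by (simp add: c_def d_def)
  qed
  ultimately show "\<exists>\<delta>>0. \<forall>t\<in>{a..b}. \<bar>t - s\<bar> < \<delta> \<longrightarrow> x t \<in> ?M"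
    using \<delta>(1) by (intro exI[of _ "\<delta> / 2"]) simp
qed

lemma slow_expansion_shift_M0: "slow_expansion F lam k M0 eps0 (\<lambda>eps. shift eps ` M0)"
  unfolding slow_expansion_def
proof (intro exI[of _ "\<lambda>eps \<Omega> \<theta>. height eps (\<Omega>, \<theta>) - (\<Omega> - kpi)"] exI[of _ C] ballI conjI)
  fix eps p assume eps: "eps \<in> {0<..<eps0}" and p: "p \<in> M0"
  obtain \<omega> \<Omega> \<theta> where p': "p = (\<omega>, \<Omega>, \<theta>)" by (cases p)
  have b: "(\<Omega>, \<theta>) \<in> box" using p M0_box by (force simp: p')
  \<comment> \<open>The sign is its own inverse, so dividing by \<open>G\<close> produces the factor
    \<open>(-1) powi k / F \<theta>\<close> of the expansion.\<close>
  have inv: "c / ((-1) powi k * F \<theta>) = c * (-1) powi k / F \<theta>" for c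
    by (cases "even k") (simp_all add: power_int_minus_left)
  have "height eps (\<Omega>, \<theta>) - (\<Omega> - kpi) - (kpi - \<Omega>) * (1 + eps * (-1) powi k * lam / F \<theta>) =
      height eps (\<Omega>, \<theta>) + eps * lam * (\<Omega> - kpi) / G \<theta>"
    unfolding G_def inv by (simp add: algebra_simps diff_divide_distrib)
  then show "case p of (\<omega>, \<Omega>, \<theta>) \<Rightarrow> \<bar>height eps (\<Omega>, \<theta>) - (\<Omega> - kpi) -
      (kpi - \<Omega>) * (1 + eps * (-1) powi k * lam / F \<theta>)\<bar> \<le> C * eps\<^sup>2"
    using height_bounds(1)[OF eps b] by (simp add: p')
qed (rule shift_M0)

text \<open>A graph has one point above each base point, so \<omega> minus \<open>w\<close> is the
  deviation. The radius 1/2 is the threshold of \<open>exponential_decay\<close>, and the rate is a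
  quarter of the damping bound \<open>f0\<close>.\<close>

lemma attracting_shift_M0:
  assumes \<tau>: "\<bar>\<tau>\<bar> = 1" "\<And>t. t \<in> {t0<..<t1} \<Longrightarrow> f0 \<le> \<tau> * G t"
  shows "attracting (\<lambda>eps p. \<tau> *\<^sub>R field F lam eps p) eps0 (\<lambda>eps. shift eps ` M0)"
  unfolding attracting_def
proof (rule exI[of _ "1 / 2"], rule conjI, simp, rule exI[of _ "f0 / 4"], rule conjI, simp add: f0,
    rule exI[of _ 1], intro ballI allI impI, elim conjE)
  fix eps \<omega> \<Omega> \<theta> w T t
  assume eps: "eps \<in> {0<..<eps0}" and sol: "solution (\<lambda>p. \<tau> *\<^sub>R field F lam eps p) (\<lambda>t. (\<omega> t, \<Omega> t, \<theta> t)) {0..T}"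
    and M: "\<forall>t\<in>{0..T}. (w t, \<Omega> t, \<theta> t) \<in> shift eps ` M0" and init: "\<bar>\<omega> 0 - w 0\<bar> < 1 / 2" and t: "t \<in> {0..T}"
  have dev: "\<omega> s - w s = deviation eps \<omega> \<Omega> \<theta> s" "(\<Omega> s, \<theta> s) \<in> box" if "s \<in> {0..T}" for s
    using M that M0_box by (auto simp: mem_shift_M0 deviation_def)
  have "0 \<in> {0..T}" using t by simp
  have "\<bar>deviation eps \<omega> \<Omega> \<theta> t\<bar> \<le> exp (- (f0 / eps) / 4 * t) * \<bar>deviation eps \<omega> \<Omega> \<theta> 0\<bar>"
    by (rule deviation_decay[OF sol eps dev(2) \<tau> _ t]) (use init dev(1)[OF \<open>0 \<in> {0..T}\<close>] in auto)
  then show "\<bar>\<omega> t - w t\<bar> \<le> 1 * exp (- (f0 / 4) * t / eps) * \<bar>\<omega> 0 - w 0\<bar>"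
    using dev(1)[OF t] dev(1)[OF \<open>0 \<in> {0..T}\<close>] by (simp add: mult.commute)
qed

text \<open>On the graph the slow equation reads \<open>x' = - lam * x + lam * h\<close> with
  \<open>h\<close> of order \<open>eps\<close>; \<open>y\<close> is the difference from the exact
  exponential. Forward in time \<open>y\<close> is damped; backward it may grow, but \<theta>
  advances with \<open>t\<close> inside the box, so the elapsed time is at most
  \<open>t1 - t0\<close>.\<close>

lemma slow_flow_shift_M0: "slow_flow F lam k eps0 (\<lambda>eps. shift eps ` M0)"
proof -
  define B where "B = C + lam * R / f0"
  define E where "E = exp (2 * lam * (t1 - t0))"
  have B: "0 \<le> B" using C lam R f0 by (simp add: B_def)
  show ?thesis
    unfolding slow_flow_def
  proof (rule exI[of _ "B * E + B"], intro ballI allI impI, elim conjE)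
    fix eps \<omega> \<Omega> \<theta> a b t
    assume eps: "eps \<in> {0<..<eps0}" and 0: "0 \<in> {a..b}" and sol: "solution (field F lam eps) (\<lambda>t. (\<omega> t, \<Omega> t, \<theta> t)) {a..b}"
      and M: "\<forall>t\<in>{a..b}. (\<omega> t, \<Omega> t, \<theta> t) \<in> shift eps ` M0" and t: "t \<in> {a..b}"
    have sol': "solution (\<lambda>p. 1 *\<^sub>R field F lam eps p) (\<lambda>t. (\<omega> t, \<Omega> t, \<theta> t)) {a..b}" using sol by simp
    note der = solution_components[OF sol']
    define x h where "x t = \<Omega> t - kpi" and "h t = height eps (\<Omega> t, \<theta> t)" for t
    have \<omega>: "\<omega> s = h s - x s" and b: "(\<Omega> s, \<theta> s) \<in> box" if "s \<in> {a..b}" for s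
      using M that M0_box by (auto simp: mem_shift_M0 x_def h_def)
    have h: "\<bar>h s\<bar> \<le> B * eps" if "s \<in> {a..b}" for s
      using height_bounds(2)[OF eps b[OF that]] by (simp add: h_def B_def)
    have "((\<lambda>t. \<theta> t - t) has_real_derivative 0) (at s within {a..b})" if "s \<in> {a..b}" for s
      by (rule derivative_eq_intros der(3)[OF that] refl)+ simp
    then obtain c where c: "\<And>s. s \<in> {a..b} \<Longrightarrow> \<theta> s - s = c"
      using has_field_derivative_zero_constant[of "{a..b}" "\<lambda>t. \<theta> t - t"] by auto
    have \<theta>: "\<theta> t = \<theta> 0 + t" using c[OF t] c[OF 0] by simp
    have time: "\<bar>t\<bar> \<le> t1 - t0" using \<theta> b[OF t] b[OF 0] by (auto simp: box_def)
    define y where "y t = x t - x 0 * exp (- lam * t)" for t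
    have y: "(y has_real_derivative - lam * y s + lam * h s) (at s within {a..b})" if s: "s \<in> {a..b}" for s
      unfolding y_def[abs_def] x_def[abs_def]
      by (rule derivative_eq_intros der(2)[OF s] refl)+ (simp add: \<omega>[OF s] x_def algebra_simps)
    have y0: "y 0 = 0" by (simp add: y_def)
    have E: "1 \<le> E" using time lam by (simp add: E_def)
    have yb: "\<bar>y t\<bar> \<le> B * eps * E"
    proof (cases "0 \<le> t")
      case True
      have "\<bar>y t\<bar> \<le> B * eps"
      proof (rule linear_ode_bound[where e = y and a = 0 and b = b and p = "\<lambda>_. lam" and r = "\<lambda>s. lam * h s"])
        fix s assume s: "s \<in> {0..b}"
        then have s': "s \<in> {a..b}" using 0 by auto
        show "(y has_real_derivative - lam * y s + lam * h s) (at s within {0..b})"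
          by (rule has_field_derivative_subset[OF y[OF s']]) (use 0 in auto)
        show "\<bar>lam * h s\<bar> \<le> B * eps * lam"
          using mult_left_mono[OF h[OF s'], of lam] lam by (simp add: abs_mult mult.commute)
      qed (use True t y0 B eps in auto)
      also have "\<dots> \<le> B * eps * E" using mult_left_mono[OF E, of "B * eps"] B eps by simp
      finally show ?thesis .
    next
      case False
      \<comment> \<open>Under time reversal \<open>y\<close> has growth rate \<open>lam\<close>. The
        factor \<open>exp (- (2 * lam) * s)\<close> turns this into damping at the same rate, and
        undoing it costs at most \<open>E\<close>.\<close>
      define v where "v s = y (- s) * exp (- (2 * lam) * s)" for s
      have v: "\<bar>v (- t)\<bar> \<le> B * eps"
      proof (rule linear_ode_bound[where e = v and a = 0 and b = "- a" and p = "\<lambda>_. lam" and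
            r = "\<lambda>s. - lam * h (- s) * exp (- (2 * lam) * s)"])
        fix s assume s: "s \<in> {0..-a}"
        then have s': "- s \<in> {a..b}" using 0 by auto
        have "(y has_real_derivative - lam * y (- s) + lam * h (- s)) (at (- s) within uminus ` {0..-a})"
          by (rule has_field_derivative_subset[OF y[OF s']]) (use 0 in auto)
        then have "(y \<circ> uminus has_real_derivative (- lam * y (- s) + lam * h (- s)) * -1) (at s within {0..-a})"
          by (rule DERIV_image_chain) (auto intro!: derivative_eq_intros)
        then have ym: "((\<lambda>s. y (- s)) has_real_derivative (- lam * y (- s) + lam * h (- s)) * -1) (at s within {0..-a})"
          by (simp add: o_def)
        show "(v has_real_derivative - lam * v s + - lam * h (- s) * exp (- (2 * lam) * s)) (at s within {0..-a})"
          unfolding v_def[abs_def] by (rule derivative_eq_intros ym refl)+ (simp add: algebra_simps)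
        have "\<bar>h (- s)\<bar> * exp (- (2 * lam) * s) \<le> B * eps * 1"
          using h[OF s'] B eps lam s by (intro mult_mono) auto
        from mult_left_mono[OF this, of lam] show "\<bar>- lam * h (- s) * exp (- (2 * lam) * s)\<bar> \<le> B * eps * lam"
          using lam by (simp add: abs_mult mult_ac)
      qed (use False t y0 B eps in \<open>auto simp: v_def\<close>)
      have "y t = v (- t) * exp (2 * lam * (- t))" by (simp add: v_def flip: exp_add)
      then have "\<bar>y t\<bar> = \<bar>v (- t)\<bar> * exp (2 * lam * (- t))" by (simp add: abs_mult)
      also have "\<dots> \<le> B * eps * E"
      proof (rule mult_mono[OF v])
        have "lam * - t \<le> lam * (t1 - t0)" using time lam by (intro mult_left_mono) auto
        then show "exp (2 * lam * - t) \<le> E" by (simp add: E_def mult.assoc)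
      qed (use B eps in auto)
      finally show ?thesis .
    qed
    have "0 \<le> B * eps" using B eps by simp
    show "\<bar>\<omega> t - - (\<Omega> 0 - kpi) * exp (- lam * t)\<bar> \<le> (B * E + B) * eps \<and>
        \<bar>\<Omega> t - (kpi + (\<Omega> 0 - kpi) * exp (- lam * t))\<bar> \<le> (B * E + B) * eps \<and> \<theta> t = \<theta> 0 + t"
    proof (intro conjI \<theta>)
      have "(B * E + B) * eps = B * eps * E + B * eps" by (simp add: algebra_simps)
      moreover have "\<omega> t - - (\<Omega> 0 - kpi) * exp (- lam * t) = h t - y t"
        by (simp add: \<omega>[OF t] y_def x_def algebra_simps)
      moreover have "\<Omega> t - (kpi + (\<Omega> 0 - kpi) * exp (- lam * t)) = y t"
        by (simp add: y_def x_def algebra_simps)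
      ultimately show "\<bar>\<omega> t - - (\<Omega> 0 - kpi) * exp (- lam * t)\<bar> \<le> (B * E + B) * eps"
        "\<bar>\<Omega> t - (kpi + (\<Omega> 0 - kpi) * exp (- lam * t))\<bar> \<le> (B * E + B) * eps"
        using h[OF t] yb \<open>0 \<le> B * eps\<close> by (simp_all only:)
    qed
  qed
qed

lemma perturbs_to_shift_M0:
  assumes sign: "(\<forall>t\<in>{t0<..<t1}. 0 < G t) \<or> (\<forall>t\<in>{t0<..<t1}. G t < 0)"
  shows "perturbs_to F lam k M0 eps0 (\<lambda>eps. shift eps ` M0)"
proof -
  have powi: "(-1) powi (k + 1) * F t = - G t" for t
    by (cases "even k") (simp_all add: G_def power_int_minus_left)
  obtain \<omega> \<Omega> \<theta> where p: "(\<omega>, \<Omega>, \<theta>) \<in> M0" using crit unfolding critical_manifold_def by auto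
  have strip: "t \<in> {t0<..<t1}" if "(w, v, t) \<in> M0" for w v t using that M0_box by (force simp: box_def)
  have topo: "compact (shift eps ` M0)" "simply_connected (shift eps ` M0)" if "eps \<in> {0<..<eps0}" for eps
  proof -
    have hom: "M0 homeomorphic shift eps ` M0" using homeomorphism_shift_M0[OF that] unfolding homeomorphic_def by blast
    show "compact (shift eps ` M0)"
      using homeomorphic_compactness[OF hom] crit unfolding critical_manifold_def by blast
    show "simply_connected (shift eps ` M0)"
      using homeomorphic_simply_connected[OF hom] crit unfolding critical_manifold_def by blast
  qed
  have "if \<forall>(\<omega>, \<Omega>, \<theta>)\<in>M0. (-1) powi (k + 1) * F \<theta> < 0
      then attracting (field F lam) eps0 (\<lambda>eps. shift eps ` M0) else repelling (field F lam) eps0 (\<lambda>eps. shift eps ` M0)"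
    using sign
  proof
    assume pos: "\<forall>t\<in>{t0<..<t1}. 0 < G t"
    then have "f0 \<le> 1 * G t" if "t \<in> {t0<..<t1}" for t using F(1)[OF that] abs_G[of t] that by force
    then have "attracting (field F lam) eps0 (\<lambda>eps. shift eps ` M0)" using attracting_shift_M0[of 1] by simp
    moreover have all: "\<forall>(\<omega>, \<Omega>, \<theta>)\<in>M0. (-1) powi (k + 1) * F \<theta> < 0"
      using pos strip by (auto simp: powi)
    ultimately show ?thesis by (subst if_P[OF all])
  next
    assume neg: "\<forall>t\<in>{t0<..<t1}. G t < 0"
    then have "f0 \<le> (-1) * G t" if "t \<in> {t0<..<t1}" for t using F(1)[OF that] abs_G[of t] that by force
    then have "repelling (field F lam) eps0 (\<lambda>eps. shift eps ` M0)"
      using attracting_shift_M0[of "-1"] by (simp add: repelling_def)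
    \<comment> \<open>Here nonemptiness of \<open>M0\<close> enters: over an empty set the
      attracting condition would hold vacuously.\<close>
    moreover have "\<not> (\<forall>(\<omega>, \<Omega>, \<theta>)\<in>M0. (-1) powi (k + 1) * F \<theta> < 0)"
      using neg strip[OF p] p by (force simp: powi)
    ultimately show ?thesis by (subst if_not_P)
  qed
  then show ?thesis
    unfolding perturbs_to_def
    using slow_manifold_shift_M0 locally_invariant_shift_M0 topo slow_expansion_shift_M0 slow_flow_shift_M0 by blast
qed

end

end

section \<open>Critical discs\<close>

lemma slow_graph_mono:
  assumes "slow_graph G l R t0 t1 C eps H H'" "C \<le> D"
  shows "slow_graph G l R t0 t1 D eps H H'"
proof -
  have "C * eps\<^sup>2 \<le> D * eps\<^sup>2" using assms(2) by (intro mult_right_mono) auto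
  then show ?thesis using assms unfolding slow_graph_def by (auto intro: order_trans)
qed

lemma nonzero_sign:
  fixes G :: "real \<Rightarrow> real"
  assumes "continuous_on {a..b} G" "\<And>t. t \<in> {a..b} \<Longrightarrow> G t \<noteq> 0"
  shows "(\<forall>t\<in>{a..b}. 0 < G t) \<or> (\<forall>t\<in>{a..b}. G t < 0)"
proof (rule ccontr)
  assume "\<not> ?thesis"
  then obtain s t where "s \<in> {a..b}" "t \<in> {a..b}" "G s < 0" "0 < G t"
    using assms(2) by (metis linorder_neqE_linordered_idom)
  moreover have "connected (G ` {a..b})" by (rule connected_continuous_image[OF assms(1)]) simp
  ultimately have "0 \<in> G ` {a..b}" by (meson connectedD_interval image_eqI less_imp_le)
  then show False using assms(2) by force
qed

text \<open>The threshold precedes the quantifiers over \<open>j\<close> and \<open>M0\<close>,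
  since infinitely many manifolds have to exist for the same \<open>eps\<close>. The index enters
  through its parity only, after centring at its own multiple of pi. Admitting every smaller
  \<open>eps1\<close> allows thresholds of both parities to be replaced by their minimum.\<close>

lemma perturbs_to_uniform:
  assumes F: "smooth_on UNIV F" "\<And>t. t \<in> {t0..t1} \<Longrightarrow> F t \<noteq> 0" and "t0 < t1" "0 < R" "0 < lam"
  shows "\<exists>eps0>0. \<forall>eps1 j M0. 0 < eps1 \<longrightarrow> eps1 \<le> eps0 \<longrightarrow> even j = even (k :: int) \<longrightarrow> critical_manifold F j M0 \<longrightarrow>
    (\<forall>(\<omega>, \<Omega>, \<theta>)\<in>M0. \<bar>\<Omega> - of_int j * pi\<bar> < R \<and> t0 < \<theta> \<and> \<theta> < t1) \<longrightarrow> (\<exists>M. perturbs_to F lam j M0 eps1 M)"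
proof -
  define G where "G t = (-1) powi k * F t" for t
  have G: "smooth_on UNIV G"
    unfolding smooth_on_def G_def[abs_def]
  proof
    show "Ck_on n UNIV (\<lambda>t. (-1) powi k * F t)" for n
      by (rule Ck_on_mult[OF open_UNIV Ck_on_const[OF open_UNIV]]) (use F(1) in \<open>simp add: smooth_on_def\<close>)
  qed
  have Fc: "continuous_on {t0..t1} F" and Gc: "continuous_on {t0..t1} G"
    using F(1) G Ck_on_imp_continuous_on continuous_on_subset unfolding smooth_on_def by blast+
  have sign: "(\<forall>t\<in>{t0..t1}. 0 < G t) \<or> (\<forall>t\<in>{t0..t1}. G t < 0)"
    by (rule nonzero_sign[OF Gc]) (use F(2) in \<open>simp add: G_def\<close>)
  obtain e0 C0 where e0: "e0 > 0" "\<And>eps. eps \<in> {0<..<e0} \<Longrightarrow> \<exists>H H'. slow_graph G lam R t0 t1 C0 eps H H'"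
    using slow_graph_exists[OF G sign \<open>t0 < t1\<close> \<open>0 < R\<close>] by blast
  define C where "C = \<bar>C0\<bar>"
  have "continuous_on {t0..t1} (\<lambda>t. \<bar>F t\<bar>)" by (intro continuous_intros Fc)
  then obtain f0 where f0: "f0 > 0" "\<And>t. t \<in> {t0..t1} \<Longrightarrow> f0 \<le> \<bar>F t\<bar>"
    using positive_on_Icc_lower_bound[of t0 t1 "\<lambda>t. \<bar>F t\<bar>"] F(2) by auto
  obtain f1 where f1: "\<And>t. t \<in> {t0..t1} \<Longrightarrow> \<bar>F t\<bar> \<le> f1" using abs_bounded_on_Icc[OF Fc] by blast
  obtain H H' where H: "\<And>eps. eps \<in> {0<..<e0} \<Longrightarrow> slow_graph G lam R t0 t1 C eps (H eps) (H' eps)"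
    using e0(2) slow_graph_mono[of G lam R t0 t1 C0 _ _ _ C] unfolding C_def by (metis abs_ge_self)
  define eps0 where "eps0 = min (min e0 1) (min (f0 / (4 * (lam * (1 + C)))) (1 / (2 * (C + lam * R / f0))))"
  have pos: "0 < lam * (1 + C)" "0 < C + lam * R / f0" "0 \<le> C"
    using assms(4,5) f0(1) by (auto simp: C_def intro: add_nonneg_pos)
  have "0 < eps0" using e0(1) f0(1) pos by (simp add: eps0_def)
  moreover have "\<exists>M. perturbs_to F lam j M0 eps1 M"
    if eps1: "0 < eps1" "eps1 \<le> eps0" and j: "even j = even k" and crit: "critical_manifold F j M0"
      and strip: "\<forall>(\<omega>, \<Omega>, \<theta>)\<in>M0. \<bar>\<Omega> - of_int j * pi\<bar> < R \<and> t0 < \<theta> \<and> \<theta> < t1" for eps1 j M0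
  proof -
    have Gj: "G = (\<lambda>t. (-1) powi j * F t)" using j by (simp add: G_def[abs_def] power_int_minus_left)
    interpret slow_graph_family F lam j R t0 t1 C f0 f1 eps1 H H'
    proof
      show "slow_graph (\<lambda>t. (-1) powi j * F t) lam R t0 t1 C eps (H eps) (H' eps)" if "eps \<in> {0<..<eps1}" for eps
        using H[of eps] that eps1 unfolding Gj[symmetric] by (simp add: eps0_def)
      have "eps1 \<le> f0 / (4 * (lam * (1 + C)))" "eps1 \<le> 1 / 2 / (C + lam * R / f0)"
        using eps1(2) unfolding eps0_def by auto
      moreover have "0 < 4 * (lam * (1 + C))" using pos(1) by simp
      ultimately have "eps1 * (4 * (lam * (1 + C))) \<le> f0" "eps1 * (C + lam * R / f0) \<le> 1 / 2"
        by (simp_all only: pos_le_divide_eq[OF pos(2)] pos_le_divide_eq)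
      then show "4 * (lam * (1 + C)) * eps1 \<le> f0" "(C + lam * R / f0) * eps1 \<le> 1 / 2"
        by (simp_all only: mult.commute[of eps1])
    qed (use assms(4,5) pos f0 f1 eps1 in \<open>auto simp: eps0_def\<close>)
    have "snd ` M0 \<subseteq> box" using strip by (fastforce simp: box_def abs_less_iff)
    moreover have "(\<forall>t\<in>{t0<..<t1}. 0 < slow_graph_family.G F j t) \<or> (\<forall>t\<in>{t0<..<t1}. slow_graph_family.G F j t < 0)"
      using sign unfolding Gj G_def by auto
    ultimately show ?thesis using perturbs_to_shift_M0[OF crit] by blast
  qed
  ultimately show ?thesis by blast
qed

text \<open>The projection of a compact connected set to the \<theta>-axis is a closed interval on
  which \<open>F\<close> has no zero; the open set \<open>F \<noteq> 0\<close> leaves room to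
  enlarge it at both ends.\<close>

lemma critical_manifold_strip:
  assumes F: "continuous_on UNIV F" and crit: "critical_manifold F k M0"
  shows "\<exists>R t0 t1. 0 < R \<and> t0 < t1 \<and> (\<forall>t\<in>{t0..t1}. F t \<noteq> 0) \<and>
    (\<forall>(\<omega>, \<Omega>, \<theta>)\<in>M0. \<bar>\<Omega> - of_int k * pi\<bar> < R \<and> t0 < \<theta> \<and> \<theta> < t1)"
proof -
  have M0: "M0 \<noteq> {}" "compact M0" "connected M0" and F0: "\<And>p. p \<in> M0 \<Longrightarrow> F (snd (snd p)) \<noteq> 0"
    using crit simply_connected_imp_connected[of M0] unfolding critical_manifold_def by auto
  have c: "continuous_on M0 (\<lambda>p. snd (snd p))" "continuous_on M0 (\<lambda>p. fst (snd p) - of_int k * pi)"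
    by (intro continuous_intros)+
  have "connected ((\<lambda>p. snd (snd p)) ` M0)" "compact ((\<lambda>p. snd (snd p)) ` M0)"
    using connected_continuous_image[OF c(1) M0(3)] compact_continuous_image[OF c(1) M0(2)] by auto
  then obtain a b where ab: "(\<lambda>p. snd (snd p)) ` M0 = {a..b}"
    using connected_compact_interval_1 by (metis box_real(2))
  have le: "a \<le> b" using M0(1) ab by force
  have "open {t. F t \<noteq> 0}"
    using open_vimage[OF open_Compl[OF closed_singleton[of 0]] F] by (simp add: vimage_def)
  moreover have ab0: "F t \<noteq> 0" if "t \<in> {a..b}" for t using that F0 unfolding ab[symmetric] by auto
  then have "a \<in> {t. F t \<noteq> 0}" "b \<in> {t. F t \<noteq> 0}" using le by auto
  ultimately obtain d e where d: "d > 0" "cball a d \<subseteq> {t. F t \<noteq> 0}" and e: "e > 0" "cball b e \<subseteq> {t. F t \<noteq> 0}"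
    unfolding open_contains_cball by metis
  have "F t \<noteq> 0" if "t \<in> {a - d..b + e}" for t
  proof -
    have "t \<in> {a..b} \<or> t \<in> cball a d \<or> t \<in> cball b e"
      using that le d(1) e(1) by (auto simp: dist_real_def abs_le_iff)
    then show ?thesis using ab0 d(2) e(2) by auto
  qed
  moreover have "bounded ((\<lambda>p. fst (snd p) - of_int k * pi) ` M0)"
    by (rule compact_imp_bounded[OF compact_continuous_image[OF c(2) M0(2)]])
  then obtain B where B: "\<And>p. p \<in> M0 \<Longrightarrow> \<bar>fst (snd p) - of_int k * pi\<bar> \<le> B"
    unfolding bounded_real by auto
  have "\<bar>fst (snd p) - of_int k * pi\<bar> < \<bar>B\<bar> + 1 \<and> a - d < snd (snd p) \<and> snd (snd p) < b + e"
    if "p \<in> M0" for p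
  proof -
    have "snd (snd p) \<in> {a..b}" unfolding ab[symmetric] using that by (rule imageI)
    then show ?thesis using B[OF that] d(1) e(1) by simp
  qed
  then have "\<forall>(\<omega>, \<Omega>, \<theta>)\<in>M0. \<bar>\<Omega> - of_int k * pi\<bar> < \<bar>B\<bar> + 1 \<and> a - d < \<theta> \<and> \<theta> < b + e"
    by (simp add: case_prod_unfold)
  moreover have "a - d < b + e" "0 < \<bar>B\<bar> + 1" using d(1) e(1) le by auto
  ultimately show ?thesis by blast
qed

section \<open>Round discs in the critical planes\<close>

lemma Ck_on_divide:
  fixes f g :: "'a::euclidean_space \<Rightarrow> real"
  assumes "open S" "Ck_on n S f" "Ck_on n S g" "\<And>x. x \<in> S \<Longrightarrow> g x \<noteq> 0"
  shows "Ck_on n S (\<lambda>x. f x / g x)"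
proof -
  have "Ck_on n S (\<lambda>x. inverse (g x))"
    by (rule Ck_on_compose[OF assms(1) _ _ assms(3) Ck_on_inverse]) (use assms(4) in \<open>auto intro: open_Compl\<close>)
  from Ck_on_mult[OF assms(1,2) this] show ?thesis by (simp add: divide_inverse)
qed

text \<open>A disc rather than a rectangle, because \<open>smooth_surface\<close> admits edges but
  no corners.\<close>

definition critical_disc :: "int \<Rightarrow> real \<Rightarrow> real \<Rightarrow> state set" where
  "critical_disc k th0 r = {(\<omega>, \<Omega>, \<theta>). \<Omega> + \<omega> = of_int k * pi \<and> (\<Omega> - of_int k * pi)\<^sup>2 + (\<theta> - th0)\<^sup>2 \<le> r\<^sup>2}"

text \<open>Inversion in a circle centred at a boundary point maps the rest of the disc onto a half-plane.\<close>

lemma critical_disc_chart: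
  assumes P: "P\<^sup>2 = r\<^sup>2" "P \<noteq> 0" and p: "(fst (snd p), snd (snd p)) \<noteq> (of_int k * pi + P, th0)"
  shows "straightens_to (critical_disc k th0 r) {(x, y, z). x = 0 \<and> y \<ge> 0} p"
proof -
  define c where "c = of_int k * pi"
  define N where "N p = (fst (snd p) - c - P)\<^sup>2 + (snd (snd p) - th0)\<^sup>2" for p :: state
  \<comment> \<open>The first coordinate measures the distance from the critical plane. The bounding
    circle passes through the centre of inversion, so it becomes a line; the factor
    \<open>- 2 * P\<close> and the shift by \<open>- 1\<close> move that line to
    \<open>y = 0\<close>.\<close>
  define f :: "state \<Rightarrow> state" where "f p = (fst p + fst (snd p) - c,
      - 1 - 2 * P * ((fst (snd p) - c - P) / N p), (snd (snd p) - th0) / N p)" for p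
  define \<xi> where "\<xi> q = - (1 + fst (snd q)) / (2 * P)" for q :: state
  define K where "K q = (\<xi> q)\<^sup>2 + (snd (snd q))\<^sup>2" for q :: state
  define g :: "state \<Rightarrow> state" where "g q = (fst q - (P + \<xi> q / K q), c + P + \<xi> q / K q, th0 + snd (snd q) / K q)" for q
  define U V where "U = {p. N p \<noteq> 0}" and "V = {q. K q \<noteq> 0}"
  have N: "Ck_on n UNIV N" for n
    unfolding N_def[abs_def] power2_eq_square
    by (intro Ck_on_add Ck_on_mult Ck_on_diff open_UNIV Ck_on_const Ck_on_linear bounded_linear_intros)
  have \<xi>: "Ck_on n UNIV \<xi>" for n
    unfolding \<xi>_def[abs_def]
    by (intro Ck_on_divide Ck_on_minus Ck_on_add open_UNIV Ck_on_const Ck_on_linear bounded_linear_intros)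
       (use P in simp)
  have K: "Ck_on n UNIV K" for n
    unfolding K_def[abs_def] power2_eq_square
    by (intro Ck_on_add Ck_on_mult \<xi> open_UNIV Ck_on_linear bounded_linear_intros)
  have "open (N -` (- {0}))" "open (K -` (- {0}))"
    using N[of 0] K[of 0] by (auto intro!: open_vimage)
  then have UV: "open U" "open V" by (auto simp: U_def V_def vimage_def)
  have sub: "Ck_on n UNIV q \<Longrightarrow> Ck_on n U q" "Ck_on n UNIV q \<Longrightarrow> Ck_on n V q" for n and q :: "state \<Rightarrow> real"
    by (auto intro: Ck_on_subset)
  have sf: "smooth_on U f"
    unfolding smooth_on_def f_def[abs_def]
    by (intro allI Ck_on_Pair Ck_on_add Ck_on_diff Ck_on_mult Ck_on_divide UV sub(1)[OF N] Ck_on_const Ck_on_linear bounded_linear_intros)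
       (simp_all add: U_def)
  have sg: "smooth_on V g"
    unfolding smooth_on_def g_def[abs_def]
    by (intro allI Ck_on_Pair Ck_on_add Ck_on_diff Ck_on_mult Ck_on_divide UV sub(2)[OF K] sub(2)[OF \<xi>] Ck_on_const Ck_on_linear bounded_linear_intros)
       (simp_all add: V_def)
  \<comment> \<open>Dividing a vector by its squared length inverts that length; hence inversion
    undoes itself, which gives both composites of \<open>f\<close> and \<open>g\<close>.\<close>
  have inv: "(a / n)\<^sup>2 + (b / n)\<^sup>2 = 1 / n" if "n = a\<^sup>2 + b\<^sup>2" "n \<noteq> 0" for a b n :: real
  proof -
    have "(a / n)\<^sup>2 + (b / n)\<^sup>2 = (a\<^sup>2 + b\<^sup>2) / n\<^sup>2" by (simp add: power_divide add_divide_distrib)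
    then show ?thesis using that by (simp add: power2_eq_square)
  qed
  have fU: "f u \<in> V" "g (f u) = u" if "u \<in> U" for u
  proof -
    have n: "N u \<noteq> 0" using that by (simp add: U_def)
    have "- (1 + (- 1 - 2 * P * q)) / (2 * P) = q" for q using P(2) by simp
    then have x: "\<xi> (f u) = (fst (snd u) - c - P) / N u" by (simp only: \<xi>_def f_def fst_conv snd_conv)
    have K: "K (f u) = 1 / N u" using inv[OF N_def n] unfolding K_def x by (simp add: f_def)
    show "f u \<in> V" using n by (simp add: V_def K)
    show "g (f u) = u" using n unfolding g_def x K by (cases u) (simp add: f_def)
  qed
  have gV: "g v \<in> U" "f (g v) = v" if "v \<in> V" for v
  proof -
    have k: "K v \<noteq> 0" using that by (simp add: V_def)
    have N: "N (g v) = 1 / K v" using inv[OF K_def k] by (simp add: N_def g_def)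
    show "g v \<in> U" using k by (simp add: U_def N)
    show "f (g v) = v" using k P(2) unfolding f_def N by (cases v) (simp add: g_def \<xi>_def)
  qed
  have hom: "homeomorphism U V f g"
  proof (rule homeomorphismI)
    show "continuous_on U f" "continuous_on V g"
      using sf sg Ck_on_imp_continuous_on unfolding smooth_on_def by blast+
  qed (use fU gV in auto)
  have half: "u \<in> critical_disc k th0 r \<longleftrightarrow> f u \<in> {(x, y, z). x = 0 \<and> y \<ge> 0}" if "u \<in> U" for u
  proof -
    obtain \<omega> \<Omega> \<theta> where u: "u = (\<omega>, \<Omega>, \<theta>)" by (cases u)
    have n: "N u > 0" using that by (simp add: U_def N_def sum_power2_gt_zero_iff)
    have "0 \<le> - 1 - 2 * P * ((\<Omega> - c - P) / N u) \<longleftrightarrow> 2 * P * (\<Omega> - c - P) + N u \<le> 0"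
      using n by (simp add: field_simps)
    also have "\<dots> \<longleftrightarrow> (\<Omega> - c)\<^sup>2 + (\<theta> - th0)\<^sup>2 \<le> r\<^sup>2"
      unfolding P(1)[symmetric] N_def u by (simp add: power2_eq_square algebra_simps)
    finally show ?thesis by (auto simp: u critical_disc_def f_def c_def add.commute)
  qed
  have "f ` (critical_disc k th0 r \<inter> U) = {(x, y, z). x = 0 \<and> y \<ge> 0} \<inter> V"
  proof (intro equalityI subsetI)
    fix v assume "v \<in> f ` (critical_disc k th0 r \<inter> U)"
    then obtain u where u: "u \<in> critical_disc k th0 r" "u \<in> U" "v = f u" by blast
    show "v \<in> {(x, y, z). x = 0 \<and> y \<ge> 0} \<inter> V"
      unfolding u(3) by (rule IntI) (use half[OF u(2)] u(1) fU(1)[OF u(2)] in \<open>simp_all only:\<close>)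
  next
    fix v assume v: "v \<in> {(x, y, z). x = 0 \<and> y \<ge> 0} \<inter> V"
    then have vV: "v \<in> V" and vH: "v \<in> {(x, y, z). x = 0 \<and> y \<ge> 0}" by (rule IntD2, rule IntD1)
    have "g v \<in> critical_disc k th0 r"
      using half[OF gV(1)[OF vV]] vH unfolding gV(2)[OF vV] by (simp only:)
    then show "v \<in> f ` (critical_disc k th0 r \<inter> U)"
      by (intro image_eqI[of v f "g v", OF gV(2)[OF vV, symmetric]] IntI gV(1)[OF vV])
  qed
  moreover have "p \<in> U" using p by (auto simp: U_def N_def c_def sum_power2_eq_zero_iff)
  ultimately show ?thesis 
    unfolding straightens_to_def
    by (intro exI[of _ U] exI[of _ V] exI[of _ f] exI[of _ g] conjI UV sf sg hom)
qed

lemma critical_disc_eq_image: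
  assumes "0 < r"
  shows "critical_disc k th0 r = (\<lambda>q. (of_int k * pi - fst q, q)) ` cball (of_int k * pi, th0) r"
proof -
  have "q \<in> cball (of_int k * pi, th0) r \<longleftrightarrow> (fst q - of_int k * pi)\<^sup>2 + (snd q - th0)\<^sup>2 \<le> r\<^sup>2" for q :: "real \<times> real"
  proof -
    have "q \<in> cball (of_int k * pi, th0) r \<longleftrightarrow> sqrt ((fst q - of_int k * pi)\<^sup>2 + (snd q - th0)\<^sup>2) \<le> r"
      by (simp add: dist_prod_def dist_real_def power2_commute)
    also have "\<dots> \<longleftrightarrow> (fst q - of_int k * pi)\<^sup>2 + (snd q - th0)\<^sup>2 \<le> r\<^sup>2"
      using assms by (metis less_imp_le real_sqrt_le_iff real_sqrt_abs abs_of_pos)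
    finally show ?thesis .
  qed
  then show ?thesis by (force simp: critical_disc_def image_iff)
qed

lemma snd_critical_disc: "0 < r \<Longrightarrow> snd ` critical_disc k th0 r = cball (of_int k * pi, th0) r"
  by (simp add: critical_disc_eq_image image_image)

lemma critical_manifold_critical_disc:
  assumes "0 < r" "\<And>t. t \<in> {th0 - r..th0 + r} \<Longrightarrow> F t \<noteq> 0"
  shows "critical_manifold F k (critical_disc k th0 r)"
proof -
  have hom: "homeomorphism (cball (of_int k * pi, th0) r) (critical_disc k th0 r) (\<lambda>q. (of_int k * pi - fst q, q)) snd"
    unfolding critical_disc_eq_image[OF assms(1)]
    by (rule homeomorphismI) (auto intro!: continuous_intros)
  then have homic: "cball (of_int k * pi, th0) r homeomorphic critical_disc k th0 r"
    unfolding homeomorphic_def by blast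
  have "smooth_surface (critical_disc k th0 r)"
    unfolding smooth_surface_def
  proof
    fix p assume "p \<in> critical_disc k th0 r"
    \<comment> \<open>Each chart misses only its own centre of inversion, so the two antipodal
      centres suffice. A half-plane chart need not send \<open>p\<close> to the edge, hence interior
      points are covered as well.\<close>
    show "straightens_to (critical_disc k th0 r) {(x, y, z). x = 0} p \<or>
        straightens_to (critical_disc k th0 r) {(x, y, z). x = 0 \<and> y \<ge> 0} p"
    proof (cases "(fst (snd p), snd (snd p)) = (of_int k * pi + r, th0)")
      case True
      then show ?thesis using critical_disc_chart[of "- r" r p k th0] assms(1) by auto
    next
      case False
      then show ?thesis using critical_disc_chart[of r r p k th0] assms(1) by auto
    qed
  qed
  moreover have "F \<theta> \<noteq> 0" if "(\<omega>, \<Omega>, \<theta>) \<in> critical_disc k th0 r" for \<omega> \<Omega> \<theta>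
  proof -
    have "(\<Omega> - of_int k * pi)\<^sup>2 + (\<theta> - th0)\<^sup>2 \<le> r\<^sup>2" using that by (simp add: critical_disc_def)
    then have "(\<theta> - th0)\<^sup>2 \<le> r\<^sup>2" using zero_le_power2[of "\<Omega> - of_int k * pi"] by linarith
    then have "\<bar>\<theta> - th0\<bar> \<le> r" using assms(1) by (simp add: abs_le_square_iff[symmetric])
    then show ?thesis by (intro assms(2)) auto
  qed
  moreover have "compact (critical_disc k th0 r)" using homeomorphic_compactness[OF homic] compact_cball by blast
  moreover have "simply_connected (critical_disc k th0 r)"
    using homeomorphic_simply_connected[OF homic] convex_imp_simply_connected[OF convex_cball] by blast
  moreover have "(0, of_int k * pi, th0) \<in> critical_disc k th0 r" by (simp add: critical_disc_def)
  then have "critical_disc k th0 r \<noteq> {}" by blast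
  moreover have "\<Omega> + \<omega> = of_int k * pi" if "(\<omega>, \<Omega>, \<theta>) \<in> critical_disc k th0 r" for \<omega> \<Omega> \<theta>
    using that by (simp add: critical_disc_def)
  ultimately show ?thesis unfolding critical_manifold_def by auto
qed

text \<open>The graph form in \<open>slow_expansion\<close> preserves the projection to the slow
  variables, and the projected discs have the distinct centres \<open>of_int k * pi\<close>.\<close>

lemma inj_perturbed_discs:
  assumes "\<And>k. slow_expansion F lam k (critical_disc k th0 r) eps0 (M k)" "eps \<in> {0<..<eps0}" "0 < r"
  shows "inj (\<lambda>k. M k eps)"
proof (rule injI)
  have M: "snd ` M k eps = cball (of_int k * pi, th0) r" for k
  proof -
    obtain h where "M k eps = (\<lambda>(\<omega>, \<Omega>, \<theta>). (h eps \<Omega> \<theta>, \<Omega>, \<theta>)) ` critical_disc k th0 r"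
      using assms(1)[of k] assms(2) unfolding slow_expansion_def by blast
    then have "snd ` M k eps = snd ` critical_disc k th0 r" by (simp add: image_image case_prod_unfold)
    then show ?thesis using snd_critical_disc[OF assms(3)] by simp
  qed
  fix i j assume "M i eps = M j eps"
  then have "cball (of_int i * pi, th0) r = cball (of_int j * pi, th0) r" using M by metis
  then show "i = j" using assms(3) by (simp add: cball_eq_cball_iff)
qed

theorem theorem1:
  fixes F :: "real \<Rightarrow> real" and lam :: real
  assumes "smooth_on UNIV F"
    and "\<exists>\<theta>. F \<theta> \<noteq> 0"
    and "lam > 0"
  shows "(\<exists>\<epsilon>0>0. \<exists>M0 M.
            (\<forall>k::int. critical_manifold F k (M0 k) \<and> perturbs_to F lam k (M0 k) \<epsilon>0 (M k)) \<and>
            (\<forall>\<epsilon>\<in>{0<..<\<epsilon>0}. inj (\<lambda>k. M k \<epsilon>))) \<and>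
         (\<forall>(k::int) M0. critical_manifold F k M0 \<longrightarrow>
            (\<exists>\<epsilon>0>0. \<exists>M. perturbs_to F lam k M0 \<epsilon>0 M))"
proof (intro conjI allI impI)
  have Fc: "continuous_on UNIV F" using assms(1) Ck_on_imp_continuous_on unfolding smooth_on_def by blast
  show "\<exists>eps0>0. \<exists>M. perturbs_to F lam k M0 eps0 M" if crit: "critical_manifold F k M0" for k M0
  proof -
    obtain R t0 t1 where strip: "0 < R" "t0 < t1" "\<And>t. t \<in> {t0..t1} \<Longrightarrow> F t \<noteq> 0"
      "\<forall>(\<omega>, \<Omega>, \<theta>)\<in>M0. \<bar>\<Omega> - of_int k * pi\<bar> < R \<and> t0 < \<theta> \<and> \<theta> < t1"
      using critical_manifold_strip[OF Fc crit] by blast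
    show ?thesis
      using perturbs_to_uniform[OF assms(1) strip(3,2,1) assms(3), of k] crit strip(4) by blast
  qed
  obtain th0 where "F th0 \<noteq> 0" using assms(2) by blast
  moreover have "open {t. F t \<noteq> 0}"
    using open_vimage[OF open_Compl[OF closed_singleton[of 0]] Fc] by (simp add: vimage_def)
  ultimately obtain d where d: "d > 0" "cball th0 d \<subseteq> {t. F t \<noteq> 0}" unfolding open_contains_cball by blast
  \<comment> \<open>Half of \<open>d\<close>, so that the closed discs lie in the open strip of
    half-width \<open>d\<close> around their centres.\<close>
  define r where "r = d / 2"
  have r: "0 < r" "r < d" using d(1) by (auto simp: r_def)
  have F0: "F t \<noteq> 0" if "t \<in> {th0 - d..th0 + d}" for t
    using that d(2) by (auto simp: dist_real_def subset_iff abs_le_iff)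
  have crit: "critical_manifold F k (critical_disc k th0 r)" for k
    by (rule critical_manifold_critical_disc[OF r(1) F0]) (use r in auto)
  have strip: "\<forall>(\<omega>, \<Omega>, \<theta>)\<in>critical_disc k th0 r. \<bar>\<Omega> - of_int k * pi\<bar> < d \<and> th0 - d < \<theta> \<and> \<theta> < th0 + d" for k
  proof clarify
    fix \<omega> \<Omega> \<theta> assume "(\<omega>, \<Omega>, \<theta>) \<in> critical_disc k th0 r"
    then have "(\<Omega> - of_int k * pi)\<^sup>2 + (\<theta> - th0)\<^sup>2 \<le> r\<^sup>2" by (simp add: critical_disc_def)
    then have "(\<Omega> - of_int k * pi)\<^sup>2 \<le> r\<^sup>2" "(\<theta> - th0)\<^sup>2 \<le> r\<^sup>2"
      using zero_le_power2[of "\<Omega> - of_int k * pi"] zero_le_power2[of "\<theta> - th0"] by linarith+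
    then have "\<bar>\<Omega> - of_int k * pi\<bar> \<le> r" "\<bar>\<theta> - th0\<bar> \<le> r" using r(1) by (simp_all add: abs_le_square_iff[symmetric])
    then show "\<bar>\<Omega> - of_int k * pi\<bar> < d \<and> th0 - d < \<theta> \<and> \<theta> < th0 + d" using r by linarith
  qed
  have "th0 - d < th0 + d" using d(1) by simp
  note uniform = perturbs_to_uniform[OF assms(1) F0 this d(1) assms(3)]
  \<comment> \<open>One threshold per parity, with 0 and 1 as representatives; their minimum serves
    every index.\<close>
  obtain e0 where e0: "e0 > 0" "\<And>eps1 j M0. 0 < eps1 \<Longrightarrow> eps1 \<le> e0 \<Longrightarrow> even j \<Longrightarrow> critical_manifold F j M0 \<Longrightarrow>
      (\<forall>(\<omega>, \<Omega>, \<theta>)\<in>M0. \<bar>\<Omega> - of_int j * pi\<bar> < d \<and> th0 - d < \<theta> \<and> \<theta> < th0 + d) \<Longrightarrow> \<exists>M. perturbs_to F lam j M0 eps1 M"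
    using uniform[of 0] by auto
  obtain e1 where e1: "e1 > 0" "\<And>eps1 j M0. 0 < eps1 \<Longrightarrow> eps1 \<le> e1 \<Longrightarrow> odd j \<Longrightarrow> critical_manifold F j M0 \<Longrightarrow>
      (\<forall>(\<omega>, \<Omega>, \<theta>)\<in>M0. \<bar>\<Omega> - of_int j * pi\<bar> < d \<and> th0 - d < \<theta> \<and> \<theta> < th0 + d) \<Longrightarrow> \<exists>M. perturbs_to F lam j M0 eps1 M"
    using uniform[of 1] by auto
  have "\<exists>M. perturbs_to F lam k (critical_disc k th0 r) (min e0 e1) M" for k
    using e0(2)[OF _ _ _ crit strip, of "min e0 e1" k] e1(2)[OF _ _ _ crit strip, of "min e0 e1" k] e0(1) e1(1)
    by (cases "even k") auto
  then obtain M where M: "\<And>k. perturbs_to F lam k (critical_disc k th0 r) (min e0 e1) (M k)" by metis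
  have "slow_expansion F lam k (critical_disc k th0 r) (min e0 e1) (M k)" for k
    using M unfolding perturbs_to_def by blast
  note inj = inj_perturbed_discs[OF this _ r(1)]
  then show "\<exists>eps0>0. \<exists>M0 M. (\<forall>k::int. critical_manifold F k (M0 k) \<and> perturbs_to F lam k (M0 k) eps0 (M k)) \<and>
      (\<forall>eps\<in>{0<..<eps0}. inj (\<lambda>k. M k eps))"
    using crit M inj e0(1) e1(1)
    by (intro exI[of _ "min e0 e1"] conjI exI[of _ "\<lambda>k. critical_disc k th0 r"] exI[of _ M]) auto
qed

end
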